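(* Let $T$ be a quasitriangular Hopf monad on an autonomous category $\mathcal{C}$. Any twist $\theta$ for $T$ yields a twist $\Theta$ on $T\text{-}\mathcal{C}$ as follows: $$\Theta_{(M,r)}=r\,\theta_M\colon(M,r)\to(M,r)$$ for any $T$-module $(M,r)$. This assignment gives a bijection between twists for $T$ and twists on $T\text{-}\mathcal{C}$. Moreover, in this correspondence, $\theta$ is self-dual (and so $T$ is ribbon) if and only if $\Theta$ is self-dual (and so $T\text{-}\mathcal{C}$ is ribbon).
   Context: Conventions: categories are small, monoidal categories $(\mathcal{C},\otimes,\mathbf 1)$ are strict; composition of $f$ followed by $g$ is written $gf$; "functorial" means natural. Monads: a monad on $\mathcal{C}$ is $(T,\mu\colon T^2\to T,\eta\colon 1_{\mathcal C}\to T)$ with $\mu_XT(\mu_X)=\mu_X\mu_{T(X)}$, $\mu_X\eta_{T(X)}=\mathrm{id}=\mu_XT(\eta_X)$. A $T$-module is $(M,r)$ with $r\colon T(M)\to M$, $rT(r)=r\mu_M$, $r\eta_M=\mathrm{id}_M$; morphisms $f\colon(M,r)\to(N,s)$ satisfy $fr=sT(f)$. $T\text{-}\mathcal{C}$ is the category of $T$-modules. Bimonads: a bimonad on a monoidal category $\mathcal{C}$ is a monad $T$ equipped with natural $T_2(X,Y)\colon T(X\otimes Y)\to T(X)\otimes T(Y)$ and $T_0\colon T(\mathbf 1)\to\mathbf 1$ with $(\mathrm{id}\otimes T_2(Y,Z))T_2(X,Y\otimes Z)=(T_2(X,Y)\otimes \mathrm{id})T_2(X\otimes Y,Z)$, $(\mathrm{id}\otimes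 T_0)T_2(X,\mathbf 1)=\mathrm{id}=(T_0\otimes\mathrm{id})T_2(\mathbf 1,X)$, $T_2(X,Y)\mu_{X\otimes Y}=(\mu_X\otimes\mu_Y)T_2(T(X),T(Y))T(T_2(X,Y))$, $T_0\mu_{\mathbf 1}=T_0T(T_0)$, $T_2(X,Y)\eta_{X\otimes Y}=\eta_X\otimes\eta_Y$, $T_0\eta_{\mathbf 1}=\mathrm{id}_{\mathbf 1}$. Then $T\text{-}\mathcal{C}$ is monoidal with $(M,r)\otimes(N,s)=(M\otimes N,(r\otimes s)T_2(M,N))$ and unit $(\mathbf 1,T_0)$. Hopf monads: $\mathcal{C}$ is autonomous if each object has a (chosen) left dual $({}^\vee X,\mathrm{ev}_X\colon{}^\vee X\otimes X\to\mathbf 1,\mathrm{coev}_X\colon\mathbf 1\to X\otimes{}^\vee X)$ and right dual $(X^\vee,\widetilde{\mathrm{ev}}_X\colon X\otimes X^\vee\to\mathbf 1,\widetilde{\mathrm{coev}}_X\colon\mathbf 1\to X^\vee\otimes X)$. A Hopf monad is a bimonad $T$ on an autonomous category admitting a left and a right antipode. A left antipode is a functorial family $s^l_X\colon T({}^\vee T(X))\to{}^\vee X$ with $T_0T(\mathrm{ev}_X)T({}^\vee\eta_X\otimes\mathrm{id}_X)=\mathrm{ev}_{T(X)}(s^l_{T(X)}T({}^\vee\mu_X)\otimes\mathrm{id}_{T(X)})T_2({}^\vee T(X),X)$ and $(\eta_X\otimes\mathrm{id}_{{}^\vee X})\mathrm{coev}_XT_0=(\mu_X\otimes s^l_X)T_2(T(X),{}^\vee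 T(X))T(\mathrm{coev}_{T(X)})$. A right antipode is a functorial family $s^r_X\colon T(T(X)^\vee)\to X^\vee$ with $T_0T(\widetilde{\mathrm{ev}}_X)T(\mathrm{id}_X\otimes\eta_X^\vee)=\widetilde{\mathrm{ev}}_{T(X)}(\mathrm{id}_{T(X)}\otimes s^r_{T(X)}T(\mu_X^\vee))T_2(X,T(X)^\vee)$ and $(\mathrm{id}_{X^\vee}\otimes\eta_X)\widetilde{\mathrm{coev}}_XT_0=(s^r_X\otimes\mu_X)T_2(T(X)^\vee,T(X))T(\widetilde{\mathrm{coev}}_{T(X)})$. Then $T\text{-}\mathcal{C}$ is autonomous, with ${}^\vee(M,r)=({}^\vee M,s^l_MT({}^\vee r))$, $(M,r)^\vee=(M^\vee,s^r_MT(r^\vee))$ and evaluations/coevaluations those of $\mathcal{C}$. Quasitriangular: $T$ is quasitriangular if it is equipped with an R-matrix, i.e. a natural family $R_{X,Y}\colon X\otimes Y\to T(Y)\otimes T(X)$ which is $*$-invertible (there is a natural $R^{*-1}_{X,Y}\colon Y\otimes X\to T(X)\otimes T(Y)$ with $(\mu_X\otimes\mu_Y)R^{*-1}_{T(X),T(Y)}R_{X,Y}=\eta_X\otimes\eta_Y$ and $(\mu_Y\otimes\mu_X)R_{T(X),T(Y)}R^{*-1}_{X,Y}=\eta_Y\otimes\eta_X$) and satisfies, for all $X,Y,Z$: $(\mu_Y\otimes\mu_X)R_{T(X),T(Y)}T_2(X,Y)=(\mu_Y\otimes\mu_X)T_2(T(Y),T(X))T(R_{X,Y})$; $(\mathrm{id}_{T(Z)}\otimes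 T_2(X,Y))R_{X\otimes Y,Z}=(\mu_Z\otimes\mathrm{id})(R_{X,T(Z)}\otimes\mathrm{id}_{T(Y)})(\mathrm{id}_X\otimes R_{Y,Z})$; $(T_2(Y,Z)\otimes\mathrm{id}_{T(X)})R_{X,Y\otimes Z}=(\mathrm{id}\otimes\mu_X)(\mathrm{id}_{T(Y)}\otimes R_{T(X),Z})(R_{X,Y}\otimes\mathrm{id}_Z)$. The category $T\text{-}\mathcal{C}$ is then braided with $\tau_{(M,r),(N,s)}=(s\otimes r)R_{M,N}$. Twists for $T$: a twist for the quasitriangular bimonad $T$ is a natural transformation $\theta\colon1_{\mathcal C}\to T$ which is central ($\mu_X\theta_{T(X)}=\mu_XT(\theta_X)$ for all $X$), $*$-invertible (there is natural $\theta'\colon1_{\mathcal C}\to T$ with $\mu_X\theta'_{T(X)}\theta_X=\eta_X=\mu_X\theta_{T(X)}\theta'_X$), and satisfies $T_2(X,Y)\theta_{X\otimes Y}=(\mu_X\theta_{T(X)}\mu_X\otimes\mu_Y\theta_{T(Y)}\mu_Y)R_{T(Y),T(X)}R_{X,Y}$ for all $X,Y$. It is self-dual if ${}^\vee\theta_X=s^l_X\theta_{{}^\vee T(X)}$ for all $X$. A ribbon Hopf monad is a quasitriangular Hopf monad on an autonomous category endowed with a self-dual twist. Twists on a braided category $(\mathcal{B},\tau)$: a natural automorphism $\Theta$ of $1_{\mathcal B}$ with $\Theta_{X\otimes Y}=(\Theta_X\otimes\Theta_Y)\tau_{Y,X}\tau_{X,Y}$. If $\mathcal{B}$ is autonomous,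 $\Theta$ is self-dual if ${}^\vee(\Theta_X)=\Theta_{{}^\vee X}$ for all $X$. A ribbon category is a braided autonomous category endowed with a self-dual twist. *)

theory Defs
  imports "HOL-Library.FuncSet"
begin

section \<open>Categories\<close>

text \<open>
  A small category is given by a set of objects and a family of hom-sets. Hom-sets are not
  required to be disjoint, which lets a category of modules have literally the same arrows as
  the base category: a morphism of modules is a morphism between the underlying objects
  satisfying an equation. Composition is written in the order of function application.
\<close>

record ('o, 'm) category =
  Obj :: "'o set"
  Hom :: "'o \<Rightarrow> 'o \<Rightarrow> 'm set"
  Comp :: "'m \<Rightarrow> 'm \<Rightarrow> 'm"  (infixr "\<cdot>\<index>" 65)
  Id :: "'o \<Rightarrow> 'm"

locale category =
  fixes C :: "('o, 'm, 'a) category_scheme" (structure)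
  assumes Comp_in_Hom:
      "\<lbrakk>X \<in> Obj C; Y \<in> Obj C; Z \<in> Obj C; f \<in> Hom C X Y; g \<in> Hom C Y Z\<rbrakk>
        \<Longrightarrow> g \<cdot> f \<in> Hom C X Z"
    and Comp_assoc:
      "\<lbrakk>W \<in> Obj C; X \<in> Obj C; Y \<in> Obj C; Z \<in> Obj C;
        f \<in> Hom C W X; g \<in> Hom C X Y; h \<in> Hom C Y Z\<rbrakk>
        \<Longrightarrow> (h \<cdot> g) \<cdot> f = h \<cdot> (g \<cdot> f)"
    and Id_in_Hom: "X \<in> Obj C \<Longrightarrow> Id C X \<in> Hom C X X"
    and Comp_Id: "\<lbrakk>X \<in> Obj C; Y \<in> Obj C; f \<in> Hom C X Y\<rbrakk> \<Longrightarrow> f \<cdot> Id C X = f"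
    and Id_Comp: "\<lbrakk>X \<in> Obj C; Y \<in> Obj C; f \<in> Hom C X Y\<rbrakk> \<Longrightarrow> Id C Y \<cdot> f = f"

definition iso :: "('o, 'm, 'a) category_scheme \<Rightarrow> 'o \<Rightarrow> 'o \<Rightarrow> 'm set" where
  "iso C X Y = {f \<in> Hom C X Y. \<exists>g \<in> Hom C Y X. g \<cdot>\<^bsub>C\<^esub> f = Id C X \<and> f \<cdot>\<^bsub>C\<^esub> g = Id C Y}"


section \<open>Strict monoidal, braided and autonomous categories\<close>

text \<open>The tensor product is written \<open>\<odot>\<close> on objects and \<open>\<otimes>\<close> on morphisms.\<close>

record ('o, 'm) monoidal = "('o, 'm) category" +
  tensor_obj :: "'o \<Rightarrow> 'o \<Rightarrow> 'o"  (infixr "\<odot>\<index>" 70)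
  tensor_arr :: "'m \<Rightarrow> 'm \<Rightarrow> 'm"  (infixr "\<otimes>\<index>" 70)
  unit_obj :: "'o"  ("\<one>\<index>")

locale strict_monoidal_category = category C
  for C :: "('o, 'm, 'a) monoidal_scheme" (structure) +
  assumes unit_in_Obj: "\<one> \<in> Obj C"
    and tensor_in_Obj: "\<lbrakk>X \<in> Obj C; Y \<in> Obj C\<rbrakk> \<Longrightarrow> X \<odot> Y \<in> Obj C"
    and tensor_in_Hom:
      "\<lbrakk>X \<in> Obj C; Y \<in> Obj C; X' \<in> Obj C; Y' \<in> Obj C; f \<in> Hom C X X'; g \<in> Hom C Y Y'\<rbrakk>
        \<Longrightarrow> f \<otimes> g \<in> Hom C (X \<odot> Y) (X' \<odot> Y')"
    and tensor_Id: "\<lbrakk>X \<in> Obj C; Y \<in> Obj C\<rbrakk> \<Longrightarrow> Id C X \<otimes> Id C Y = Id C (X \<odot> Y)"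
    and tensor_Comp:
      "\<lbrakk>X \<in> Obj C; Y \<in> Obj C; X' \<in> Obj C; Y' \<in> Obj C; X'' \<in> Obj C; Y'' \<in> Obj C;
        f \<in> Hom C X X'; f' \<in> Hom C X' X''; g \<in> Hom C Y Y'; g' \<in> Hom C Y' Y''\<rbrakk>
        \<Longrightarrow> (f' \<cdot> f) \<otimes> (g' \<cdot> g) = (f' \<otimes> g') \<cdot> (f \<otimes> g)"
    and tensor_obj_assoc:
      "\<lbrakk>X \<in> Obj C; Y \<in> Obj C; Z \<in> Obj C\<rbrakk> \<Longrightarrow> (X \<odot> Y) \<odot> Z = X \<odot> (Y \<odot> Z)"
    and unit_tensor_obj: "X \<in> Obj C \<Longrightarrow> \<one> \<odot> X = X"
    and tensor_unit_obj: "X \<in> Obj C \<Longrightarrow> X \<odot> \<one> = X"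
    and tensor_arr_assoc:
      "\<lbrakk>X \<in> Obj C; Y \<in> Obj C; Z \<in> Obj C; X' \<in> Obj C; Y' \<in> Obj C; Z' \<in> Obj C;
        f \<in> Hom C X X'; g \<in> Hom C Y Y'; h \<in> Hom C Z Z'\<rbrakk>
        \<Longrightarrow> (f \<otimes> g) \<otimes> h = f \<otimes> (g \<otimes> h)"
    and unit_tensor_arr:
      "\<lbrakk>X \<in> Obj C; X' \<in> Obj C; f \<in> Hom C X X'\<rbrakk> \<Longrightarrow> Id C \<one> \<otimes> f = f"
    and tensor_unit_arr:
      "\<lbrakk>X \<in> Obj C; X' \<in> Obj C; f \<in> Hom C X X'\<rbrakk> \<Longrightarrow> f \<otimes> Id C \<one> = f"

locale braided_category = strict_monoidal_category C
  for C :: "('o, 'm, 'a) monoidal_scheme" (structure) +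
  fixes \<tau> :: "'o \<Rightarrow> 'o \<Rightarrow> 'm"
  assumes braiding_iso: "\<lbrakk>X \<in> Obj C; Y \<in> Obj C\<rbrakk> \<Longrightarrow> \<tau> X Y \<in> iso C (X \<odot> Y) (Y \<odot> X)"
    and braiding_natural:
      "\<lbrakk>X \<in> Obj C; Y \<in> Obj C; X' \<in> Obj C; Y' \<in> Obj C; f \<in> Hom C X X'; g \<in> Hom C Y Y'\<rbrakk>
        \<Longrightarrow> (g \<otimes> f) \<cdot> \<tau> X Y = \<tau> X' Y' \<cdot> (f \<otimes> g)"
    and braiding_tensor_right:
      "\<lbrakk>X \<in> Obj C; Y \<in> Obj C; Z \<in> Obj C\<rbrakk>
        \<Longrightarrow> \<tau> X (Y \<odot> Z) = (Id C Y \<otimes> \<tau> X Z) \<cdot> (\<tau> X Y \<otimes> Id C Z)"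
    and braiding_tensor_left:
      "\<lbrakk>X \<in> Obj C; Y \<in> Obj C; Z \<in> Obj C\<rbrakk>
        \<Longrightarrow> \<tau> (X \<odot> Y) Z = (\<tau> X Z \<otimes> Id C Y) \<cdot> (Id C X \<otimes> \<tau> Y Z)"

record ('o, 'm) autonomous = "('o, 'm) monoidal" +
  ldual :: "'o \<Rightarrow> 'o"
  left_ev :: "'o \<Rightarrow> 'm"
  left_coev :: "'o \<Rightarrow> 'm"
  rdual :: "'o \<Rightarrow> 'o"
  right_ev :: "'o \<Rightarrow> 'm"
  right_coev :: "'o \<Rightarrow> 'm"

locale autonomous_category = strict_monoidal_category C
  for C :: "('o, 'm, 'a) autonomous_scheme" (structure) +
  assumes ldual_in_Obj: "X \<in> Obj C \<Longrightarrow> ldual C X \<in> Obj C"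
    and left_ev_in_Hom: "X \<in> Obj C \<Longrightarrow> left_ev C X \<in> Hom C (ldual C X \<odot> X) \<one>"
    and left_coev_in_Hom: "X \<in> Obj C \<Longrightarrow> left_coev C X \<in> Hom C \<one> (X \<odot> ldual C X)"
    and ldual_zigzag:
      "X \<in> Obj C \<Longrightarrow> (Id C X \<otimes> left_ev C X) \<cdot> (left_coev C X \<otimes> Id C X) = Id C X"
      "X \<in> Obj C \<Longrightarrow>
        (left_ev C X \<otimes> Id C (ldual C X)) \<cdot> (Id C (ldual C X) \<otimes> left_coev C X) = Id C (ldual C X)"
    and rdual_in_Obj: "X \<in> Obj C \<Longrightarrow> rdual C X \<in> Obj C"
    and right_ev_in_Hom: "X \<in> Obj C \<Longrightarrow> right_ev C X \<in> Hom C (X \<odot> rdual C X) \<one>"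
    and right_coev_in_Hom: "X \<in> Obj C \<Longrightarrow> right_coev C X \<in> Hom C \<one> (rdual C X \<odot> X)"
    and rdual_zigzag:
      "X \<in> Obj C \<Longrightarrow> (right_ev C X \<otimes> Id C X) \<cdot> (Id C X \<otimes> right_coev C X) = Id C X"
      "X \<in> Obj C \<Longrightarrow>
        (Id C (rdual C X) \<otimes> right_ev C X) \<cdot> (right_coev C X \<otimes> Id C (rdual C X)) = Id C (rdual C X)"

text \<open>
  The duals \<open>\<^sup>\<or>f : \<^sup>\<or>Y \<rightarrow> \<^sup>\<or>X\<close> and \<open>f\<^sup>\<or> : Y\<^sup>\<or> \<rightarrow> X\<^sup>\<or>\<close> of a morphism \<open>f : X \<rightarrow> Y\<close>; the arguments
  \<open>X\<close> and \<open>Y\<close> are needed because an arrow does not determine its domain and codomain.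
\<close>

definition ldual_arr :: "('o, 'm, 'a) autonomous_scheme \<Rightarrow> 'o \<Rightarrow> 'o \<Rightarrow> 'm \<Rightarrow> 'm" where
  "ldual_arr C X Y f =
    (left_ev C Y \<otimes>\<^bsub>C\<^esub> Id C (ldual C X)) \<cdot>\<^bsub>C\<^esub>
    (Id C (ldual C Y) \<otimes>\<^bsub>C\<^esub> f \<otimes>\<^bsub>C\<^esub> Id C (ldual C X)) \<cdot>\<^bsub>C\<^esub>
    (Id C (ldual C Y) \<otimes>\<^bsub>C\<^esub> left_coev C X)"

definition rdual_arr :: "('o, 'm, 'a) autonomous_scheme \<Rightarrow> 'o \<Rightarrow> 'o \<Rightarrow> 'm \<Rightarrow> 'm" where
  "rdual_arr C X Y f =
    (Id C (rdual C X) \<otimes>\<^bsub>C\<^esub> right_ev C Y) \<cdot>\<^bsub>C\<^esub>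
    (Id C (rdual C X) \<otimes>\<^bsub>C\<^esub> f \<otimes>\<^bsub>C\<^esub> Id C (rdual C Y)) \<cdot>\<^bsub>C\<^esub>
    (right_coev C X \<otimes>\<^bsub>C\<^esub> Id C (rdual C Y))"


section \<open>Twists on braided categories, ribbon categories\<close>

locale braided_twist = braided_category C \<tau>
  for C :: "('o, 'm, 'a) monoidal_scheme" (structure) and \<tau> +
  fixes \<Theta> :: "'o \<Rightarrow> 'm"
  assumes twist_iso: "X \<in> Obj C \<Longrightarrow> \<Theta> X \<in> iso C X X"
    and twist_natural:
      "\<lbrakk>X \<in> Obj C; Y \<in> Obj C; f \<in> Hom C X Y\<rbrakk> \<Longrightarrow> f \<cdot> \<Theta> X = \<Theta> Y \<cdot> f"
    and twist_tensor:
      "\<lbrakk>X \<in> Obj C; Y \<in> Obj C\<rbrakk> \<Longrightarrow> \<Theta> (X \<odot> Y) = (\<Theta> X \<otimes> \<Theta> Y) \<cdot> \<tau> Y X \<cdot> \<tau> X Y"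

definition self_dual_braided_twist ::
    "('o, 'm, 'a) autonomous_scheme \<Rightarrow> ('o \<Rightarrow> 'm) \<Rightarrow> bool" where
  "self_dual_braided_twist C \<Theta> \<longleftrightarrow>
    (\<forall>X \<in> Obj C. ldual_arr C X X (\<Theta> X) = \<Theta> (ldual C X))"

locale ribbon_category = autonomous_category C + braided_twist C \<tau> \<Theta>
  for C :: "('o, 'm, 'a) autonomous_scheme" (structure) and \<tau> \<Theta> +
  assumes self_dual: "self_dual_braided_twist C \<Theta>"

text \<open>
  Families indexed by the objects are HOL functions; requiring them to be \<^const>\<open>undefined\<close>
  outside the set of objects makes equality of functions the equality of families.
\<close>

definition braided_twists ::
    "('o, 'm, 'a) monoidal_scheme \<Rightarrow> ('o \<Rightarrow> 'o \<Rightarrow> 'm) \<Rightarrow> ('o \<Rightarrow> 'm) set" where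
  "braided_twists C \<tau> = {\<Theta> \<in> extensional (Obj C). braided_twist C \<tau> \<Theta>}"


section \<open>Monads, bimonads and Hopf monads\<close>

record ('o, 'm) monad =
  fobj :: "'o \<Rightarrow> 'o"
  farr :: "'m \<Rightarrow> 'm"
  mu :: "'o \<Rightarrow> 'm"
  eta :: "'o \<Rightarrow> 'm"

locale monad = category C
  for C :: "('o, 'm, 'a) category_scheme" (structure) +
  fixes T :: "('o, 'm, 'b) monad_scheme"
  assumes fobj_in_Obj: "X \<in> Obj C \<Longrightarrow> fobj T X \<in> Obj C"
    and farr_in_Hom:
      "\<lbrakk>X \<in> Obj C; Y \<in> Obj C; f \<in> Hom C X Y\<rbrakk> \<Longrightarrow> farr T f \<in> Hom C (fobj T X) (fobj T Y)"
    and farr_Id: "X \<in> Obj C \<Longrightarrow> farr T (Id C X) = Id C (fobj T X)"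
    and farr_Comp:
      "\<lbrakk>X \<in> Obj C; Y \<in> Obj C; Z \<in> Obj C; f \<in> Hom C X Y; g \<in> Hom C Y Z\<rbrakk>
        \<Longrightarrow> farr T (g \<cdot> f) = farr T g \<cdot> farr T f"
    and mu_in_Hom: "X \<in> Obj C \<Longrightarrow> mu T X \<in> Hom C (fobj T (fobj T X)) (fobj T X)"
    and mu_natural:
      "\<lbrakk>X \<in> Obj C; Y \<in> Obj C; f \<in> Hom C X Y\<rbrakk>
        \<Longrightarrow> farr T f \<cdot> mu T X = mu T Y \<cdot> farr T (farr T f)"
    and eta_in_Hom: "X \<in> Obj C \<Longrightarrow> eta T X \<in> Hom C X (fobj T X)"
    and eta_natural:
      "\<lbrakk>X \<in> Obj C; Y \<in> Obj C; f \<in> Hom C X Y\<rbrakk> \<Longrightarrow> farr T f \<cdot> eta T X = eta T Y \<cdot> f"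
    and mu_assoc: "X \<in> Obj C \<Longrightarrow> mu T X \<cdot> farr T (mu T X) = mu T X \<cdot> mu T (fobj T X)"
    and mu_eta: "X \<in> Obj C \<Longrightarrow> mu T X \<cdot> eta T (fobj T X) = Id C (fobj T X)"
    and mu_farr_eta: "X \<in> Obj C \<Longrightarrow> mu T X \<cdot> farr T (eta T X) = Id C (fobj T X)"

record ('o, 'm) bimonad = "('o, 'm) monad" +
  T2 :: "'o \<Rightarrow> 'o \<Rightarrow> 'm"
  T0 :: "'m"

locale bimonad = strict_monoidal_category C + monad C T
  for C :: "('o, 'm, 'a) monoidal_scheme" (structure)
    and T :: "('o, 'm, 'b) bimonad_scheme" +
  assumes T2_in_Hom:
      "\<lbrakk>X \<in> Obj C; Y \<in> Obj C\<rbrakk> \<Longrightarrow> T2 T X Y \<in> Hom C (fobj T (X \<odot> Y)) (fobj T X \<odot> fobj T Y)"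
    and T2_natural:
      "\<lbrakk>X \<in> Obj C; Y \<in> Obj C; X' \<in> Obj C; Y' \<in> Obj C; f \<in> Hom C X X'; g \<in> Hom C Y Y'\<rbrakk>
        \<Longrightarrow> (farr T f \<otimes> farr T g) \<cdot> T2 T X Y = T2 T X' Y' \<cdot> farr T (f \<otimes> g)"
    and T0_in_Hom: "T0 T \<in> Hom C (fobj T \<one>) \<one>"
    and T2_coassoc:
      "\<lbrakk>X \<in> Obj C; Y \<in> Obj C; Z \<in> Obj C\<rbrakk>
        \<Longrightarrow> (Id C (fobj T X) \<otimes> T2 T Y Z) \<cdot> T2 T X (Y \<odot> Z)
          = (T2 T X Y \<otimes> Id C (fobj T Z)) \<cdot> T2 T (X \<odot> Y) Z"
    and T2_counit_right:
      "X \<in> Obj C \<Longrightarrow> (Id C (fobj T X) \<otimes> T0 T) \<cdot> T2 T X \<one> = Id C (fobj T X)"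
    and T2_counit_left:
      "X \<in> Obj C \<Longrightarrow> (T0 T \<otimes> Id C (fobj T X)) \<cdot> T2 T \<one> X = Id C (fobj T X)"
    and T2_mu:
      "\<lbrakk>X \<in> Obj C; Y \<in> Obj C\<rbrakk>
        \<Longrightarrow> T2 T X Y \<cdot> mu T (X \<odot> Y)
          = (mu T X \<otimes> mu T Y) \<cdot> T2 T (fobj T X) (fobj T Y) \<cdot> farr T (T2 T X Y)"
    and T0_mu: "T0 T \<cdot> mu T \<one> = T0 T \<cdot> farr T (T0 T)"
    and T2_eta: "\<lbrakk>X \<in> Obj C; Y \<in> Obj C\<rbrakk> \<Longrightarrow> T2 T X Y \<cdot> eta T (X \<odot> Y) = eta T X \<otimes> eta T Y"
    and T0_eta: "T0 T \<cdot> eta T \<one> = Id C \<one>"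

text \<open>
  Antipodes are unique if they exist, so a Hopf monad may be taken to come with its two
  antipodes \<open>sl\<close> and \<open>sr\<close>.
\<close>

locale hopf_monad = autonomous_category C + bimonad C T
  for C :: "('o, 'm, 'a) autonomous_scheme" (structure)
    and T :: "('o, 'm, 'b) bimonad_scheme" +
  fixes sl sr :: "'o \<Rightarrow> 'm"
  assumes sl_in_Hom:
      "X \<in> Obj C \<Longrightarrow> sl X \<in> Hom C (fobj T (ldual C (fobj T X))) (ldual C X)"
    and sl_natural:
      "\<lbrakk>X \<in> Obj C; Y \<in> Obj C; f \<in> Hom C X Y\<rbrakk>
        \<Longrightarrow> ldual_arr C X Y f \<cdot> sl Y
          = sl X \<cdot> farr T (ldual_arr C (fobj T X) (fobj T Y) (farr T f))"
    and sl_ev: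
      "X \<in> Obj C \<Longrightarrow>
        T0 T \<cdot> farr T (left_ev C X) \<cdot> farr T (ldual_arr C X (fobj T X) (eta T X) \<otimes> Id C X)
        = left_ev C (fobj T X)
          \<cdot> ((sl (fobj T X) \<cdot> farr T (ldual_arr C (fobj T (fobj T X)) (fobj T X) (mu T X)))
              \<otimes> Id C (fobj T X))
          \<cdot> T2 T (ldual C (fobj T X)) X"
    and sl_coev:
      "X \<in> Obj C \<Longrightarrow>
        (eta T X \<otimes> Id C (ldual C X)) \<cdot> left_coev C X \<cdot> T0 T
        = (mu T X \<otimes> sl X) \<cdot> T2 T (fobj T X) (ldual C (fobj T X)) \<cdot> farr T (left_coev C (fobj T X))"
    and sr_in_Hom:
      "X \<in> Obj C \<Longrightarrow> sr X \<in> Hom C (fobj T (rdual C (fobj T X))) (rdual C X)"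
    and sr_natural:
      "\<lbrakk>X \<in> Obj C; Y \<in> Obj C; f \<in> Hom C X Y\<rbrakk>
        \<Longrightarrow> rdual_arr C X Y f \<cdot> sr Y
          = sr X \<cdot> farr T (rdual_arr C (fobj T X) (fobj T Y) (farr T f))"
    and sr_ev:
      "X \<in> Obj C \<Longrightarrow>
        T0 T \<cdot> farr T (right_ev C X) \<cdot> farr T (Id C X \<otimes> rdual_arr C X (fobj T X) (eta T X))
        = right_ev C (fobj T X)
          \<cdot> (Id C (fobj T X)
              \<otimes> (sr (fobj T X) \<cdot> farr T (rdual_arr C (fobj T (fobj T X)) (fobj T X) (mu T X))))
          \<cdot> T2 T X (rdual C (fobj T X))"
    and sr_coev:
      "X \<in> Obj C \<Longrightarrow>
        (Id C (rdual C X) \<otimes> eta T X) \<cdot> right_coev C X \<cdot> T0 T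
        = (sr X \<otimes> mu T X) \<cdot> T2 T (rdual C (fobj T X)) (fobj T X) \<cdot> farr T (right_coev C (fobj T X))"


section \<open>The category of modules over a Hopf monad\<close>

definition modules ::
    "('o, 'm, 'a) category_scheme \<Rightarrow> ('o, 'm, 'b) monad_scheme \<Rightarrow> ('o \<times> 'm) set" where
  "modules C T = {(M, r). M \<in> Obj C \<and> r \<in> Hom C (fobj T M) M
     \<and> r \<cdot>\<^bsub>C\<^esub> farr T r = r \<cdot>\<^bsub>C\<^esub> mu T M \<and> r \<cdot>\<^bsub>C\<^esub> eta T M = Id C M}"

definition module_hom ::
    "('o, 'm, 'a) category_scheme \<Rightarrow> ('o, 'm, 'b) monad_scheme
      \<Rightarrow> 'o \<times> 'm \<Rightarrow> 'o \<times> 'm \<Rightarrow> 'm set" where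
  "module_hom C T = (\<lambda>(M, r) (N, s). {f \<in> Hom C M N. f \<cdot>\<^bsub>C\<^esub> r = s \<cdot>\<^bsub>C\<^esub> farr T f})"

definition module_category ::
    "('o, 'm, 'a) autonomous_scheme \<Rightarrow> ('o, 'm, 'b) bimonad_scheme
      \<Rightarrow> ('o \<Rightarrow> 'm) \<Rightarrow> ('o \<Rightarrow> 'm) \<Rightarrow> ('o \<times> 'm, 'm) autonomous" where
  "module_category C T sl sr = \<lparr>
     Obj = modules C T,
     Hom = module_hom C T,
     Comp = Comp C,
     Id = (\<lambda>(M, r). Id C M),
     tensor_obj = (\<lambda>(M, r) (N, s). (M \<odot>\<^bsub>C\<^esub> N, (r \<otimes>\<^bsub>C\<^esub> s) \<cdot>\<^bsub>C\<^esub> T2 T M N)),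
     tensor_arr = tensor_arr C,
     unit_obj = (\<one>\<^bsub>C\<^esub>, T0 T),
     ldual = (\<lambda>(M, r). (ldual C M, sl M \<cdot>\<^bsub>C\<^esub> farr T (ldual_arr C (fobj T M) M r))),
     left_ev = (\<lambda>(M, r). left_ev C M),
     left_coev = (\<lambda>(M, r). left_coev C M),
     rdual = (\<lambda>(M, r). (rdual C M, sr M \<cdot>\<^bsub>C\<^esub> farr T (rdual_arr C (fobj T M) M r))),
     right_ev = (\<lambda>(M, r). right_ev C M),
     right_coev = (\<lambda>(M, r). right_coev C M)\<rparr>"


section \<open>Quasitriangular structures and twists\<close>

locale quasitriangular_bimonad = bimonad C T
  for C :: "('o, 'm, 'a) monoidal_scheme" (structure)
    and T :: "('o, 'm, 'b) bimonad_scheme" +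
  fixes R :: "'o \<Rightarrow> 'o \<Rightarrow> 'm"
  assumes R_in_Hom:
      "\<lbrakk>X \<in> Obj C; Y \<in> Obj C\<rbrakk> \<Longrightarrow> R X Y \<in> Hom C (X \<odot> Y) (fobj T Y \<odot> fobj T X)"
    and R_natural:
      "\<lbrakk>X \<in> Obj C; Y \<in> Obj C; X' \<in> Obj C; Y' \<in> Obj C; f \<in> Hom C X X'; g \<in> Hom C Y Y'\<rbrakk>
        \<Longrightarrow> (farr T g \<otimes> farr T f) \<cdot> R X Y = R X' Y' \<cdot> (f \<otimes> g)"
    and R_star_invertible:
      "\<exists>R'.
        (\<forall>X \<in> Obj C. \<forall>Y \<in> Obj C. R' X Y \<in> Hom C (Y \<odot> X) (fobj T X \<odot> fobj T Y))
        \<and> (\<forall>X \<in> Obj C. \<forall>Y \<in> Obj C. \<forall>X' \<in> Obj C. \<forall>Y' \<in> Obj C.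
            \<forall>f \<in> Hom C X X'. \<forall>g \<in> Hom C Y Y'.
              (farr T f \<otimes> farr T g) \<cdot> R' X Y = R' X' Y' \<cdot> (g \<otimes> f))
        \<and> (\<forall>X \<in> Obj C. \<forall>Y \<in> Obj C.
            (mu T X \<otimes> mu T Y) \<cdot> R' (fobj T X) (fobj T Y) \<cdot> R X Y = eta T X \<otimes> eta T Y
            \<and> (mu T Y \<otimes> mu T X) \<cdot> R (fobj T X) (fobj T Y) \<cdot> R' X Y = eta T Y \<otimes> eta T X)"
    and R_T2:
      "\<lbrakk>X \<in> Obj C; Y \<in> Obj C\<rbrakk>
        \<Longrightarrow> (mu T Y \<otimes> mu T X) \<cdot> R (fobj T X) (fobj T Y) \<cdot> T2 T X Y
          = (mu T Y \<otimes> mu T X) \<cdot> T2 T (fobj T Y) (fobj T X) \<cdot> farr T (R X Y)"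
    and R_tensor_left:
      "\<lbrakk>X \<in> Obj C; Y \<in> Obj C; Z \<in> Obj C\<rbrakk>
        \<Longrightarrow> (Id C (fobj T Z) \<otimes> T2 T X Y) \<cdot> R (X \<odot> Y) Z
          = (mu T Z \<otimes> Id C (fobj T X \<odot> fobj T Y))
            \<cdot> (R X (fobj T Z) \<otimes> Id C (fobj T Y)) \<cdot> (Id C X \<otimes> R Y Z)"
    and R_tensor_right:
      "\<lbrakk>X \<in> Obj C; Y \<in> Obj C; Z \<in> Obj C\<rbrakk>
        \<Longrightarrow> (T2 T Y Z \<otimes> Id C (fobj T X)) \<cdot> R X (Y \<odot> Z)
          = (Id C (fobj T Y \<odot> fobj T Z) \<otimes> mu T X)
            \<cdot> (Id C (fobj T Y) \<otimes> R (fobj T X) Z) \<cdot> (R X Y \<otimes> Id C Z)"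

definition module_braiding ::
    "('o, 'm, 'a) monoidal_scheme \<Rightarrow> ('o \<Rightarrow> 'o \<Rightarrow> 'm) \<Rightarrow> 'o \<times> 'm \<Rightarrow> 'o \<times> 'm \<Rightarrow> 'm" where
  "module_braiding C R = (\<lambda>(M, r) (N, s). (s \<otimes>\<^bsub>C\<^esub> r) \<cdot>\<^bsub>C\<^esub> R M N)"

locale quasitriangular_hopf_monad = hopf_monad C T sl sr + quasitriangular_bimonad C T R
  for C :: "('o, 'm, 'a) autonomous_scheme" (structure)
    and T :: "('o, 'm, 'b) bimonad_scheme"
    and sl sr :: "'o \<Rightarrow> 'm"
    and R :: "'o \<Rightarrow> 'o \<Rightarrow> 'm"

locale bimonad_twist = quasitriangular_bimonad C T R
  for C :: "('o, 'm, 'a) monoidal_scheme" (structure)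
    and T :: "('o, 'm, 'b) bimonad_scheme"
    and R +
  fixes \<theta> :: "'o \<Rightarrow> 'm"
  assumes theta_in_Hom: "X \<in> Obj C \<Longrightarrow> \<theta> X \<in> Hom C X (fobj T X)"
    and theta_natural:
      "\<lbrakk>X \<in> Obj C; Y \<in> Obj C; f \<in> Hom C X Y\<rbrakk> \<Longrightarrow> farr T f \<cdot> \<theta> X = \<theta> Y \<cdot> f"
    and theta_central: "X \<in> Obj C \<Longrightarrow> mu T X \<cdot> \<theta> (fobj T X) = mu T X \<cdot> farr T (\<theta> X)"
    and theta_star_invertible:
      "\<exists>\<theta>'. (\<forall>X \<in> Obj C. \<theta>' X \<in> Hom C X (fobj T X))
        \<and> (\<forall>X \<in> Obj C. \<forall>Y \<in> Obj C. \<forall>f \<in> Hom C X Y. farr T f \<cdot> \<theta>' X = \<theta>' Y \<cdot> f)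
        \<and> (\<forall>X \<in> Obj C. mu T X \<cdot> \<theta>' (fobj T X) \<cdot> \<theta> X = eta T X
            \<and> mu T X \<cdot> \<theta> (fobj T X) \<cdot> \<theta>' X = eta T X)"
    and theta_tensor:
      "\<lbrakk>X \<in> Obj C; Y \<in> Obj C\<rbrakk>
        \<Longrightarrow> T2 T X Y \<cdot> \<theta> (X \<odot> Y)
          = ((mu T X \<cdot> \<theta> (fobj T X) \<cdot> mu T X) \<otimes> (mu T Y \<cdot> \<theta> (fobj T Y) \<cdot> mu T Y))
            \<cdot> R (fobj T Y) (fobj T X) \<cdot> R X Y"

definition bimonad_twists ::
    "('o, 'm, 'a) monoidal_scheme \<Rightarrow> ('o, 'm, 'b) bimonad_scheme
      \<Rightarrow> ('o \<Rightarrow> 'o \<Rightarrow> 'm) \<Rightarrow> ('o \<Rightarrow> 'm) set" where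
  "bimonad_twists C T R = {\<theta> \<in> extensional (Obj C). bimonad_twist C T R \<theta>}"

definition self_dual_bimonad_twist ::
    "('o, 'm, 'a) autonomous_scheme \<Rightarrow> ('o, 'm, 'b) bimonad_scheme
      \<Rightarrow> ('o \<Rightarrow> 'm) \<Rightarrow> ('o \<Rightarrow> 'm) \<Rightarrow> bool" where
  "self_dual_bimonad_twist C T sl \<theta> \<longleftrightarrow>
    (\<forall>X \<in> Obj C.
      ldual_arr C X (fobj T X) (\<theta> X) = sl X \<cdot>\<^bsub>C\<^esub> \<theta> (ldual C (fobj T X)))"

locale ribbon_hopf_monad = quasitriangular_hopf_monad C T sl sr R + bimonad_twist C T R \<theta>
  for C :: "('o, 'm, 'a) autonomous_scheme" (structure)
    and T :: "('o, 'm, 'b) bimonad_scheme"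
    and sl sr R \<theta> +
  assumes self_dual: "self_dual_bimonad_twist C T sl \<theta>"

definition module_twist ::
    "('o, 'm, 'a) category_scheme \<Rightarrow> ('o, 'm, 'b) monad_scheme
      \<Rightarrow> ('o \<Rightarrow> 'm) \<Rightarrow> 'o \<times> 'm \<Rightarrow> 'm" where
  "module_twist C T \<theta> = (\<lambda>(M, r) \<in> modules C T. r \<cdot>\<^bsub>C\<^esub> \<theta> M)"

end

theory Submission
  imports Defs
begin

text \<open>
  A twist \<open>\<theta>\<close> acts on every module by \<open>r \<theta>\<^sub>M\<close>, and it is recovered from this action on free
  modules as \<open>\<theta>\<^sub>X = \<Theta>\<^bsub>(TX, \<mu>)\<^esub> \<eta>\<^sub>X\<close>. Conversely the action \<open>r : (TM, \<mu>) \<rightarrow> (M, r)\<close> is linear, so by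
  naturality a twist \<open>\<Theta>\<close> on modules is determined by its values on free modules. The axioms of
  \<open>\<theta>\<close> and \<open>\<Theta>\<close> correspond: linearity of \<open>\<Theta>\<close> to centrality, and the tensor axioms through linearity
  of \<open>T\<^sub>2\<close>. Self-duality transfers because the dual action is \<open>s\<^sup>l T(\<^sup>\<or>r)\<close>.
\<close>

section \<open>Arrows with source and target\<close>

text \<open>The conclusion reaches beyond the correspondence: \<open>ribbon_category\<close>
  presupposes that modules form an autonomous category and \<open>braided_twist\<close> that they
  form a braided one, so both structures have to be derived from the axioms of \<open>T\<close> as
  well. The obstacle there is the dual action: the antipode axioms speak of evaluation and
  coevaluation, not of the module laws of \<open>sl T(dual r)\<close>, which have to be extracted
  from the linearity of these two maps. Invertibility transfers as follows. A star-inverse of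
  \<open>\<theta>\<close> acts on modules as the inverse of \<open>\<Theta>\<close>; conversely,
  pointwise inverses of \<open>\<Theta>\<close> are automatically natural, so on free modules they
  give a natural family, which is a star-inverse. The tensor axioms match because on free modules
  the braiding, restricted along \<open>\<eta> \<boxtimes> \<eta>\<close>, is the R-matrix itself.
  The mathematics is done for the predicates \<open>is_twist\<close> and \<open>is_mtwist\<close> on
  arrows that know their source and target; the given locales are reached by translation.\<close>

text \<open>
  The hom-sets of a category need not be disjoint. Recording source and target turns every typing
  side condition into an equation between objects.
\<close>

datatype ('o, 'm) arrow = Arr (src: 'o) (und: 'm) (tgt: 'o)

context category
begin

definition arr :: "('o, 'm) arrow \<Rightarrow> bool" where
  "arr f \<longleftrightarrow> src f \<in> Obj C \<and> tgt f \<in> Obj C \<and> und f \<in> Hom C (src f) (tgt f)"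

text \<open>Composition is total and checks nothing: composability enters only as the hypothesis
  \<open>src g = tgt f\<close> of the laws, an equation that \<open>simp\<close> can
  discharge.\<close>

definition cmp :: "('o, 'm) arrow \<Rightarrow> ('o, 'm) arrow \<Rightarrow> ('o, 'm) arrow"  (infixr "\<star>" 65) where
  "g \<star> f = Arr (src f) (und g \<cdot> und f) (tgt g)"

definition idt :: "'o \<Rightarrow> ('o, 'm) arrow" where
  "idt X = Arr X (Id C X) X"

lemma arr_Arr [simp]: "arr (Arr X f Y) \<longleftrightarrow> X \<in> Obj C \<and> Y \<in> Obj C \<and> f \<in> Hom C X Y"
  by (simp add: arr_def)

lemma src_in_Obj [simp]: "arr f \<Longrightarrow> src f \<in> Obj C"
  and tgt_in_Obj [simp]: "arr f \<Longrightarrow> tgt f \<in> Obj C"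
  and und_in_Hom [simp]: "\<lbrakk>arr f; src f = X; tgt f = Y\<rbrakk> \<Longrightarrow> und f \<in> Hom C X Y"
  by (auto simp only: arr_def)

lemma src_cmp [simp]: "src (g \<star> f) = src f"
  and tgt_cmp [simp]: "tgt (g \<star> f) = tgt g"
  and und_cmp: "und (g \<star> f) = und g \<cdot> und f"
  by (simp_all add: cmp_def)

lemma arr_cmp [simp]: "\<lbrakk>arr g; arr f; src g = tgt f\<rbrakk> \<Longrightarrow> arr (g \<star> f)"
  using Comp_in_Hom [of "src f" "tgt f" "tgt g" "und f" "und g"] by (simp add: cmp_def)

lemma src_idt [simp]: "src (idt X) = X"
  and tgt_idt [simp]: "tgt (idt X) = X"
  and und_idt: "und (idt X) = Id C X"
  by (simp_all add: idt_def)

lemma arr_idt [simp]: "X \<in> Obj C \<Longrightarrow> arr (idt X)"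
  by (simp add: idt_def Id_in_Hom)

lemma cmp_assoc [simp]:
  "\<lbrakk>arr h; arr g; arr f; src h = tgt g; src g = tgt f\<rbrakk> \<Longrightarrow> (h \<star> g) \<star> f = h \<star> g \<star> f"
  using Comp_assoc [of "src f" "tgt f" "tgt g" "tgt h" "und f" "und g" "und h"] by (simp add: cmp_def)

lemma cmp_idt [simp]: "\<lbrakk>arr f; src f = X\<rbrakk> \<Longrightarrow> f \<star> idt X = f"
  using Comp_Id [of "src f" "tgt f" "und f"] by (auto simp: cmp_def idt_def intro: arrow.expand)

lemma idt_cmp [simp]: "\<lbrakk>arr f; tgt f = X\<rbrakk> \<Longrightarrow> idt X \<star> f = f"
  using Id_Comp [of "src f" "tgt f" "und f"] by (auto simp: cmp_def idt_def intro: arrow.expand)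

text \<open>Composites are kept bracketed to the right by \<open>cmp_assoc\<close>, so an equation
  about \<open>a \<star> b\<close> does not match inside \<open>a \<star> b \<star> d\<close>. This
  lemma and the next let it act in front of a tail \<open>d\<close>.\<close>

lemma cmp_extend:
  "\<lbrakk>a \<star> b = c; arr a; arr b; arr d; src a = tgt b; src b = tgt d\<rbrakk> \<Longrightarrow> a \<star> b \<star> d = c \<star> d"
  using cmp_assoc by metis

lemma cmp_extend':
  "\<lbrakk>a \<star> b = a' \<star> b'; arr a; arr b; arr d; src a = tgt b; src b = tgt d;
    arr a'; arr b'; src a' = tgt b'; src b' = tgt d\<rbrakk> \<Longrightarrow> a \<star> b \<star> d = a' \<star> b' \<star> d"
  using cmp_assoc by metis

end

context strict_monoidal_category
begin

definition ten :: "('o, 'm) arrow \<Rightarrow> ('o, 'm) arrow \<Rightarrow> ('o, 'm) arrow"  (infixr "\<boxtimes>" 70) where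
  "f \<boxtimes> g = Arr (src f \<odot> src g) (und f \<otimes> und g) (tgt f \<odot> tgt g)"

declare unit_in_Obj [simp] tensor_in_Obj [simp] tensor_obj_assoc [simp]
  unit_tensor_obj [simp] tensor_unit_obj [simp]

lemma src_ten [simp]: "src (f \<boxtimes> g) = src f \<odot> src g"
  and tgt_ten [simp]: "tgt (f \<boxtimes> g) = tgt f \<odot> tgt g"
  by (simp_all add: ten_def)

lemma arr_ten [simp]: "\<lbrakk>arr f; arr g\<rbrakk> \<Longrightarrow> arr (f \<boxtimes> g)"
  using tensor_in_Hom [of "src f" "src g" "tgt f" "tgt g" "und f" "und g"] by (simp add: ten_def)

lemma ten_assoc [simp]: "\<lbrakk>arr f; arr g; arr h\<rbrakk> \<Longrightarrow> (f \<boxtimes> g) \<boxtimes> h = f \<boxtimes> g \<boxtimes> h"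
  using tensor_arr_assoc [of "src f" "src g" "src h" "tgt f" "tgt g" "tgt h" "und f" "und g" "und h"]
  by (simp add: ten_def)

lemma idt_unit_ten [simp]: "arr f \<Longrightarrow> idt \<one> \<boxtimes> f = f"
  using unit_tensor_arr [of "src f" "tgt f" "und f"] by (simp add: ten_def idt_def)

lemma ten_idt_unit [simp]: "arr f \<Longrightarrow> f \<boxtimes> idt \<one> = f"
  using tensor_unit_arr [of "src f" "tgt f" "und f"] by (simp add: ten_def idt_def)

lemma idt_ten_idt [simp]: "\<lbrakk>X \<in> Obj C; Y \<in> Obj C\<rbrakk> \<Longrightarrow> idt X \<boxtimes> idt Y = idt (X \<odot> Y)"
  by (simp add: ten_def idt_def tensor_Id)

text \<open>Since \<open>ten_assoc\<close> brackets to the right,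
  \<open>idt X \<boxtimes> idt Y\<close> is not a subterm here and \<open>idt_ten_idt\<close> cannot
  fire.\<close>

lemma idt_ten_idt_ten [simp]:
  "\<lbrakk>X \<in> Obj C; Y \<in> Obj C; arr f\<rbrakk> \<Longrightarrow> idt X \<boxtimes> idt Y \<boxtimes> f = idt (X \<odot> Y) \<boxtimes> f"
  by (subst ten_assoc [symmetric]) (simp_all del: ten_assoc)

lemma interchange:
  "\<lbrakk>arr f; arr g; arr f'; arr g'; src f' = tgt f; src g' = tgt g\<rbrakk>
    \<Longrightarrow> (f' \<boxtimes> g') \<star> (f \<boxtimes> g) = (f' \<star> f) \<boxtimes> (g' \<star> g)"
  using tensor_Comp [of "src f" "src g" "tgt f" "tgt g" "tgt f'" "tgt g'" "und f" "und f'" "und g" "und g'"]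
  by (simp add: cmp_def ten_def)

lemma interchange_extend:
  "\<lbrakk>arr f; arr g; arr f'; arr g'; arr h; src f' = tgt f; src g' = tgt g; src f \<odot> src g = tgt h\<rbrakk>
    \<Longrightarrow> (f' \<boxtimes> g') \<star> (f \<boxtimes> g) \<star> h = ((f' \<star> f) \<boxtimes> (g' \<star> g)) \<star> h"
  by (rule cmp_extend [OF interchange]) simp_all

lemmas merge = interchange interchange_extend

text \<open>Opposite direction to \<open>interchange\<close>: spreads a whiskered composite into a
  composite of whiskered arrows, so that single factors become accessible to rewriting.\<close>

lemma cmp_ten_idt:
  "\<lbrakk>arr g; arr f; src g = tgt f; X \<in> Obj C\<rbrakk> \<Longrightarrow> (g \<star> f) \<boxtimes> idt X = (g \<boxtimes> idt X) \<star> (f \<boxtimes> idt X)"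
  by (simp add: interchange)

lemma idt_ten_cmp:
  "\<lbrakk>arr g; arr f; src g = tgt f; X \<in> Obj C\<rbrakk> \<Longrightarrow> idt X \<boxtimes> (g \<star> f) = (idt X \<boxtimes> g) \<star> (idt X \<boxtimes> f)"
  by (simp add: interchange)

text \<open>Equating the two factorizations of \<open>f \<boxtimes> g\<close> moves arrows in
  different tensor factors past each other.\<close>

lemma slide:
  assumes "arr f" "arr g"
  shows "(f \<boxtimes> idt (tgt g)) \<star> (idt (src f) \<boxtimes> g) = f \<boxtimes> g"
    and "(idt (tgt f) \<boxtimes> g) \<star> (f \<boxtimes> idt (src g)) = f \<boxtimes> g"
  using assms by (simp_all add: interchange)

end

section \<open>Dual arrows\<close>

context autonomous_category
begin

definition ev :: "'o \<Rightarrow> ('o, 'm) arrow" where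
  "ev X = Arr (ldual C X \<odot> X) (left_ev C X) \<one>"

definition coev :: "'o \<Rightarrow> ('o, 'm) arrow" where
  "coev X = Arr \<one> (left_coev C X) (X \<odot> ldual C X)"

definition dual :: "('o, 'm) arrow \<Rightarrow> ('o, 'm) arrow" where
  "dual f = Arr (ldual C (tgt f)) (ldual_arr C (src f) (tgt f) (und f)) (ldual C (src f))"

declare ldual_in_Obj [simp]

lemma src_ev [simp]: "src (ev X) = ldual C X \<odot> X"
  and tgt_ev [simp]: "tgt (ev X) = \<one>"
  and src_coev [simp]: "src (coev X) = \<one>"
  and tgt_coev [simp]: "tgt (coev X) = X \<odot> ldual C X"
  and src_dual [simp]: "src (dual f) = ldual C (tgt f)"
  and tgt_dual [simp]: "tgt (dual f) = ldual C (src f)"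
  by (simp_all add: ev_def coev_def dual_def)

lemma arr_ev [simp]: "X \<in> Obj C \<Longrightarrow> arr (ev X)"
  by (simp add: ev_def left_ev_in_Hom)

lemma arr_coev [simp]: "X \<in> Obj C \<Longrightarrow> arr (coev X)"
  by (simp add: coev_def left_coev_in_Hom)

lemma zigzag:
  assumes "X \<in> Obj C"
  shows "(idt X \<boxtimes> ev X) \<star> (coev X \<boxtimes> idt X) = idt X"
    and "(ev X \<boxtimes> idt (ldual C X)) \<star> (idt (ldual C X) \<boxtimes> coev X) = idt (ldual C X)"
  using assms
  by (simp_all add: cmp_def ten_def idt_def ev_def coev_def ldual_zigzag)

lemma dual_eq:
  assumes "arr f"
  shows "dual f = (ev (tgt f) \<boxtimes> idt (ldual C (src f)))
    \<star> (idt (ldual C (tgt f)) \<boxtimes> f \<boxtimes> idt (ldual C (src f)))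
    \<star> (idt (ldual C (tgt f)) \<boxtimes> coev (src f))"
  using assms
  by (simp add: cmp_def ten_def idt_def ev_def coev_def dual_def ldual_arr_def)

lemma arr_dual [simp]: "arr f \<Longrightarrow> arr (dual f)"
  by (simp add: dual_eq)


text \<open>After expanding \<open>dual f\<close>, the two evaluations slide past each other,
  \<open>f\<close> slides past \<open>ev (src f)\<close>, and the zigzag identity at
  \<open>src f\<close> straightens the remaining strand.\<close>

lemma ev_dual:
  assumes f: "arr f"
  shows "ev (src f) \<star> (dual f \<boxtimes> idt (src f)) = ev (tgt f) \<star> (idt (ldual C (tgt f)) \<boxtimes> f)"
proof -
  let ?X = "src f" and ?Y = "tgt f"
  let ?X' = "ldual C ?X" and ?Y' = "ldual C ?Y"
  have "ev ?X \<star> (dual f \<boxtimes> idt ?X) = (ev ?X \<star> (ev ?Y \<boxtimes> idt (?X' \<odot> ?X)))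
      \<star> (idt ?Y' \<boxtimes> f \<boxtimes> idt (?X' \<odot> ?X)) \<star> (idt ?Y' \<boxtimes> coev ?X \<boxtimes> idt ?X)"
    using f by (simp add: dual_eq cmp_ten_idt)
  also have "ev ?X \<star> (ev ?Y \<boxtimes> idt (?X' \<odot> ?X)) = ev ?Y \<star> (idt ?Y' \<boxtimes> idt ?Y \<boxtimes> ev ?X)"
    using f slide [of "ev ?Y" "ev ?X"] by simp
  also have "(\<dots>) \<star> (idt ?Y' \<boxtimes> f \<boxtimes> idt (?X' \<odot> ?X)) \<star> (idt ?Y' \<boxtimes> coev ?X \<boxtimes> idt ?X)
      = ev ?Y \<star> (idt ?Y' \<boxtimes> ((idt ?Y \<boxtimes> ev ?X) \<star> (f \<boxtimes> idt (?X' \<odot> ?X)) \<star> (coev ?X \<boxtimes> idt ?X)))"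
    using f by (simp add: merge del: idt_ten_idt_ten)
  also have "(idt ?Y \<boxtimes> ev ?X) \<star> (f \<boxtimes> idt (?X' \<odot> ?X)) \<star> (coev ?X \<boxtimes> idt ?X)
      = f \<star> (idt ?X \<boxtimes> ev ?X) \<star> (coev ?X \<boxtimes> idt ?X)"
    using f slide [of f "ev ?X"]
    by (intro cmp_extend') simp_all
  finally show ?thesis
    using f by (simp add: zigzag)
qed

text \<open>The mirror argument, with the coevaluations exchanged and the zigzag taken at
  \<open>tgt f\<close>.\<close>

lemma coev_dual:
  assumes f: "arr f"
  shows "(idt (tgt f) \<boxtimes> dual f) \<star> coev (tgt f) = (f \<boxtimes> idt (ldual C (src f))) \<star> coev (src f)"
proof -
  let ?X = "src f" and ?Y = "tgt f"
  let ?X' = "ldual C ?X" and ?Y' = "ldual C ?Y"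
  have "(idt ?Y \<boxtimes> dual f) \<star> coev ?Y = (idt ?Y \<boxtimes> ev ?Y \<boxtimes> idt ?X')
      \<star> (idt (?Y \<odot> ?Y') \<boxtimes> f \<boxtimes> idt ?X') \<star> (idt (?Y \<odot> ?Y') \<boxtimes> coev ?X) \<star> coev ?Y"
    using f by (simp add: dual_eq idt_ten_cmp)
  also have "(idt (?Y \<odot> ?Y') \<boxtimes> coev ?X) \<star> coev ?Y = (coev ?Y \<boxtimes> idt (?X \<odot> ?X')) \<star> coev ?X"
    using f slide [of "coev ?Y" "coev ?X"] by simp
  also have "(idt (?Y \<odot> ?Y') \<boxtimes> f \<boxtimes> idt ?X') \<star> (coev ?Y \<boxtimes> idt (?X \<odot> ?X')) \<star> coev ?X
      = (coev ?Y \<boxtimes> idt (?Y \<odot> ?X')) \<star> (f \<boxtimes> idt ?X') \<star> coev ?X"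
    using f slide [of "coev ?Y" "f \<boxtimes> idt ?X'"] by (intro cmp_extend') simp_all
  also have "(idt ?Y \<boxtimes> ev ?Y \<boxtimes> idt ?X') \<star> (coev ?Y \<boxtimes> idt (?Y \<odot> ?X')) \<star> (f \<boxtimes> idt ?X') \<star> coev ?X
      = (((idt ?Y \<boxtimes> ev ?Y) \<star> (coev ?Y \<boxtimes> idt ?Y)) \<boxtimes> idt ?X') \<star> (f \<boxtimes> idt ?X') \<star> coev ?X"
    using f by (simp add: cmp_ten_idt)
  finally show ?thesis
    using f by (simp add: zigzag)
qed

text \<open>A zigzag recovers \<open>g\<close> from \<open>ev \<star> (g \<boxtimes> idt)\<close> by
  bending the strand of \<open>src f\<close> back with \<open>coev\<close>. Duals of arrows can thus
  be identified by one evaluation equation, without unfolding \<open>dual_eq\<close>.\<close>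

lemma dual_unique:
  assumes f: "arr f" and g: "arr g" "src g = ldual C (tgt f)" "tgt g = ldual C (src f)"
    and eq: "ev (src f) \<star> (g \<boxtimes> idt (src f)) = ev (tgt f) \<star> (idt (ldual C (tgt f)) \<boxtimes> f)"
  shows "g = dual f"
proof -
  let ?X = "src f" and ?Y = "tgt f"
  let ?X' = "ldual C ?X" and ?Y' = "ldual C ?Y"
  have "g = ((ev ?X \<boxtimes> idt ?X') \<star> (idt ?X' \<boxtimes> coev ?X)) \<star> g"
    using f g by (simp add: zigzag)
  also have "\<dots> = (ev ?X \<boxtimes> idt ?X') \<star> (g \<boxtimes> idt (?X \<odot> ?X')) \<star> (idt ?Y' \<boxtimes> coev ?X)"
    using f g slide [of g "coev ?X"] by simp
  also have "\<dots> = ((ev ?X \<star> (g \<boxtimes> idt ?X)) \<boxtimes> idt ?X') \<star> (idt ?Y' \<boxtimes> coev ?X)"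
    using f g by (simp add: cmp_ten_idt)
  also have "\<dots> = dual f"
    unfolding eq using f g by (simp add: cmp_ten_idt dual_eq)
  finally show ?thesis .
qed

lemma dual_idt [simp]: "X \<in> Obj C \<Longrightarrow> dual (idt X) = idt (ldual C X)"
  by (rule dual_unique [symmetric]) simp_all

lemma dual_cmp:
  assumes g: "arr g" and f: "arr f" and gf: "src g = tgt f"
  shows "dual (g \<star> f) = dual f \<star> dual g"
proof (rule dual_unique [symmetric])
  let ?X = "src f" and ?Y = "tgt f" and ?Z = "tgt g"
  have "ev ?X \<star> ((dual f \<star> dual g) \<boxtimes> idt ?X) = (ev ?X \<star> (dual f \<boxtimes> idt ?X)) \<star> (dual g \<boxtimes> idt ?X)"
    using assms by (simp add: cmp_ten_idt)
  also have "\<dots> = ev ?Y \<star> (idt (ldual C ?Y) \<boxtimes> f) \<star> (dual g \<boxtimes> idt ?X)"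
    using assms by (simp add: ev_dual)
  also have "\<dots> = (ev ?Y \<star> (dual g \<boxtimes> idt ?Y)) \<star> (idt (ldual C ?Z) \<boxtimes> f)"
    using assms slide [of "dual g" f] by simp
  also have "\<dots> = ev ?Z \<star> (idt (ldual C ?Z) \<boxtimes> (g \<star> f))"
    using assms ev_dual [of g] by (simp add: idt_ten_cmp)
  finally show "ev (src (g \<star> f)) \<star> ((dual f \<star> dual g) \<boxtimes> idt (src (g \<star> f)))
      = ev (tgt (g \<star> f)) \<star> (idt (ldual C (tgt (g \<star> f))) \<boxtimes> (g \<star> f))"
    by simp
qed (use assms in simp_all)

end

section \<open>Comonoidal functors\<close>

text \<open>Separated from the monad structure because the uniqueness lemma below is needed for the
  identity functor and for the square of \<open>T\<close>, not for \<open>T\<close> itself.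
  \<open>P\<close> and \<open>F\<close> are the object and arrow parts, \<open>d\<close> and
  \<open>e\<close> the analogues of \<open>T2\<close> and \<open>T0\<close>.\<close>

locale comonoidal_functor = strict_monoidal_category C
  for C :: "('o, 'm, 'a) monoidal_scheme" (structure) +
  fixes P :: "'o \<Rightarrow> 'o"
    and F :: "('o, 'm) arrow \<Rightarrow> ('o, 'm) arrow"
    and d :: "'o \<Rightarrow> 'o \<Rightarrow> ('o, 'm) arrow"
    and e :: "('o, 'm) arrow"
  assumes P_in_Obj [simp]: "X \<in> Obj C \<Longrightarrow> P X \<in> Obj C"
    and arr_F [simp]: "arr f \<Longrightarrow> arr (F f)"
    and src_F [simp]: "arr f \<Longrightarrow> src (F f) = P (src f)"
    and tgt_F [simp]: "arr f \<Longrightarrow> tgt (F f) = P (tgt f)"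
    and F_idt [simp]: "X \<in> Obj C \<Longrightarrow> F (idt X) = idt (P X)"
    and F_cmp: "\<lbrakk>arr g; arr f; src g = tgt f\<rbrakk> \<Longrightarrow> F (g \<star> f) = F g \<star> F f"
    and arr_d [simp]: "\<lbrakk>X \<in> Obj C; Y \<in> Obj C\<rbrakk> \<Longrightarrow> arr (d X Y)"
    and src_d [simp]: "\<lbrakk>X \<in> Obj C; Y \<in> Obj C\<rbrakk> \<Longrightarrow> src (d X Y) = P (X \<odot> Y)"
    and tgt_d [simp]: "\<lbrakk>X \<in> Obj C; Y \<in> Obj C\<rbrakk> \<Longrightarrow> tgt (d X Y) = P X \<odot> P Y"
    and arr_e [simp]: "arr e"
    and src_e [simp]: "src e = P \<one>"
    and tgt_e [simp]: "tgt e = \<one>"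
    and d_natural:
      "\<lbrakk>arr f; arr g\<rbrakk>
        \<Longrightarrow> d (tgt f) (tgt g) \<star> F (f \<boxtimes> g) = (F f \<boxtimes> F g) \<star> d (src f) (src g)"
    and d_coassoc:
      "\<lbrakk>X \<in> Obj C; Y \<in> Obj C; Z \<in> Obj C\<rbrakk>
        \<Longrightarrow> (idt (P X) \<boxtimes> d Y Z) \<star> d X (Y \<odot> Z) = (d X Y \<boxtimes> idt (P Z)) \<star> d (X \<odot> Y) Z"
    and d_counit_right: "X \<in> Obj C \<Longrightarrow> (idt (P X) \<boxtimes> e) \<star> d X \<one> = idt (P X)"
    and d_counit_left: "X \<in> Obj C \<Longrightarrow> (e \<boxtimes> idt (P X)) \<star> d \<one> X = idt (P X)"
begin

text \<open>Uniqueness of inverses in disguise: given \<open>a\<close>, the map \<open>b\<close>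
  makes the evaluation \<open>p\<close> linear (a left inverse) and \<open>b'\<close> makes the
  coevaluation \<open>c\<close> linear (a right inverse). The composite of
  \<open>b \<boxtimes> a \<boxtimes> b'\<close> with an iterated comultiplication is evaluated in
  two ways, with coassociativity in the role of associativity and the zigzag closing the
  strand.\<close>

lemma pairing_unique:
  assumes [simp]: "M \<in> Obj C" "N \<in> Obj C"
    and p [simp]: "arr p" "src p = N \<odot> M" "tgt p = \<one>"
    and c [simp]: "arr c" "src c = \<one>" "tgt c = M \<odot> N"
    and zz: "(p \<boxtimes> idt N) \<star> (idt N \<boxtimes> c) = idt N"
    and a [simp]: "arr a" "src a = P M" "tgt a = M"
    and b [simp]: "arr b" "src b = P N" "tgt b = N"
    and b' [simp]: "arr b'" "src b' = P N" "tgt b' = N"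
    and pb: "p \<star> (b \<boxtimes> a) \<star> d N M = e \<star> F p"
    and cb': "(a \<boxtimes> b') \<star> d M N \<star> F c = c \<star> e"
  shows "b = b'"
proof -
  have "b = ((p \<boxtimes> idt N) \<star> (idt N \<boxtimes> c)) \<star> b \<star> (idt (P N) \<boxtimes> e) \<star> d N \<one>"
    by (simp add: zz d_counit_right)
  also have "\<dots> = (p \<boxtimes> idt N) \<star> ((idt N \<boxtimes> c) \<star> b \<star> (idt (P N) \<boxtimes> e)) \<star> d N \<one>"
    by simp
  also have "(idt N \<boxtimes> c) \<star> b \<star> (idt (P N) \<boxtimes> e) = b \<boxtimes> (c \<star> e)"
  proof -
    have "b \<star> (idt (P N) \<boxtimes> e) = (idt N \<boxtimes> e) \<star> (b \<boxtimes> idt (P \<one>))"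
      using slide [of b e] by simp
    then show ?thesis
      by (simp add: merge)
  qed
  \<comment> \<open>\<open>cb'\<close> is read from right to left: replacing
    \<open>c \<star> e\<close> creates the strands \<open>a\<close> and \<open>b'\<close> next to
    \<open>b\<close>.\<close>
  also have "\<dots> = (b \<boxtimes> a \<boxtimes> b') \<star> (idt (P N) \<boxtimes> d M N) \<star> (idt (P N) \<boxtimes> F c)"
    by (simp add: interchange flip: cb')
  also have "(\<dots>) \<star> d N \<one>
      = (b \<boxtimes> a \<boxtimes> b') \<star> (idt (P N) \<boxtimes> d M N) \<star> (idt (P N) \<boxtimes> F c) \<star> d N \<one>"
    by simp
  also have "(idt (P N) \<boxtimes> F c) \<star> d N \<one> = d N (M \<odot> N) \<star> F (idt N \<boxtimes> c)"
    using d_natural [of "idt N" c] by simp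
  \<comment> \<open>Coassociativity regroups the three strands, so that \<open>b\<close> and
    \<open>a\<close>, instead of \<open>a\<close> and \<open>b'\<close>, come from one
    comultiplication and \<open>pb\<close> becomes applicable.\<close>
  also have "(idt (P N) \<boxtimes> d M N) \<star> d N (M \<odot> N) \<star> F (idt N \<boxtimes> c)
      = (d N M \<boxtimes> idt (P N)) \<star> d (N \<odot> M) N \<star> F (idt N \<boxtimes> c)"
    by (intro cmp_extend') (simp_all add: d_coassoc)
  also have "(p \<boxtimes> idt N) \<star> (b \<boxtimes> a \<boxtimes> b') \<star> \<dots>
      = ((p \<star> (b \<boxtimes> a) \<star> d N M) \<boxtimes> b') \<star> d (N \<odot> M) N \<star> F (idt N \<boxtimes> c)"
    using interchange_extend [of "b \<boxtimes> a" b' p "idt N"] interchange_extend [of "d N M" "idt (P N)" "p \<star> (b \<boxtimes> a)" b']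
    by simp
  also have "(p \<star> (b \<boxtimes> a) \<star> d N M) \<boxtimes> b' = (e \<boxtimes> b') \<star> (F p \<boxtimes> idt (P N))"
    by (simp add: pb interchange)
  also have "(\<dots>) \<star> d (N \<odot> M) N \<star> F (idt N \<boxtimes> c)
      = (e \<boxtimes> b') \<star> (F p \<boxtimes> idt (P N)) \<star> d (N \<odot> M) N \<star> F (idt N \<boxtimes> c)"
    by simp
  also have "(F p \<boxtimes> idt (P N)) \<star> d (N \<odot> M) N \<star> F (idt N \<boxtimes> c)
      = d \<one> N \<star> F (p \<boxtimes> idt N) \<star> F (idt N \<boxtimes> c)"
    using d_natural [of p "idt N"] by (intro cmp_extend') simp_all
  also have "F (p \<boxtimes> idt N) \<star> F (idt N \<boxtimes> c) = idt (P N)"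
    by (simp add: zz flip: F_cmp)
  also have "(e \<boxtimes> b') \<star> d \<one> N \<star> idt (P N) = b' \<star> (e \<boxtimes> idt (P N)) \<star> d \<one> N"
    using slide(2) [of e b', symmetric] by simp
  also have "\<dots> = b'"
    by (simp add: d_counit_left)
  finally show ?thesis .
qed

text \<open>This is the comonoidal structure on the square for which \<open>comul_mul\<close> and
  \<open>counit_mul\<close> say that \<open>\<mu>\<close> is a comonoidal transformation from the
  square of \<open>T\<close> to \<open>T\<close>.\<close>

lemma square_comonoidal:
  "comonoidal_functor C (\<lambda>X. P (P X)) (\<lambda>f. F (F f)) (\<lambda>X Y. d (P X) (P Y) \<star> F (d X Y)) (e \<star> F e)"
proof unfold_locales
  fix f g assume [simp]: "arr f" "arr g"
  have "(d (P (tgt f)) (P (tgt g)) \<star> F (d (tgt f) (tgt g))) \<star> F (F (f \<boxtimes> g))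
      = d (P (tgt f)) (P (tgt g)) \<star> F (d (tgt f) (tgt g) \<star> F (f \<boxtimes> g))"
    by (simp add: F_cmp)
  also have "\<dots> = (d (P (tgt f)) (P (tgt g)) \<star> F (F f \<boxtimes> F g)) \<star> F (d (src f) (src g))"
    by (simp add: d_natural F_cmp)
  also have "\<dots> = (F (F f) \<boxtimes> F (F g)) \<star> d (P (src f)) (P (src g)) \<star> F (d (src f) (src g))"
    using d_natural [of "F f" "F g"] by simp
  finally show "(d (P (tgt f)) (P (tgt g)) \<star> F (d (tgt f) (tgt g))) \<star> F (F (f \<boxtimes> g))
    = (F (F f) \<boxtimes> F (F g)) \<star> d (P (src f)) (P (src g)) \<star> F (d (src f) (src g))" .
next
  fix X Y Z assume [simp]: "X \<in> Obj C" "Y \<in> Obj C" "Z \<in> Obj C"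
  have "(idt (P (P X)) \<boxtimes> (d (P Y) (P Z) \<star> F (d Y Z))) \<star> d (P X) (P (Y \<odot> Z)) \<star> F (d X (Y \<odot> Z))
      = (idt (P (P X)) \<boxtimes> d (P Y) (P Z)) \<star> (F (idt (P X)) \<boxtimes> F (d Y Z)) \<star> d (P X) (P (Y \<odot> Z))
        \<star> F (d X (Y \<odot> Z))"
    by (simp add: idt_ten_cmp)
  also have "(F (idt (P X)) \<boxtimes> F (d Y Z)) \<star> d (P X) (P (Y \<odot> Z)) \<star> F (d X (Y \<odot> Z))
      = d (P X) (P Y \<odot> P Z) \<star> F (idt (P X) \<boxtimes> d Y Z) \<star> F (d X (Y \<odot> Z))"
    using d_natural [of "idt (P X)" "d Y Z"] by (intro cmp_extend') simp_all
  also have "\<dots> = d (P X) (P Y \<odot> P Z) \<star> F (d X Y \<boxtimes> idt (P Z)) \<star> F (d (X \<odot> Y) Z)"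
    by (simp add: d_coassoc flip: F_cmp)
  also have "(idt (P (P X)) \<boxtimes> d (P Y) (P Z)) \<star> \<dots> = (d (P X) (P Y) \<boxtimes> idt (P (P Z)))
      \<star> d (P X \<odot> P Y) (P Z) \<star> F (d X Y \<boxtimes> idt (P Z)) \<star> F (d (X \<odot> Y) Z)"
    by (intro cmp_extend') (simp_all add: d_coassoc)
  also have "d (P X \<odot> P Y) (P Z) \<star> F (d X Y \<boxtimes> idt (P Z)) \<star> F (d (X \<odot> Y) Z)
      = (F (d X Y) \<boxtimes> idt (P (P Z))) \<star> d (P (X \<odot> Y)) (P Z) \<star> F (d (X \<odot> Y) Z)"
    using d_natural [of "d X Y" "idt (P Z)"] by (intro cmp_extend') simp_all
  also have "(d (P X) (P Y) \<boxtimes> idt (P (P Z))) \<star> \<dots>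
    = ((d (P X) (P Y) \<star> F (d X Y)) \<boxtimes> idt (P (P Z))) \<star> d (P (X \<odot> Y)) (P Z) \<star> F (d (X \<odot> Y) Z)"
    by (simp add: cmp_ten_idt)
  finally show "(idt (P (P X)) \<boxtimes> (d (P Y) (P Z) \<star> F (d Y Z))) \<star> d (P X) (P (Y \<odot> Z)) \<star> F (d X (Y \<odot> Z))
      = ((d (P X) (P Y) \<star> F (d X Y)) \<boxtimes> idt (P (P Z))) \<star> d (P (X \<odot> Y)) (P Z) \<star> F (d (X \<odot> Y) Z)" .
next
  fix X assume [simp]: "X \<in> Obj C"
  have "(idt (P (P X)) \<boxtimes> (e \<star> F e)) \<star> d (P X) (P \<one>) \<star> F (d X \<one>)
      = (idt (P (P X)) \<boxtimes> e) \<star> (F (idt (P X)) \<boxtimes> F e) \<star> d (P X) (P \<one>) \<star> F (d X \<one>)"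
    by (simp add: idt_ten_cmp)
  also have "(F (idt (P X)) \<boxtimes> F e) \<star> d (P X) (P \<one>) \<star> F (d X \<one>)
      = d (P X) \<one> \<star> F (idt (P X) \<boxtimes> e) \<star> F (d X \<one>)"
    using d_natural [of "idt (P X)" e] by (intro cmp_extend') simp_all
  also have "\<dots> = d (P X) \<one>"
    by (simp add: d_counit_right flip: F_cmp)
  finally show "(idt (P (P X)) \<boxtimes> (e \<star> F e)) \<star> d (P X) (P \<one>) \<star> F (d X \<one>) = idt (P (P X))"
    by (simp add: d_counit_right)
  have "((e \<star> F e) \<boxtimes> idt (P (P X))) \<star> d (P \<one>) (P X) \<star> F (d \<one> X)
      = (e \<boxtimes> idt (P (P X))) \<star> (F e \<boxtimes> F (idt (P X))) \<star> d (P \<one>) (P X) \<star> F (d \<one> X)"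
    by (simp add: cmp_ten_idt)
  also have "(F e \<boxtimes> F (idt (P X))) \<star> d (P \<one>) (P X) \<star> F (d \<one> X)
      = d \<one> (P X) \<star> F (e \<boxtimes> idt (P X)) \<star> F (d \<one> X)"
    using d_natural [of e "idt (P X)"] by (intro cmp_extend') simp_all
  also have "\<dots> = d \<one> (P X)"
    by (simp add: d_counit_left flip: F_cmp)
  finally show "((e \<star> F e) \<boxtimes> idt (P (P X))) \<star> d (P \<one>) (P X) \<star> F (d \<one> X) = idt (P (P X))"
    by (simp add: d_counit_left)
qed (simp_all add: F_cmp)

end

lemma (in strict_monoidal_category) identity_comonoidal:
  "comonoidal_functor C (\<lambda>X. X) (\<lambda>f. f) (\<lambda>X Y. idt (X \<odot> Y)) (idt \<one>)"
  by unfold_locales simp_all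

section \<open>Modules over a bimonad\<close>

context monad
begin

definition F :: "('o, 'm) arrow \<Rightarrow> ('o, 'm) arrow" where
  "F f = Arr (fobj T (src f)) (farr T (und f)) (fobj T (tgt f))"

definition mul :: "'o \<Rightarrow> ('o, 'm) arrow"  ("\<mu>") where
  "\<mu> X = Arr (fobj T (fobj T X)) (mu T X) (fobj T X)"

definition unit :: "'o \<Rightarrow> ('o, 'm) arrow"  ("\<eta>") where
  "\<eta> X = Arr X (eta T X) (fobj T X)"

declare fobj_in_Obj [simp]

lemma src_F [simp]: "src (F f) = fobj T (src f)"
  and tgt_F [simp]: "tgt (F f) = fobj T (tgt f)"
  and src_mul [simp]: "src (\<mu> X) = fobj T (fobj T X)"
  and tgt_mul [simp]: "tgt (\<mu> X) = fobj T X"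
  and src_unit [simp]: "src (\<eta> X) = X"
  and tgt_unit [simp]: "tgt (\<eta> X) = fobj T X"
  by (simp_all add: F_def mul_def unit_def)

lemma arr_F [simp]: "arr f \<Longrightarrow> arr (F f)"
  using farr_in_Hom [of "src f" "tgt f" "und f"] by (simp add: F_def)

lemma arr_mul [simp]: "X \<in> Obj C \<Longrightarrow> arr (\<mu> X)"
  by (simp add: mul_def mu_in_Hom)

lemma arr_unit [simp]: "X \<in> Obj C \<Longrightarrow> arr (\<eta> X)"
  by (simp add: unit_def eta_in_Hom)

lemma F_idt [simp]: "X \<in> Obj C \<Longrightarrow> F (idt X) = idt (fobj T X)"
  by (simp add: F_def idt_def farr_Id)

lemma F_cmp: "\<lbrakk>arr g; arr f; src g = tgt f\<rbrakk> \<Longrightarrow> F (g \<star> f) = F g \<star> F f"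
  using farr_Comp [of "src f" "tgt f" "tgt g" "und f" "und g"] by (simp add: F_def cmp_def)

lemma mul_natural: "arr f \<Longrightarrow> \<mu> (tgt f) \<star> F (F f) = F f \<star> \<mu> (src f)"
  using mu_natural [of "src f" "tgt f" "und f"] by (simp add: F_def cmp_def mul_def)

lemma unit_natural: "arr f \<Longrightarrow> F f \<star> \<eta> (src f) = \<eta> (tgt f) \<star> f"
  using eta_natural [of "src f" "tgt f" "und f"] by (simp add: F_def cmp_def unit_def)

lemma mul_F_mul: "X \<in> Obj C \<Longrightarrow> \<mu> X \<star> F (\<mu> X) = \<mu> X \<star> \<mu> (fobj T X)"
  by (simp add: F_def cmp_def mul_def mu_assoc)

lemma mul_unit: "X \<in> Obj C \<Longrightarrow> \<mu> X \<star> \<eta> (fobj T X) = idt (fobj T X)"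
  by (simp add: cmp_def mul_def unit_def idt_def mu_eta)

lemma mul_F_unit: "X \<in> Obj C \<Longrightarrow> \<mu> X \<star> F (\<eta> X) = idt (fobj T X)"
  by (simp add: F_def cmp_def mul_def unit_def idt_def mu_farr_eta)

text \<open>The carrier is the target of the action, so a module is a single arrow instead of a
  pair; \<open>act\<close> and \<open>modules_iff\<close> connect this with
  \<open>modules\<close>.\<close>

definition is_module :: "('o, 'm) arrow \<Rightarrow> bool" where
  "is_module \<rho> \<longleftrightarrow> arr \<rho> \<and> src \<rho> = fobj T (tgt \<rho>)
    \<and> \<rho> \<star> F \<rho> = \<rho> \<star> \<mu> (tgt \<rho>) \<and> \<rho> \<star> \<eta> (tgt \<rho>) = idt (tgt \<rho>)"

definition is_module_hom :: "('o, 'm) arrow \<Rightarrow> ('o, 'm) arrow \<Rightarrow> ('o, 'm) arrow \<Rightarrow> bool" where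
  "is_module_hom \<rho> \<sigma> f \<longleftrightarrow> arr f \<and> src f = tgt \<rho> \<and> tgt f = tgt \<sigma> \<and> f \<star> \<rho> = \<sigma> \<star> F f"

abbreviation act :: "'o \<times> 'm \<Rightarrow> ('o, 'm) arrow" where
  "act N \<equiv> Arr (fobj T (fst N)) (snd N) (fst N)"

lemma modules_iff: "N \<in> modules C T \<longleftrightarrow> is_module (act N)"
  by (cases N) (auto simp: modules_def is_module_def cmp_def F_def mul_def unit_def idt_def)

lemma module_hom_iff:
  "\<lbrakk>N \<in> modules C T; N' \<in> modules C T\<rbrakk>
    \<Longrightarrow> f \<in> module_hom C T N N' \<longleftrightarrow> is_module_hom (act N) (act N') (Arr (fst N) f (fst N'))"
  by (cases N; cases N')
    (auto simp: module_hom_def is_module_hom_def modules_def cmp_def F_def)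

lemma
  assumes "is_module \<rho>"
  shows is_module_arr [simp]: "arr \<rho>"
    and is_module_src [simp]: "src \<rho> = fobj T (tgt \<rho>)"
    and is_module_assoc: "\<rho> \<star> F \<rho> = \<rho> \<star> \<mu> (tgt \<rho>)"
    and is_module_unit: "\<rho> \<star> \<eta> (tgt \<rho>) = idt (tgt \<rho>)"
  using assms by (simp_all add: is_module_def)

lemma is_moduleI:
  "\<lbrakk>arr \<rho>; src \<rho> = fobj T (tgt \<rho>); \<rho> \<star> F \<rho> = \<rho> \<star> \<mu> (tgt \<rho>); \<rho> \<star> \<eta> (tgt \<rho>) = idt (tgt \<rho>)\<rbrakk>
    \<Longrightarrow> is_module \<rho>"
  unfolding is_module_def by blast

lemma is_module_free [simp]: "X \<in> Obj C \<Longrightarrow> is_module (\<mu> X)"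
  by (rule is_moduleI) (simp_all add: mul_F_mul mul_unit)

text \<open>Inserting the identity \<open>F f \<star> F g\<close> on the source side of
  \<open>g \<star> \<sigma>\<close> makes linearity of \<open>f\<close> applicable. It spares
  separate linearity proofs for the inverses of braidings and twists.\<close>

lemma is_module_hom_inverse:
  assumes "is_module \<rho>" "is_module \<sigma>" and f: "is_module_hom \<rho> \<sigma> f"
    and g: "arr g" "src g = tgt \<sigma>" "tgt g = tgt \<rho>"
    and gf: "g \<star> f = idt (tgt \<rho>)" and fg: "f \<star> g = idt (tgt \<sigma>)"
  shows "is_module_hom \<sigma> \<rho> g"
proof -
  have [simp]: "arr f" "src f = tgt \<rho>" "tgt f = tgt \<sigma>" and h: "f \<star> \<rho> = \<sigma> \<star> F f"
    using f by (simp_all add: is_module_hom_def)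
  note [simp] = assms(1,2) g
  have "g \<star> \<sigma> = g \<star> (\<sigma> \<star> F f) \<star> F g"
    by (simp add: fg flip: F_cmp)
  also have "\<dots> = (g \<star> f) \<star> \<rho> \<star> F g"
    by (simp flip: h)
  also have "\<dots> = \<rho> \<star> F g"
    unfolding gf by simp
  finally show ?thesis
    by (simp add: is_module_hom_def)
qed

lemma is_module_hom_cmp:
  assumes [simp]: "is_module \<rho>" "is_module \<sigma>" "is_module \<pi>"
    and f: "is_module_hom \<rho> \<sigma> f" and g: "is_module_hom \<sigma> \<pi> g"
  shows "is_module_hom \<rho> \<pi> (g \<star> f)"
proof -
  have [simp]: "arr f" "src f = tgt \<rho>" "tgt f = tgt \<sigma>" "arr g" "src g = tgt \<sigma>" "tgt g = tgt \<pi>"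
    and eq: "f \<star> \<rho> = \<sigma> \<star> F f" "g \<star> \<sigma> = \<pi> \<star> F g"
    using f g by (simp_all add: is_module_hom_def)
  have "g \<star> \<sigma> \<star> F f = \<pi> \<star> F g \<star> F f"
    by (intro cmp_extend') (simp_all add: eq)
  then show ?thesis
    by (simp add: is_module_hom_def eq F_cmp)
qed

end

context bimonad
begin

definition comul :: "'o \<Rightarrow> 'o \<Rightarrow> ('o, 'm) arrow"  ("\<delta>") where
  "\<delta> X Y = Arr (fobj T (X \<odot> Y)) (T2 T X Y) (fobj T X \<odot> fobj T Y)"

definition counit :: "('o, 'm) arrow"  ("\<epsilon>") where
  "\<epsilon> = Arr (fobj T \<one>) (T0 T) \<one>"

sublocale comonoidal_functor C "fobj T" F \<delta> \<epsilon>
proof unfold_locales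
  show "arr f \<Longrightarrow> arr g \<Longrightarrow> \<delta> (tgt f) (tgt g) \<star> F (f \<boxtimes> g) = (F f \<boxtimes> F g) \<star> \<delta> (src f) (src g)"
    for f g
    using T2_natural [of "src f" "src g" "tgt f" "tgt g" "und f" "und g"]
    by (simp add: comul_def F_def ten_def cmp_def)
qed ((simp add: F_cmp; fail) | simp add: comul_def counit_def F_def ten_def cmp_def idt_def
    T2_in_Hom T0_in_Hom T2_coassoc T2_counit_left T2_counit_right)+

lemma comul_mul:
  "\<lbrakk>X \<in> Obj C; Y \<in> Obj C\<rbrakk>
    \<Longrightarrow> \<delta> X Y \<star> \<mu> (X \<odot> Y) = (\<mu> X \<boxtimes> \<mu> Y) \<star> \<delta> (fobj T X) (fobj T Y) \<star> F (\<delta> X Y)"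
  by (simp add: comul_def mul_def F_def ten_def cmp_def T2_mu)

lemma counit_mul: "\<epsilon> \<star> \<mu> \<one> = \<epsilon> \<star> F \<epsilon>"
  by (simp add: counit_def mul_def F_def cmp_def T0_mu)

lemma comul_unit: "\<lbrakk>X \<in> Obj C; Y \<in> Obj C\<rbrakk> \<Longrightarrow> \<delta> X Y \<star> \<eta> (X \<odot> Y) = \<eta> X \<boxtimes> \<eta> Y"
  by (simp add: comul_def unit_def ten_def cmp_def T2_eta)

lemma counit_unit: "\<epsilon> \<star> \<eta> \<one> = idt \<one>"
  by (simp add: counit_def unit_def cmp_def idt_def T0_eta)

definition mten :: "('o, 'm) arrow \<Rightarrow> ('o, 'm) arrow \<Rightarrow> ('o, 'm) arrow" where
  "mten \<rho> \<sigma> = (\<rho> \<boxtimes> \<sigma>) \<star> \<delta> (tgt \<rho>) (tgt \<sigma>)"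

lemma tgt_mten [simp]: "tgt (mten \<rho> \<sigma>) = tgt \<rho> \<odot> tgt \<sigma>"
  by (simp add: mten_def)

lemma
  assumes "arr \<rho>" "arr \<sigma>" "src \<rho> = fobj T (tgt \<rho>)" "src \<sigma> = fobj T (tgt \<sigma>)"
  shows arr_mten [simp]: "arr (mten \<rho> \<sigma>)"
    and src_mten [simp]: "src (mten \<rho> \<sigma>) = fobj T (tgt \<rho> \<odot> tgt \<sigma>)"
  using assms by (simp_all add: mten_def)

text \<open>Naturality of \<open>\<delta>\<close> brings the two actions together; its compatibility
  with \<open>\<mu>\<close> then gives associativity, and that with \<open>\<eta>\<close> the unit
  law.\<close>

lemma is_module_mten [simp]:
  assumes [simp]: "is_module \<rho>" "is_module \<sigma>"
  shows "is_module (mten \<rho> \<sigma>)"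
proof -
  let ?M = "tgt \<rho>" and ?N = "tgt \<sigma>"
  have nat: "\<delta> ?M ?N \<star> F (\<rho> \<boxtimes> \<sigma>) = (F \<rho> \<boxtimes> F \<sigma>) \<star> \<delta> (fobj T ?M) (fobj T ?N)"
    using d_natural [of \<rho> \<sigma>] by simp
  have "mten \<rho> \<sigma> \<star> F (mten \<rho> \<sigma>) = (\<rho> \<boxtimes> \<sigma>) \<star> (\<delta> ?M ?N \<star> F (\<rho> \<boxtimes> \<sigma>)) \<star> F (\<delta> ?M ?N)"
    by (simp add: mten_def F_cmp)
  also have "\<dots> = ((\<rho> \<star> F \<rho>) \<boxtimes> (\<sigma> \<star> F \<sigma>)) \<star> \<delta> (fobj T ?M) (fobj T ?N) \<star> F (\<delta> ?M ?N)"
    by (simp add: nat interchange_extend)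
  also have "\<dots> = (\<rho> \<boxtimes> \<sigma>) \<star> (\<mu> ?M \<boxtimes> \<mu> ?N) \<star> \<delta> (fobj T ?M) (fobj T ?N) \<star> F (\<delta> ?M ?N)"
    by (simp add: is_module_assoc interchange_extend)
  also have "\<dots> = mten \<rho> \<sigma> \<star> \<mu> (?M \<odot> ?N)"
    by (simp add: mten_def comul_mul)
  finally have "mten \<rho> \<sigma> \<star> F (mten \<rho> \<sigma>) = mten \<rho> \<sigma> \<star> \<mu> (?M \<odot> ?N)" .
  moreover have "mten \<rho> \<sigma> \<star> \<eta> (?M \<odot> ?N) = idt (?M \<odot> ?N)"
    by (simp add: mten_def comul_unit interchange is_module_unit)
  ultimately show ?thesis
    by (intro is_moduleI) simp_all
qed

lemma is_module_counit [simp]: "is_module \<epsilon>"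
  by (rule is_moduleI) (simp_all add: counit_mul counit_unit)

text \<open>A rereading of \<open>comul_mul\<close>. It is what lets a natural transformation on
  modules be moved past \<open>\<delta>\<close> when the tensor axiom of a twist is extracted from
  free modules.\<close>

lemma is_module_hom_comul:
  "\<lbrakk>X \<in> Obj C; Y \<in> Obj C\<rbrakk> \<Longrightarrow> is_module_hom (\<mu> (X \<odot> Y)) (mten (\<mu> X) (\<mu> Y)) (\<delta> X Y)"
  by (simp add: is_module_hom_def mten_def comul_mul)

lemma is_module_hom_ten:
  assumes [simp]: "is_module \<rho>" "is_module \<rho>'" "is_module \<sigma>" "is_module \<sigma>'"
    and f: "is_module_hom \<rho> \<rho>' f" and g: "is_module_hom \<sigma> \<sigma>' g"
  shows "is_module_hom (mten \<rho> \<sigma>) (mten \<rho>' \<sigma>') (f \<boxtimes> g)"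
proof -
  have [simp]: "arr f" "arr g" "src f = tgt \<rho>" "tgt f = tgt \<rho>'" "src g = tgt \<sigma>" "tgt g = tgt \<sigma>'"
    and eq: "f \<star> \<rho> = \<rho>' \<star> F f" "g \<star> \<sigma> = \<sigma>' \<star> F g"
    using f g by (simp_all add: is_module_hom_def)
  have nat: "\<delta> (tgt \<rho>') (tgt \<sigma>') \<star> F (f \<boxtimes> g) = (F f \<boxtimes> F g) \<star> \<delta> (tgt \<rho>) (tgt \<sigma>)"
    using d_natural [of f g] by simp
  show ?thesis
    by (simp add: is_module_hom_def mten_def interchange_extend eq nat)
qed

text \<open>Coassociativity of \<open>\<delta>\<close>; the equality is strict because the base
  category is.\<close>

lemma mten_assoc:
  assumes [simp]: "is_module \<rho>" "is_module \<sigma>" "is_module \<pi>"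
  shows "mten (mten \<rho> \<sigma>) \<pi> = mten \<rho> (mten \<sigma> \<pi>)"
proof -
  let ?M = "tgt \<rho>" and ?N = "tgt \<sigma>" and ?P = "tgt \<pi>"
  have "mten (mten \<rho> \<sigma>) \<pi>
      = ((\<rho> \<boxtimes> \<sigma>) \<boxtimes> \<pi>) \<star> (\<delta> ?M ?N \<boxtimes> idt (fobj T ?P)) \<star> \<delta> (?M \<odot> ?N) ?P"
    by (simp add: mten_def interchange_extend del: ten_assoc)
  also have "\<dots> = (\<rho> \<boxtimes> \<sigma> \<boxtimes> \<pi>) \<star> (idt (fobj T ?M) \<boxtimes> \<delta> ?N ?P) \<star> \<delta> ?M (?N \<odot> ?P)"
    by (simp add: d_coassoc)
  also have "\<dots> = mten \<rho> (mten \<sigma> \<pi>)"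
    by (simp add: mten_def interchange_extend)
  finally show ?thesis .
qed

lemma mten_counit:
  assumes [simp]: "is_module \<rho>"
  shows "mten \<epsilon> \<rho> = \<rho>" "mten \<rho> \<epsilon> = \<rho>"
proof -
  have "mten \<epsilon> \<rho> = \<rho> \<star> (\<epsilon> \<boxtimes> idt (fobj T (tgt \<rho>))) \<star> \<delta> \<one> (tgt \<rho>)"
    using slide(2) [of \<epsilon> \<rho>, symmetric] by (simp add: mten_def)
  then show "mten \<epsilon> \<rho> = \<rho>"
    by (simp add: d_counit_left)
  have "mten \<rho> \<epsilon> = \<rho> \<star> (idt (fobj T (tgt \<rho>)) \<boxtimes> \<epsilon>) \<star> \<delta> (tgt \<rho>) \<one>"
    using slide(1) [of \<rho> \<epsilon>, symmetric] by (simp add: mten_def)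
  then show "mten \<rho> \<epsilon> = \<rho>"
    by (simp add: d_counit_right)
qed

end

section \<open>Duals of modules over a Hopf monad\<close>

context hopf_monad
begin

definition antipode :: "'o \<Rightarrow> ('o, 'm) arrow"  ("\<s>") where
  "\<s> X = Arr (fobj T (ldual C (fobj T X))) (sl X) (ldual C X)"

lemma src_antipode [simp]: "src (\<s> X) = fobj T (ldual C (fobj T X))"
  and tgt_antipode [simp]: "tgt (\<s> X) = ldual C X"
  by (simp_all add: antipode_def)

lemma arr_antipode [simp]: "X \<in> Obj C \<Longrightarrow> arr (\<s> X)"
  by (simp add: antipode_def sl_in_Hom)

lemma antipode_natural: "arr f \<Longrightarrow> dual f \<star> \<s> (tgt f) = \<s> (src f) \<star> F (dual (F f))"
  using sl_natural [of "src f" "tgt f" "und f"] by (simp add: antipode_def cmp_def F_def dual_def)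

lemma antipode_ev:
  "X \<in> Obj C \<Longrightarrow>
    \<epsilon> \<star> F (ev X) \<star> F (dual (\<eta> X) \<boxtimes> idt X)
    = ev (fobj T X) \<star> ((\<s> (fobj T X) \<star> F (dual (\<mu> X))) \<boxtimes> idt (fobj T X))
      \<star> \<delta> (ldual C (fobj T X)) X"
  by (simp add: antipode_def counit_def comul_def cmp_def F_def dual_def ev_def ten_def idt_def
      unit_def mul_def sl_ev)

lemma antipode_coev:
  "X \<in> Obj C \<Longrightarrow>
    (\<eta> X \<boxtimes> idt (ldual C X)) \<star> coev X \<star> \<epsilon>
    = (\<mu> X \<boxtimes> \<s> X) \<star> \<delta> (fobj T X) (ldual C (fobj T X)) \<star> F (coev (fobj T X))"
  by (simp add: antipode_def counit_def comul_def cmp_def F_def dual_def coev_def ten_def idt_def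
      unit_def mul_def sl_coev)

definition dact :: "('o, 'm) arrow \<Rightarrow> ('o, 'm) arrow" where
  "dact \<rho> = \<s> (tgt \<rho>) \<star> F (dual \<rho>)"

lemma tgt_dact [simp]: "tgt (dact \<rho>) = ldual C (tgt \<rho>)"
  by (simp add: dact_def)

lemma src_dact [simp]: "src (dact \<rho>) = fobj T (ldual C (tgt \<rho>))"
  by (simp add: dact_def)

lemma arr_dact [simp]: "is_module \<rho> \<Longrightarrow> arr (dact \<rho>)"
  by (simp add: dact_def)

text \<open>\<open>ev_dual\<close> carries \<open>\<rho>\<close> over to the dual side, where
  naturality of the antipode and \<open>\<rho> \<star> F \<rho> = \<rho> \<star> \<mu>\<close>
  produce the dual of \<open>\<mu>\<close> that \<open>antipode_ev\<close> requires. What remains is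
  \<open>dual (\<eta> M) \<star> dual \<rho>\<close>, an identity by the unit law of the
  module.\<close>

lemma ev_dact:
  assumes [simp]: "is_module \<rho>"
  shows "ev (tgt \<rho>) \<star> mten (dact \<rho>) \<rho> = \<epsilon> \<star> F (ev (tgt \<rho>))"
proof -
  let ?M = "tgt \<rho>"
  let ?T = "fobj T ?M" and ?M' = "ldual C ?M"
  have slide': "dual \<rho> \<star> dact \<rho> = \<s> ?T \<star> F (dual (\<mu> ?M)) \<star> F (dual \<rho>)"
  proof -
    have "dual \<rho> \<star> dact \<rho> = (dual \<rho> \<star> \<s> ?M) \<star> F (dual \<rho>)"
      by (simp add: dact_def)
    also have "\<dots> = \<s> ?T \<star> F (dual (\<rho> \<star> F \<rho>))"
      by (simp add: antipode_natural dual_cmp F_cmp)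
    also have "\<dots> = \<s> ?T \<star> F (dual (\<mu> ?M)) \<star> F (dual \<rho>)"
      by (simp add: is_module_assoc dual_cmp F_cmp)
    finally show ?thesis .
  qed
  have unit: "dual (\<eta> ?M) \<star> dual \<rho> = idt ?M'"
    by (simp add: is_module_unit flip: dual_cmp)
  have nat: "\<delta> (ldual C ?T) ?M \<star> F (dual \<rho> \<boxtimes> idt ?M) = (F (dual \<rho>) \<boxtimes> idt ?T) \<star> \<delta> ?M' ?M"
    using d_natural [of "dual \<rho>" "idt ?M"] by simp
  have "ev ?M \<star> mten (dact \<rho>) \<rho> = (ev ?M \<star> (idt ?M' \<boxtimes> \<rho>)) \<star> (dact \<rho> \<boxtimes> idt ?T) \<star> \<delta> ?M' ?M"
    by (simp add: mten_def interchange_extend)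
  also have "\<dots> = ev ?T \<star> ((dual \<rho> \<star> dact \<rho>) \<boxtimes> idt ?T) \<star> \<delta> ?M' ?M"
    by (simp add: interchange_extend flip: ev_dual)
  also have "\<dots> = ev ?T \<star> ((\<s> ?T \<star> F (dual (\<mu> ?M))) \<boxtimes> idt ?T) \<star> (F (dual \<rho>) \<boxtimes> idt ?T) \<star> \<delta> ?M' ?M"
    by (simp add: slide' interchange_extend)
  also have "\<dots> = (ev ?T \<star> ((\<s> ?T \<star> F (dual (\<mu> ?M))) \<boxtimes> idt ?T) \<star> \<delta> (ldual C ?T) ?M)
      \<star> F (dual \<rho> \<boxtimes> idt ?M)"
    by (simp add: nat)
  also have "\<dots> = (\<epsilon> \<star> F (ev ?M) \<star> F (dual (\<eta> ?M) \<boxtimes> idt ?M)) \<star> F (dual \<rho> \<boxtimes> idt ?M)"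
    by (simp only: antipode_ev tgt_in_Obj is_module_arr assms)
  also have "\<dots> = \<epsilon> \<star> F (ev ?M) \<star> F ((dual (\<eta> ?M) \<star> dual \<rho>) \<boxtimes> idt ?M)"
    by (simp add: cmp_ten_idt F_cmp)
  finally show ?thesis
    by (simp add: unit)
qed

text \<open>Here \<open>coev_dual\<close> exchanges \<open>dual \<rho>\<close> under
  \<open>F\<close> for a second copy of \<open>\<rho>\<close> on the other factor; associativity of
  the action turns the two copies into \<open>\<rho> \<star> \<mu>\<close>, exposing
  \<open>antipode_coev\<close>, and \<open>\<rho> \<star> \<eta>\<close> disappears at the
  end.\<close>

lemma coev_dact:
  assumes [simp]: "is_module \<rho>"
  shows "mten \<rho> (dact \<rho>) \<star> F (coev (tgt \<rho>)) = coev (tgt \<rho>) \<star> \<epsilon>"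
proof -
  let ?M = "tgt \<rho>"
  let ?T = "fobj T ?M" and ?M' = "ldual C ?M"
  have nat1: "(idt ?T \<boxtimes> F (dual \<rho>)) \<star> \<delta> ?M ?M' = \<delta> ?M (ldual C ?T) \<star> F (idt ?M \<boxtimes> dual \<rho>)"
    using d_natural [of "idt ?M" "dual \<rho>"] by simp
  have nat2: "\<delta> ?M (ldual C ?T) \<star> F (\<rho> \<boxtimes> idt (ldual C ?T))
      = (F \<rho> \<boxtimes> idt (fobj T (ldual C ?T))) \<star> \<delta> ?T (ldual C ?T)"
    using d_natural [of \<rho> "idt (ldual C ?T)"] by simp
  have "mten \<rho> (dact \<rho>) \<star> F (coev ?M)
      = (\<rho> \<boxtimes> \<s> ?M) \<star> ((idt ?T \<boxtimes> F (dual \<rho>)) \<star> \<delta> ?M ?M') \<star> F (coev ?M)"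
    by (simp add: mten_def dact_def interchange_extend)
  also have "\<dots> = (\<rho> \<boxtimes> \<s> ?M) \<star> \<delta> ?M (ldual C ?T) \<star> F ((idt ?M \<boxtimes> dual \<rho>) \<star> coev ?M)"
    by (simp add: nat1 F_cmp)
  also have "\<dots> = (\<rho> \<boxtimes> \<s> ?M) \<star> (\<delta> ?M (ldual C ?T) \<star> F (\<rho> \<boxtimes> idt (ldual C ?T))) \<star> F (coev ?T)"
    by (simp add: coev_dual F_cmp)
  also have "\<dots> = ((\<rho> \<star> F \<rho>) \<boxtimes> \<s> ?M) \<star> \<delta> ?T (ldual C ?T) \<star> F (coev ?T)"
    by (simp add: nat2 interchange_extend)
  also have "\<dots> = (\<rho> \<boxtimes> idt ?M') \<star> (\<mu> ?M \<boxtimes> \<s> ?M) \<star> \<delta> ?T (ldual C ?T) \<star> F (coev ?T)"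
    by (simp add: is_module_assoc interchange_extend)
  also have "\<dots> = ((\<rho> \<star> \<eta> ?M) \<boxtimes> idt ?M') \<star> coev ?M \<star> \<epsilon>"
    by (simp add: interchange_extend flip: antipode_coev)
  finally show ?thesis
    by (simp add: is_module_unit)
qed

text \<open>
  By uniqueness of duals over the comonoidal functors \<open>1\<close> and \<open>T\<^sup>2\<close>, any arrow \<open>T(\<^sup>\<or>M) \<rightarrow> \<^sup>\<or>M\<close>
  that makes evaluation and coevaluation linear is automatically an action.
\<close>

lemma is_module_dact [simp]:
  assumes [simp]: "is_module \<rho>"
  shows "is_module (dact \<rho>)"
proof -
  let ?M = "tgt \<rho>"
  let ?T = "fobj T ?M" and ?N = "ldual C ?M"
  have "dact \<rho> \<star> \<eta> ?N = idt ?N"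
  \<comment> \<open>The two candidates are \<open>dact \<rho> \<star> \<eta> N\<close> and the
    identity, paired with the identity of \<open>M\<close>; the coevaluation condition for the
    latter is trivial.\<close>
  proof (rule comonoidal_functor.pairing_unique [OF identity_comonoidal, of ?M ?N "ev ?M" "coev ?M" "idt ?M"])
    have "ev ?M \<star> ((dact \<rho> \<star> \<eta> ?N) \<boxtimes> idt ?M) = ev ?M \<star> (dact \<rho> \<boxtimes> \<rho>) \<star> (\<eta> ?N \<boxtimes> \<eta> ?M)"
      by (simp add: interchange is_module_unit)
    also have "\<dots> = (ev ?M \<star> mten (dact \<rho>) \<rho>) \<star> \<eta> (?N \<odot> ?M)"
      by (simp add: mten_def comul_unit)
    also have "\<dots> = \<epsilon> \<star> \<eta> \<one> \<star> ev ?M"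
      using unit_natural [of "ev ?M"] by (simp add: ev_dact)
    also have "\<dots> = (\<epsilon> \<star> \<eta> \<one>) \<star> ev ?M"
      by simp
    finally show "ev ?M \<star> ((dact \<rho> \<star> \<eta> ?N) \<boxtimes> idt ?M) \<star> idt (?N \<odot> ?M) = idt \<one> \<star> ev ?M"
      by (simp add: counit_unit)
  qed (simp_all add: zigzag)
  moreover have "dact \<rho> \<star> \<mu> ?N = dact \<rho> \<star> F (dact \<rho>)"
  \<comment> \<open>Over the square of \<open>T\<close>, the map on \<open>M\<close> is
    \<open>\<rho> \<star> \<mu> M\<close>, equal to \<open>\<rho> \<star> F \<rho>\<close>. The
    first form suits the evaluation test of \<open>dact \<rho> \<star> \<mu> N\<close>, the second
    the coevaluation test of \<open>dact \<rho> \<star> F (dact \<rho>)\<close>.\<close>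
  proof (rule comonoidal_functor.pairing_unique [OF square_comonoidal, of ?M ?N "ev ?M" "coev ?M" "\<rho> \<star> \<mu> ?M"])
    have "ev ?M \<star> ((dact \<rho> \<star> \<mu> ?N) \<boxtimes> (\<rho> \<star> \<mu> ?M)) \<star> \<delta> (fobj T ?N) ?T \<star> F (\<delta> ?N ?M)
        = ev ?M \<star> (dact \<rho> \<boxtimes> \<rho>) \<star> (\<mu> ?N \<boxtimes> \<mu> ?M) \<star> \<delta> (fobj T ?N) ?T \<star> F (\<delta> ?N ?M)"
      by (simp add: interchange_extend)
    also have "\<dots> = (ev ?M \<star> mten (dact \<rho>) \<rho>) \<star> \<mu> (?N \<odot> ?M)"
      by (simp add: mten_def comul_mul)
    also have "\<dots> = (\<epsilon> \<star> \<mu> \<one>) \<star> F (F (ev ?M))"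
      using mul_natural [of "ev ?M"] by (simp add: ev_dact)
    finally show "ev ?M \<star> ((dact \<rho> \<star> \<mu> ?N) \<boxtimes> (\<rho> \<star> \<mu> ?M)) \<star> \<delta> (fobj T ?N) (fobj T ?M) \<star> F (\<delta> ?N ?M)
        = (\<epsilon> \<star> F \<epsilon>) \<star> F (F (ev ?M))"
      by (simp add: counit_mul)
    have nat: "\<delta> ?M ?N \<star> F (\<rho> \<boxtimes> dact \<rho>) = (F \<rho> \<boxtimes> F (dact \<rho>)) \<star> \<delta> ?T (fobj T ?N)"
      using d_natural [of \<rho> "dact \<rho>"] by simp
    have "((\<rho> \<star> \<mu> ?M) \<boxtimes> (dact \<rho> \<star> F (dact \<rho>))) \<star> (\<delta> ?T (fobj T ?N) \<star> F (\<delta> ?M ?N)) \<star> F (F (coev ?M))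
        = (\<rho> \<boxtimes> dact \<rho>) \<star> ((F \<rho> \<boxtimes> F (dact \<rho>)) \<star> \<delta> ?T (fobj T ?N)) \<star> F (\<delta> ?M ?N) \<star> F (F (coev ?M))"
      by (simp add: interchange_extend is_module_assoc)
    also have "\<dots> = mten \<rho> (dact \<rho>) \<star> F (mten \<rho> (dact \<rho>) \<star> F (coev ?M))"
      unfolding nat [symmetric] by (simp add: mten_def F_cmp)
    also have "\<dots> = mten \<rho> (dact \<rho>) \<star> F (coev ?M \<star> \<epsilon>)"
      by (simp add: coev_dact)
    also have "\<dots> = (mten \<rho> (dact \<rho>) \<star> F (coev ?M)) \<star> F \<epsilon>"
      by (simp add: F_cmp)
    finally show "((\<rho> \<star> \<mu> ?M) \<boxtimes> (dact \<rho> \<star> F (dact \<rho>))) \<star> (\<delta> ?T (fobj T ?N) \<star> F (\<delta> ?M ?N)) \<star> F (F (coev ?M))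
        = coev ?M \<star> \<epsilon> \<star> F \<epsilon>"
      by (simp add: coev_dact)
  qed (simp_all add: zigzag)
  ultimately show ?thesis
    by (intro is_moduleI) simp_all
qed

end

section \<open>The reversed tensor product\<close>

text \<open>Right duals are left duals for the reversed tensor product, so only left duals are treated by hand.\<close>

definition rev_cat :: "('o, 'm, 'a) autonomous_scheme \<Rightarrow> ('o, 'm, 'a) autonomous_scheme" where
  "rev_cat C = C\<lparr>tensor_obj := \<lambda>X Y. tensor_obj C Y X, tensor_arr := \<lambda>f g. tensor_arr C g f,
     ldual := rdual C, left_ev := right_ev C, left_coev := right_coev C,
     rdual := ldual C, right_ev := left_ev C, right_coev := left_coev C\<rparr>"

definition rev_bimonad :: "('o, 'm, 'b) bimonad_scheme \<Rightarrow> ('o, 'm, 'b) bimonad_scheme" where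
  "rev_bimonad T = T\<lparr>T2 := \<lambda>X Y. T2 T Y X\<rparr>"

lemma rev_cat_simps [simp]:
  "Obj (rev_cat C) = Obj C" "Hom (rev_cat C) = Hom C" "Comp (rev_cat C) = Comp C"
  "Id (rev_cat C) = Id C" "tensor_obj (rev_cat C) X Y = tensor_obj C Y X"
  "tensor_arr (rev_cat C) f g = tensor_arr C g f" "unit_obj (rev_cat C) = unit_obj C"
  "ldual (rev_cat C) = rdual C" "left_ev (rev_cat C) = right_ev C"
  "left_coev (rev_cat C) = right_coev C" "rdual (rev_cat C) = ldual C"
  "right_ev (rev_cat C) = left_ev C" "right_coev (rev_cat C) = left_coev C"
  by (simp_all add: rev_cat_def)

lemma rev_bimonad_simps [simp]:
  "fobj (rev_bimonad T) = fobj T" "farr (rev_bimonad T) = farr T" "mu (rev_bimonad T) = mu T"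
  "eta (rev_bimonad T) = eta T" "T2 (rev_bimonad T) X Y = T2 T Y X" "T0 (rev_bimonad T) = T0 T"
  by (simp_all add: rev_bimonad_def)

context autonomous_category
begin

lemma category_rev: "category (rev_cat C)"
  using category_axioms by (simp add: category_def)

lemma strict_monoidal_rev: "strict_monoidal_category (rev_cat C)"
proof (intro strict_monoidal_category.intro category_rev strict_monoidal_category_axioms.intro)
  fix X Y X' Y' X'' Y'' f f' g g'
  assume "X \<in> Obj (rev_cat C)" "Y \<in> Obj (rev_cat C)" "X' \<in> Obj (rev_cat C)" "Y' \<in> Obj (rev_cat C)"
    "X'' \<in> Obj (rev_cat C)" "Y'' \<in> Obj (rev_cat C)" "f \<in> Hom (rev_cat C) X X'"
    "f' \<in> Hom (rev_cat C) X' X''" "g \<in> Hom (rev_cat C) Y Y'" "g' \<in> Hom (rev_cat C) Y' Y''"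
  then show "(f' \<cdot>\<^bsub>rev_cat C\<^esub> f) \<otimes>\<^bsub>rev_cat C\<^esub> (g' \<cdot>\<^bsub>rev_cat C\<^esub> g)
      = (f' \<otimes>\<^bsub>rev_cat C\<^esub> g') \<cdot>\<^bsub>rev_cat C\<^esub> (f \<otimes>\<^bsub>rev_cat C\<^esub> g)"
    using tensor_Comp [of Y X Y' X' Y'' X'' g g' f f'] by simp
next
  fix X Y Z X' Y' Z' f g h
  assume "X \<in> Obj (rev_cat C)" "Y \<in> Obj (rev_cat C)" "Z \<in> Obj (rev_cat C)" "X' \<in> Obj (rev_cat C)"
    "Y' \<in> Obj (rev_cat C)" "Z' \<in> Obj (rev_cat C)" "f \<in> Hom (rev_cat C) X X'"
    "g \<in> Hom (rev_cat C) Y Y'" "h \<in> Hom (rev_cat C) Z Z'"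
  then show "(f \<otimes>\<^bsub>rev_cat C\<^esub> g) \<otimes>\<^bsub>rev_cat C\<^esub> h = f \<otimes>\<^bsub>rev_cat C\<^esub> (g \<otimes>\<^bsub>rev_cat C\<^esub> h)"
    using tensor_arr_assoc [of Z Y X Z' Y' X' h g f] by simp
next
  fix X X' f
  assume "X \<in> Obj (rev_cat C)" "X' \<in> Obj (rev_cat C)" "f \<in> Hom (rev_cat C) X X'"
  then show "Id (rev_cat C) \<one>\<^bsub>rev_cat C\<^esub> \<otimes>\<^bsub>rev_cat C\<^esub> f = f"
    and "f \<otimes>\<^bsub>rev_cat C\<^esub> Id (rev_cat C) \<one>\<^bsub>rev_cat C\<^esub> = f"
    using unit_tensor_arr [of X X' f] tensor_unit_arr [of X X' f] by simp_all
qed (simp_all add: tensor_Id tensor_in_Hom)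

lemma autonomous_rev: "autonomous_category (rev_cat C)"
  by (intro autonomous_category.intro strict_monoidal_rev autonomous_category_axioms.intro)
    (simp_all add: left_ev_in_Hom left_coev_in_Hom right_ev_in_Hom right_coev_in_Hom rdual_in_Obj
      ldual_zigzag rdual_zigzag)

text \<open>Reversal changes the bracketing of the threefold tensor product in the middle of each
  formula, whence the two instances of associativity.\<close>

lemma
  assumes "X \<in> Obj C" "Y \<in> Obj C" "f \<in> Hom C X Y"
  shows ldual_arr_rev: "ldual_arr (rev_cat C) X Y f = rdual_arr C X Y f"
    and rdual_arr_rev: "rdual_arr (rev_cat C) X Y f = ldual_arr C X Y f"
  using assms
  by (simp_all add: ldual_arr_def rdual_arr_def rdual_in_Obj Id_in_Hom
      tensor_arr_assoc [of "rdual C X" X "rdual C Y" "rdual C X" Y "rdual C Y"]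
      tensor_arr_assoc [of "ldual C Y" X "ldual C X" "ldual C Y" Y "ldual C X"])

end

context hopf_monad
begin

lemma bimonad_rev: "bimonad (rev_cat C) (rev_bimonad T)"
proof (intro bimonad.intro strict_monoidal_rev bimonad_axioms.intro)
  show "monad (rev_cat C) (rev_bimonad T)"
    using monad_axioms by (simp add: monad_def monad_axioms_def category_rev)
next
  fix X Y X' Y' f g
  assume "X \<in> Obj (rev_cat C)" "Y \<in> Obj (rev_cat C)" "X' \<in> Obj (rev_cat C)" "Y' \<in> Obj (rev_cat C)"
    "f \<in> Hom (rev_cat C) X X'" "g \<in> Hom (rev_cat C) Y Y'"
  then show "(farr (rev_bimonad T) f \<otimes>\<^bsub>rev_cat C\<^esub> farr (rev_bimonad T) g) \<cdot>\<^bsub>rev_cat C\<^esub> T2 (rev_bimonad T) X Y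
      = T2 (rev_bimonad T) X' Y' \<cdot>\<^bsub>rev_cat C\<^esub> farr (rev_bimonad T) (f \<otimes>\<^bsub>rev_cat C\<^esub> g)"
    using T2_natural [of Y X Y' X' g f] by simp
qed (simp_all add: T2_in_Hom T0_in_Hom T2_coassoc T2_counit_left T2_counit_right T2_mu T0_mu T2_eta T0_eta)

text \<open>The right antipode axioms are the left ones read in the opposite tensor order, hence the
  swapped antipodes.\<close>

lemma hopf_monad_rev: "hopf_monad (rev_cat C) (rev_bimonad T) sr sl"
  by (intro hopf_monad.intro autonomous_rev bimonad_rev hopf_monad_axioms.intro)
    (simp_all add: ldual_arr_rev rdual_arr_rev rdual_in_Obj farr_in_Hom eta_in_Hom mu_in_Hom
      sl_in_Hom sr_in_Hom sl_natural sr_natural sl_ev sr_ev sl_coev sr_coev)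

end

section \<open>The category of modules\<close>

context hopf_monad
begin

abbreviation ldual_module :: "'o \<times> 'm \<Rightarrow> 'o \<times> 'm" where
  "ldual_module N \<equiv> (ldual C (fst N), sl (fst N) \<cdot> farr T (ldual_arr C (fobj T (fst N)) (fst N) (snd N)))"

abbreviation tensor_module :: "'o \<times> 'm \<Rightarrow> 'o \<times> 'm \<Rightarrow> 'o \<times> 'm" where
  "tensor_module N N' \<equiv> (fst N \<odot> fst N', (snd N \<otimes> snd N') \<cdot> T2 T (fst N) (fst N'))"

text \<open>With its two companions below, the dictionary by which facts about \<open>dact\<close>,
  \<open>mten\<close> and \<open>\<epsilon>\<close> become facts about the pairs that are the
  objects of \<open>module_category\<close>.\<close>

lemma act_ldual_module: "act (ldual_module N) = dact (act N)"
  by (simp add: dact_def antipode_def cmp_def F_def dual_def)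

lemma act_tensor_module: "act (tensor_module N N') = mten (act N) (act N')"
  by (simp add: mten_def comul_def cmp_def ten_def)

lemma act_unit: "act (\<one>, T0 T) = \<epsilon>"
  by (simp add: counit_def)

lemma is_module_act [simp]: "N \<in> modules C T \<Longrightarrow> is_module (act N)"
  by (simp add: modules_iff)

lemma fst_module [simp]: "N \<in> modules C T \<Longrightarrow> fst N \<in> Obj C"
  and snd_module [simp]: "N \<in> modules C T \<Longrightarrow> snd N \<in> Hom C (fobj T (fst N)) (fst N)"
  by (auto simp: modules_def)

lemma ldual_module_in_modules: "N \<in> modules C T \<Longrightarrow> ldual_module N \<in> modules C T"
  unfolding modules_iff act_ldual_module by simp

lemma tensor_module_in_modules:
  "\<lbrakk>N \<in> modules C T; N' \<in> modules C T\<rbrakk> \<Longrightarrow> tensor_module N N' \<in> modules C T"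
  unfolding modules_iff act_tensor_module by simp

lemma unit_in_modules: "(\<one>, T0 T) \<in> modules C T"
  unfolding modules_iff act_unit by simp

lemma left_ev_module_hom:
  assumes "N \<in> modules C T"
  shows "left_ev C (fst N) \<in> module_hom C T (tensor_module (ldual_module N) N) (\<one>, T0 T)"
proof -
  have "is_module_hom (mten (dact (act N)) (act N)) \<epsilon> (ev (fst N))"
    using ev_dact [of "act N"] assms by (simp add: is_module_hom_def)
  then show ?thesis
    using assms module_hom_iff [OF tensor_module_in_modules [OF ldual_module_in_modules] unit_in_modules]
    unfolding act_tensor_module act_ldual_module act_unit by (simp add: ev_def)
qed

lemma left_coev_module_hom:
  assumes "N \<in> modules C T"
  shows "left_coev C (fst N) \<in> module_hom C T (\<one>, T0 T) (tensor_module N (ldual_module N))"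
proof -
  have "is_module_hom \<epsilon> (mten (act N) (dact (act N))) (coev (fst N))"
    using coev_dact [of "act N"] assms by (simp add: is_module_hom_def)
  then show ?thesis
    using assms module_hom_iff [OF unit_in_modules tensor_module_in_modules [OF _ ldual_module_in_modules]]
    unfolding act_tensor_module act_ldual_module act_unit by (simp add: coev_def)
qed


abbreviation TC :: "('o \<times> 'm, 'm) autonomous" where
  "TC \<equiv> module_category C T sl sr"

lemma module_category_simps [simp]:
  "Obj TC = modules C T" "Hom TC = module_hom C T" "Comp TC = Comp C" "Id TC N = Id C (fst N)"
  "tensor_obj TC N N' = tensor_module N N'" "tensor_arr TC = tensor_arr C" "unit_obj TC = (\<one>, T0 T)"
  "ldual TC N = ldual_module N" "left_ev TC N = left_ev C (fst N)"
  "left_coev TC N = left_coev C (fst N)"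
  "rdual TC N = (rdual C (fst N), sr (fst N) \<cdot> farr T (rdual_arr C (fobj T (fst N)) (fst N) (snd N)))"
  "right_ev TC N = right_ev C (fst N)" "right_coev TC N = right_coev C (fst N)"
  by (simp_all add: module_category_def split: prod.splits)

lemma module_homD: "f \<in> module_hom C T N N' \<Longrightarrow> f \<in> Hom C (fst N) (fst N')"
  by (auto simp: module_hom_def split: prod.splits)

lemma module_category_is_category: "category TC"
proof (rule category.intro)
  fix X Y Z f g
  assume XYZ: "X \<in> Obj TC" "Y \<in> Obj TC" "Z \<in> Obj TC" and f: "f \<in> Hom TC X Y" and g: "g \<in> Hom TC Y Z"
  let ?f = "Arr (fst X) f (fst Y)" and ?g = "Arr (fst Y) g (fst Z)"
  have "is_module_hom (act X) (act Y) ?f" "is_module_hom (act Y) (act Z) ?g"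
    using f g XYZ by (simp_all add: module_hom_iff)
  then have "is_module_hom (act X) (act Z) (?g \<star> ?f)"
    using XYZ by (intro is_module_hom_cmp [of _ "act Y"]) simp_all
  then show "g \<cdot>\<^bsub>TC\<^esub> f \<in> Hom TC X Z"
    using XYZ by (simp add: module_hom_iff cmp_def)
next
  fix W X Y Z f g h
  assume "W \<in> Obj TC" "X \<in> Obj TC" "Y \<in> Obj TC" "Z \<in> Obj TC"
    "f \<in> Hom TC W X" "g \<in> Hom TC X Y" "h \<in> Hom TC Y Z"
  then show "(h \<cdot>\<^bsub>TC\<^esub> g) \<cdot>\<^bsub>TC\<^esub> f = h \<cdot>\<^bsub>TC\<^esub> (g \<cdot>\<^bsub>TC\<^esub> f)"
    using Comp_assoc [of "fst W" "fst X" "fst Y" "fst Z" f g h] by (simp add: module_homD)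
next
  fix X assume X: "X \<in> Obj TC"
  then have "is_module_hom (act X) (act X) (idt (fst X))"
    by (simp add: is_module_hom_def)
  then show "Id TC X \<in> Hom TC X X"
    using X by (simp add: module_hom_iff idt_def)
next
  fix X Y f
  assume "X \<in> Obj TC" "Y \<in> Obj TC" "f \<in> Hom TC X Y"
  then show "f \<cdot>\<^bsub>TC\<^esub> Id TC X = f" "Id TC Y \<cdot>\<^bsub>TC\<^esub> f = f"
    using Comp_Id [of "fst X" "fst Y" f] Id_Comp [of "fst X" "fst Y" f] by (simp_all add: module_homD)
qed

lemma module_category_strict_monoidal: "strict_monoidal_category TC"
proof (intro strict_monoidal_category.intro module_category_is_category
    strict_monoidal_category_axioms.intro)
  show "\<one>\<^bsub>TC\<^esub> \<in> Obj TC"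
    using unit_in_modules by simp
next
  fix X Y assume "X \<in> Obj TC" "Y \<in> Obj TC"
  then show "X \<odot>\<^bsub>TC\<^esub> Y \<in> Obj TC" "Id TC X \<otimes>\<^bsub>TC\<^esub> Id TC Y = Id TC (X \<odot>\<^bsub>TC\<^esub> Y)"
    using tensor_module_in_modules [of X Y] by (simp_all add: tensor_Id)
next
  fix X Y X' Y' f g
  assume XY: "X \<in> Obj TC" "Y \<in> Obj TC" "X' \<in> Obj TC" "Y' \<in> Obj TC"
    and fg: "f \<in> Hom TC X X'" "g \<in> Hom TC Y Y'"
  let ?f = "Arr (fst X) f (fst X')" and ?g = "Arr (fst Y) g (fst Y')"
  have "is_module_hom (act X) (act X') ?f" "is_module_hom (act Y) (act Y') ?g"
    using fg XY by (simp_all add: module_hom_iff)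
  then have "is_module_hom (mten (act X) (act Y)) (mten (act X') (act Y')) (?f \<boxtimes> ?g)"
    using XY by (intro is_module_hom_ten) simp_all
  then show "f \<otimes>\<^bsub>TC\<^esub> g \<in> Hom TC (X \<odot>\<^bsub>TC\<^esub> Y) (X' \<odot>\<^bsub>TC\<^esub> Y')"
    using XY module_hom_iff [OF tensor_module_in_modules tensor_module_in_modules, of X Y X' Y']
    unfolding act_tensor_module by (simp add: ten_def)
next
  fix X Y X' Y' X'' Y'' f f' g g'
  assume "X \<in> Obj TC" "Y \<in> Obj TC" "X' \<in> Obj TC" "Y' \<in> Obj TC"
    "X'' \<in> Obj TC" "Y'' \<in> Obj TC" "f \<in> Hom TC X X'"
    "f' \<in> Hom TC X' X''" "g \<in> Hom TC Y Y'" "g' \<in> Hom TC Y' Y''"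
  then show "(f' \<cdot>\<^bsub>TC\<^esub> f) \<otimes>\<^bsub>TC\<^esub> (g' \<cdot>\<^bsub>TC\<^esub> g) = (f' \<otimes>\<^bsub>TC\<^esub> g') \<cdot>\<^bsub>TC\<^esub> (f \<otimes>\<^bsub>TC\<^esub> g)"
    using tensor_Comp [of "fst X" "fst Y" "fst X'" "fst Y'" "fst X''" "fst Y''" f f' g g']
    by (simp add: module_homD)
next
  fix X Y Z assume XYZ: "X \<in> Obj TC" "Y \<in> Obj TC" "Z \<in> Obj TC"
  \<comment> \<open>Strictness concerns the actions as well as the carriers; an equation between
    \<open>act\<close> arrows states both at once.\<close>
  have "act (tensor_module (tensor_module X Y) Z) = act (tensor_module X (tensor_module Y Z))"
    unfolding act_tensor_module using XYZ by (intro mten_assoc) simp_all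
  then show "(X \<odot>\<^bsub>TC\<^esub> Y) \<odot>\<^bsub>TC\<^esub> Z = X \<odot>\<^bsub>TC\<^esub> (Y \<odot>\<^bsub>TC\<^esub> Z)"
    by simp
next
  fix X assume X: "X \<in> Obj TC"
  have "act (tensor_module (\<one>, T0 T) X) = act X" "act (tensor_module X (\<one>, T0 T)) = act X"
    unfolding act_tensor_module act_unit using X by (auto intro: mten_counit)
  then show "\<one>\<^bsub>TC\<^esub> \<odot>\<^bsub>TC\<^esub> X = X" "X \<odot>\<^bsub>TC\<^esub> \<one>\<^bsub>TC\<^esub> = X"
    by (simp_all add: prod_eq_iff)
next
  fix X Y Z X' Y' Z' f g h
  assume "X \<in> Obj TC" "Y \<in> Obj TC" "Z \<in> Obj TC" "X' \<in> Obj TC"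
    "Y' \<in> Obj TC" "Z' \<in> Obj TC" "f \<in> Hom TC X X'"
    "g \<in> Hom TC Y Y'" "h \<in> Hom TC Z Z'"
  then show "(f \<otimes>\<^bsub>TC\<^esub> g) \<otimes>\<^bsub>TC\<^esub> h = f \<otimes>\<^bsub>TC\<^esub> (g \<otimes>\<^bsub>TC\<^esub> h)"
    using tensor_arr_assoc [of "fst X" "fst Y" "fst Z" "fst X'" "fst Y'" "fst Z'" f g h]
    by (simp add: module_homD)
next
  fix X X' f
  assume "X \<in> Obj TC" "X' \<in> Obj TC" "f \<in> Hom TC X X'"
  then show "Id TC \<one>\<^bsub>TC\<^esub> \<otimes>\<^bsub>TC\<^esub> f = f" "f \<otimes>\<^bsub>TC\<^esub> Id TC \<one>\<^bsub>TC\<^esub> = f"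
    using unit_tensor_arr [of "fst X" "fst X'" f] tensor_unit_arr [of "fst X" "fst X'" f]
    by (simp_all add: module_homD)
qed

lemma module_category_autonomous: "autonomous_category TC"
proof (intro autonomous_category.intro module_category_strict_monoidal
    autonomous_category_axioms.intro)
  \<comment> \<open>The right half of the structure comes from the left-dual lemmas in the reversed
    setting. Modules and their morphisms do not mention the tensor product, so they are literally
    the same there.\<close>
  interpret rev: hopf_monad "rev_cat C" "rev_bimonad T" sr sl
    by (rule hopf_monad_rev)
  have rev_modules: "modules (rev_cat C) (rev_bimonad T) = modules C T"
    by (simp add: modules_def)
  have rev_hom: "module_hom (rev_cat C) (rev_bimonad T) = module_hom C T"
    by (simp add: module_hom_def)
  fix N assume N: "N \<in> Obj TC"
  have dual_snd: "ldual_arr (rev_cat C) (fobj T (fst N)) (fst N) (snd N) = rdual_arr C (fobj T (fst N)) (fst N) (snd N)"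
    using N by (intro ldual_arr_rev) (auto simp: modules_def)
  show "ldual TC N \<in> Obj TC" "left_ev TC N \<in> Hom TC (ldual TC N \<odot>\<^bsub>TC\<^esub> N) \<one>\<^bsub>TC\<^esub>"
    "left_coev TC N \<in> Hom TC \<one>\<^bsub>TC\<^esub> (N \<odot>\<^bsub>TC\<^esub> ldual TC N)"
    using N ldual_module_in_modules [of N] left_ev_module_hom [of N] left_coev_module_hom [of N]
    by simp_all
  show "rdual TC N \<in> Obj TC" "right_ev TC N \<in> Hom TC (N \<odot>\<^bsub>TC\<^esub> rdual TC N) \<one>\<^bsub>TC\<^esub>"
    "right_coev TC N \<in> Hom TC \<one>\<^bsub>TC\<^esub> (rdual TC N \<odot>\<^bsub>TC\<^esub> N)"
    using N rev.ldual_module_in_modules [of N] rev.left_ev_module_hom [of N]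
      rev.left_coev_module_hom [of N]
    by (simp_all add: rev_modules rev_hom dual_snd)
qed (simp_all add: ldual_zigzag rdual_zigzag)

end

section \<open>The braiding of modules\<close>

context quasitriangular_bimonad
begin

definition Rt :: "'o \<Rightarrow> 'o \<Rightarrow> ('o, 'm) arrow"  ("\<R>") where
  "\<R> X Y = Arr (X \<odot> Y) (R X Y) (fobj T Y \<odot> fobj T X)"

lemma src_Rt [simp]: "src (\<R> X Y) = X \<odot> Y"
  and tgt_Rt [simp]: "tgt (\<R> X Y) = fobj T Y \<odot> fobj T X"
  by (simp_all add: Rt_def)

lemma arr_Rt [simp]: "\<lbrakk>X \<in> Obj C; Y \<in> Obj C\<rbrakk> \<Longrightarrow> arr (\<R> X Y)"
  by (simp add: Rt_def R_in_Hom)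

lemma Rt_natural:
  "\<lbrakk>arr f; arr g; src f = X; src g = Y; tgt f = X'; tgt g = Y'\<rbrakk>
    \<Longrightarrow> \<R> X' Y' \<star> (f \<boxtimes> g) = (F g \<boxtimes> F f) \<star> \<R> X Y"
  using R_natural [of "src f" "src g" "tgt f" "tgt g" "und f" "und g"]
  by (auto simp: Rt_def cmp_def ten_def F_def)

lemma Rt_comul:
  "\<lbrakk>X \<in> Obj C; Y \<in> Obj C\<rbrakk>
    \<Longrightarrow> (\<mu> Y \<boxtimes> \<mu> X) \<star> \<R> (fobj T X) (fobj T Y) \<star> \<delta> X Y
      = (\<mu> Y \<boxtimes> \<mu> X) \<star> \<delta> (fobj T Y) (fobj T X) \<star> F (\<R> X Y)"
  by (simp add: Rt_def cmp_def ten_def F_def mul_def comul_def R_T2)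

lemma Rt_ten_left:
  "\<lbrakk>X \<in> Obj C; Y \<in> Obj C; Z \<in> Obj C\<rbrakk>
    \<Longrightarrow> (idt (fobj T Z) \<boxtimes> \<delta> X Y) \<star> \<R> (X \<odot> Y) Z
      = (\<mu> Z \<boxtimes> idt (fobj T X \<odot> fobj T Y)) \<star> (\<R> X (fobj T Z) \<boxtimes> idt (fobj T Y)) \<star> (idt X \<boxtimes> \<R> Y Z)"
  by (simp add: Rt_def cmp_def ten_def idt_def mul_def comul_def R_tensor_left)

lemma Rt_ten_right:
  "\<lbrakk>X \<in> Obj C; Y \<in> Obj C; Z \<in> Obj C\<rbrakk>
    \<Longrightarrow> (\<delta> Y Z \<boxtimes> idt (fobj T X)) \<star> \<R> X (Y \<odot> Z)
      = (idt (fobj T Y \<odot> fobj T Z) \<boxtimes> \<mu> X) \<star> (idt (fobj T Y) \<boxtimes> \<R> (fobj T X) Z) \<star> (\<R> X Y \<boxtimes> idt Z)"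
  by (simp add: Rt_def cmp_def ten_def idt_def mul_def comul_def R_tensor_right)

lemma Rt_inverse:
  obtains Q where
    "\<And>X Y. \<lbrakk>X \<in> Obj C; Y \<in> Obj C\<rbrakk> \<Longrightarrow> arr (Q X Y)"
    "\<And>X Y. src (Q X Y) = Y \<odot> X"
    "\<And>X Y. tgt (Q X Y) = fobj T X \<odot> fobj T Y"
    "\<And>f g X Y X' Y'. \<lbrakk>arr f; arr g; src f = X; src g = Y; tgt f = X'; tgt g = Y'\<rbrakk>
      \<Longrightarrow> Q X' Y' \<star> (g \<boxtimes> f) = (F f \<boxtimes> F g) \<star> Q X Y"
    "\<And>X Y. \<lbrakk>X \<in> Obj C; Y \<in> Obj C\<rbrakk>
      \<Longrightarrow> (\<mu> X \<boxtimes> \<mu> Y) \<star> Q (fobj T X) (fobj T Y) \<star> \<R> X Y = \<eta> X \<boxtimes> \<eta> Y"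
    "\<And>X Y. \<lbrakk>X \<in> Obj C; Y \<in> Obj C\<rbrakk>
      \<Longrightarrow> (\<mu> Y \<boxtimes> \<mu> X) \<star> \<R> (fobj T X) (fobj T Y) \<star> Q X Y = \<eta> Y \<boxtimes> \<eta> X"
proof -
  obtain R' where
    hom: "\<forall>X \<in> Obj C. \<forall>Y \<in> Obj C. R' X Y \<in> Hom C (Y \<odot> X) (fobj T X \<odot> fobj T Y)"
    and nat: "\<forall>X \<in> Obj C. \<forall>Y \<in> Obj C. \<forall>X' \<in> Obj C. \<forall>Y' \<in> Obj C.
      \<forall>f \<in> Hom C X X'. \<forall>g \<in> Hom C Y Y'.
        (farr T f \<otimes> farr T g) \<cdot> R' X Y = R' X' Y' \<cdot> (g \<otimes> f)"
    and inv: "\<forall>X \<in> Obj C. \<forall>Y \<in> Obj C.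
      (mu T X \<otimes> mu T Y) \<cdot> R' (fobj T X) (fobj T Y) \<cdot> R X Y = eta T X \<otimes> eta T Y
      \<and> (mu T Y \<otimes> mu T X) \<cdot> R (fobj T X) (fobj T Y) \<cdot> R' X Y = eta T Y \<otimes> eta T X"
    using R_star_invertible by (elim exE conjE) (rule that)
  have nat': "Arr (Y' \<odot> X') (R' X' Y') (fobj T X' \<odot> fobj T Y') \<star> (g \<boxtimes> f)
      = (F f \<boxtimes> F g) \<star> Arr (Y \<odot> X) (R' X Y) (fobj T X \<odot> fobj T Y)"
    if "arr f" "arr g" "src f = X" "src g = Y" "tgt f = X'" "tgt g = Y'" for f g X Y X' Y'
    using that nat [rule_format, of "src f" "src g" "tgt f" "tgt g" "und f" "und g"]
    by (auto simp: cmp_def ten_def F_def)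
  show thesis
    by (rule that [of "\<lambda>X Y. Arr (Y \<odot> X) (R' X Y) (fobj T X \<odot> fobj T Y)"])
      ((simp add: nat'; fail) | simp add: hom inv Rt_def cmp_def ten_def mul_def unit_def)+
qed

definition tau :: "('o, 'm) arrow \<Rightarrow> ('o, 'm) arrow \<Rightarrow> ('o, 'm) arrow" where
  "tau \<rho> \<sigma> = (\<sigma> \<boxtimes> \<rho>) \<star> \<R> (tgt \<rho>) (tgt \<sigma>)"

lemma src_tau [simp]: "src (tau \<rho> \<sigma>) = tgt \<rho> \<odot> tgt \<sigma>"
  and tgt_tau [simp]: "tgt (tau \<rho> \<sigma>) = tgt \<sigma> \<odot> tgt \<rho>"
  by (simp_all add: tau_def)

lemma arr_tau [simp]: "\<lbrakk>is_module \<rho>; is_module \<sigma>\<rbrakk> \<Longrightarrow> arr (tau \<rho> \<sigma>)"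
  by (simp add: tau_def)

text \<open>The axiom \<open>Rt_comul\<close> holds only after composing with
  \<open>\<mu> \<boxtimes> \<mu>\<close>. Naturality of \<open>\<R>\<close> and of
  \<open>\<delta>\<close> gives each side a factor \<open>F \<sigma> \<boxtimes> F \<rho>\<close>,
  which the outer actions convert into that \<open>\<mu> \<boxtimes> \<mu>\<close>. The same
  conversion recurs in the braiding lemmas below.\<close>

lemma is_module_hom_tau:
  assumes [simp]: "is_module \<rho>" "is_module \<sigma>"
  shows "is_module_hom (mten \<rho> \<sigma>) (mten \<sigma> \<rho>) (tau \<rho> \<sigma>)"
proof -
  let ?M = "tgt \<rho>" and ?N = "tgt \<sigma>"
  let ?TM = "fobj T ?M" and ?TN = "fobj T ?N"
  have nat1: "\<R> ?M ?N \<star> (\<rho> \<boxtimes> \<sigma>) = (F \<sigma> \<boxtimes> F \<rho>) \<star> \<R> ?TM ?TN"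
    by (rule Rt_natural) simp_all
  have nat2: "\<delta> ?N ?M \<star> F (\<sigma> \<boxtimes> \<rho>) = (F \<sigma> \<boxtimes> F \<rho>) \<star> \<delta> ?TN ?TM"
    using d_natural [of \<sigma> \<rho>] by simp
  have "tau \<rho> \<sigma> \<star> mten \<rho> \<sigma> = (\<sigma> \<boxtimes> \<rho>) \<star> (\<R> ?M ?N \<star> (\<rho> \<boxtimes> \<sigma>)) \<star> \<delta> ?M ?N"
    by (simp add: tau_def mten_def)
  also have "\<dots> = (\<sigma> \<boxtimes> \<rho>) \<star> (\<mu> ?N \<boxtimes> \<mu> ?M) \<star> \<R> ?TM ?TN \<star> \<delta> ?M ?N"
    unfolding nat1 by (simp add: interchange_extend is_module_assoc)
  also have "\<dots> = (\<sigma> \<boxtimes> \<rho>) \<star> (\<mu> ?N \<boxtimes> \<mu> ?M) \<star> \<delta> ?TN ?TM \<star> F (\<R> ?M ?N)"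
    by (simp add: Rt_comul)
  also have "\<dots> = (\<sigma> \<boxtimes> \<rho>) \<star> (\<delta> ?N ?M \<star> F (\<sigma> \<boxtimes> \<rho>)) \<star> F (\<R> ?M ?N)"
    unfolding nat2 by (simp add: interchange_extend is_module_assoc)
  also have "\<dots> = mten \<sigma> \<rho> \<star> F (tau \<rho> \<sigma>)"
    by (simp add: mten_def tau_def F_cmp)
  finally show ?thesis
    by (simp add: is_module_hom_def)
qed

text \<open>The inverse is the star-inverse \<open>Q\<close> of the R-matrix followed by the
  actions. Converting actions into \<open>\<mu>\<close> reduces each composite to a star-inverse
  identity, whose value \<open>\<eta> \<boxtimes> \<eta>\<close> is cancelled by the unit
  laws.\<close>

lemma tau_inverse:
  assumes [simp]: "is_module \<rho>" "is_module \<sigma>"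
  obtains g where "is_module_hom (mten \<sigma> \<rho>) (mten \<rho> \<sigma>) g"
    "g \<star> tau \<rho> \<sigma> = idt (tgt \<rho> \<odot> tgt \<sigma>)" "tau \<rho> \<sigma> \<star> g = idt (tgt \<sigma> \<odot> tgt \<rho>)"
proof -
  obtain Q where Q [simp]: "\<And>X Y. \<lbrakk>X \<in> Obj C; Y \<in> Obj C\<rbrakk> \<Longrightarrow> arr (Q X Y)"
    "\<And>X Y. src (Q X Y) = Y \<odot> X"
    "\<And>X Y. tgt (Q X Y) = fobj T X \<odot> fobj T Y"
    and nat: "\<And>f g X Y X' Y'. \<lbrakk>arr f; arr g; src f = X; src g = Y; tgt f = X'; tgt g = Y'\<rbrakk>
      \<Longrightarrow> Q X' Y' \<star> (g \<boxtimes> f) = (F f \<boxtimes> F g) \<star> Q X Y"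
    and inv: "\<And>X Y. \<lbrakk>X \<in> Obj C; Y \<in> Obj C\<rbrakk>
      \<Longrightarrow> (\<mu> X \<boxtimes> \<mu> Y) \<star> Q (fobj T X) (fobj T Y) \<star> \<R> X Y = \<eta> X \<boxtimes> \<eta> Y"
    "\<And>X Y. \<lbrakk>X \<in> Obj C; Y \<in> Obj C\<rbrakk>
      \<Longrightarrow> (\<mu> Y \<boxtimes> \<mu> X) \<star> \<R> (fobj T X) (fobj T Y) \<star> Q X Y = \<eta> Y \<boxtimes> \<eta> X"
    by (rule Rt_inverse) blast
  let ?M = "tgt \<rho>" and ?N = "tgt \<sigma>"
  let ?TM = "fobj T ?M" and ?TN = "fobj T ?N"
  define g where "g = (\<rho> \<boxtimes> \<sigma>) \<star> Q ?M ?N"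
  have [simp]: "arr g" "src g = ?N \<odot> ?M" "tgt g = ?M \<odot> ?N"
    by (simp_all add: g_def)
  have nat1: "Q ?M ?N \<star> (\<sigma> \<boxtimes> \<rho>) = (F \<rho> \<boxtimes> F \<sigma>) \<star> Q ?TM ?TN"
    by (rule nat) simp_all
  have nat2: "\<R> ?M ?N \<star> (\<rho> \<boxtimes> \<sigma>) = (F \<sigma> \<boxtimes> F \<rho>) \<star> \<R> ?TM ?TN"
    by (rule Rt_natural) simp_all
  have "g \<star> tau \<rho> \<sigma> = (\<rho> \<boxtimes> \<sigma>) \<star> (Q ?M ?N \<star> (\<sigma> \<boxtimes> \<rho>)) \<star> \<R> ?M ?N"
    by (simp add: g_def tau_def)
  also have "\<dots> = (\<rho> \<boxtimes> \<sigma>) \<star> (\<mu> ?M \<boxtimes> \<mu> ?N) \<star> Q ?TM ?TN \<star> \<R> ?M ?N"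
    unfolding nat1 by (simp add: interchange_extend is_module_assoc)
  also have "\<dots> = idt (?M \<odot> ?N)"
    by (simp add: inv interchange is_module_unit)
  finally have 1: "g \<star> tau \<rho> \<sigma> = idt (?M \<odot> ?N)" .
  have "tau \<rho> \<sigma> \<star> g = (\<sigma> \<boxtimes> \<rho>) \<star> (\<R> ?M ?N \<star> (\<rho> \<boxtimes> \<sigma>)) \<star> Q ?M ?N"
    by (simp add: g_def tau_def)
  also have "\<dots> = (\<sigma> \<boxtimes> \<rho>) \<star> (\<mu> ?N \<boxtimes> \<mu> ?M) \<star> \<R> ?TM ?TN \<star> Q ?M ?N"
    unfolding nat2 by (simp add: interchange_extend is_module_assoc)
  also have "\<dots> = idt (?N \<odot> ?M)"
    by (simp add: inv interchange is_module_unit)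
  finally have 2: "tau \<rho> \<sigma> \<star> g = idt (?N \<odot> ?M)" .
  from 1 2 have "is_module_hom (mten \<sigma> \<rho>) (mten \<rho> \<sigma>) g"
    by (intro is_module_hom_inverse [OF _ _ is_module_hom_tau]) simp_all
  with 1 2 show thesis
    by (intro that)
qed

lemma tau_natural:
  assumes [simp]: "is_module \<rho>" "is_module \<rho>'" "is_module \<sigma>" "is_module \<sigma>'"
    and f: "is_module_hom \<rho> \<rho>' f" and g: "is_module_hom \<sigma> \<sigma>' g"
  shows "(g \<boxtimes> f) \<star> tau \<rho> \<sigma> = tau \<rho>' \<sigma>' \<star> (f \<boxtimes> g)"
proof -
  have [simp]: "arr f" "arr g" "src f = tgt \<rho>" "tgt f = tgt \<rho>'" "src g = tgt \<sigma>" "tgt g = tgt \<sigma>'"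
    and eq: "f \<star> \<rho> = \<rho>' \<star> F f" "g \<star> \<sigma> = \<sigma>' \<star> F g"
    using f g by (simp_all add: is_module_hom_def)
  have nat: "\<R> (tgt \<rho>') (tgt \<sigma>') \<star> (f \<boxtimes> g) = (F g \<boxtimes> F f) \<star> \<R> (tgt \<rho>) (tgt \<sigma>)"
    by (rule Rt_natural) simp_all
  show ?thesis
    by (simp add: tau_def interchange_extend eq nat)
qed

text \<open>The \<open>\<mu>\<close> in \<open>Rt_ten_right\<close> turns into a second application
  of \<open>\<rho>\<close>, which naturality of \<open>\<R>\<close> moves in front of the second
  braiding; there it completes the first one.\<close>

lemma tau_mten_right:
  assumes [simp]: "is_module \<rho>" "is_module \<sigma>" "is_module \<pi>"
  shows "tau \<rho> (mten \<sigma> \<pi>) = (idt (tgt \<sigma>) \<boxtimes> tau \<rho> \<pi>) \<star> (tau \<rho> \<sigma> \<boxtimes> idt (tgt \<pi>))"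
proof -
  let ?M = "tgt \<rho>" and ?N = "tgt \<sigma>" and ?P = "tgt \<pi>"
  let ?TM = "fobj T ?M" and ?TN = "fobj T ?N" and ?TP = "fobj T ?P"
  have nat: "\<R> ?M ?P \<star> (\<rho> \<boxtimes> idt ?P) = (idt ?TP \<boxtimes> F \<rho>) \<star> \<R> ?TM ?P"
    using Rt_natural [of \<rho> "idt ?P"] by simp
  have "tau \<rho> (mten \<sigma> \<pi>) = ((\<sigma> \<boxtimes> \<pi>) \<boxtimes> \<rho>) \<star> (\<delta> ?N ?P \<boxtimes> idt ?TM) \<star> \<R> ?M (?N \<odot> ?P)"
    by (simp add: tau_def mten_def interchange_extend del: ten_assoc)
  also have "\<dots> = (\<sigma> \<boxtimes> \<pi> \<boxtimes> \<rho>) \<star> (idt ?TN \<boxtimes> idt ?TP \<boxtimes> \<mu> ?M) \<star> (idt ?TN \<boxtimes> \<R> ?TM ?P) \<star> (\<R> ?M ?N \<boxtimes> idt ?P)"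
    by (simp add: Rt_ten_right)
  also have "\<dots> = (\<sigma> \<boxtimes> ((\<pi> \<boxtimes> (\<rho> \<star> F \<rho>)) \<star> \<R> ?TM ?P)) \<star> (\<R> ?M ?N \<boxtimes> idt ?P)"
    by (simp add: merge is_module_assoc del: idt_ten_idt_ten)
  also have "(\<pi> \<boxtimes> (\<rho> \<star> F \<rho>)) \<star> \<R> ?TM ?P = (\<pi> \<boxtimes> \<rho>) \<star> \<R> ?M ?P \<star> (\<rho> \<boxtimes> idt ?P)"
    by (simp add: nat interchange_extend)
  also have "\<sigma> \<boxtimes> \<dots> = (idt ?N \<boxtimes> tau \<rho> \<pi>) \<star> (\<sigma> \<boxtimes> \<rho> \<boxtimes> idt ?P)"
    by (simp add: tau_def interchange)
  also have "(\<dots>) \<star> (\<R> ?M ?N \<boxtimes> idt ?P) = (idt ?N \<boxtimes> tau \<rho> \<pi>) \<star> ((\<sigma> \<boxtimes> \<rho>) \<boxtimes> idt ?P) \<star> (\<R> ?M ?N \<boxtimes> idt ?P)"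
    by simp
  also have "\<dots> = (idt ?N \<boxtimes> tau \<rho> \<pi>) \<star> (tau \<rho> \<sigma> \<boxtimes> idt ?P)"
    by (simp add: tau_def interchange del: ten_assoc)
  finally show ?thesis .
qed

lemma tau_mten_left:
  assumes [simp]: "is_module \<rho>" "is_module \<sigma>" "is_module \<pi>"
  shows "tau (mten \<rho> \<sigma>) \<pi> = (tau \<rho> \<pi> \<boxtimes> idt (tgt \<sigma>)) \<star> (idt (tgt \<rho>) \<boxtimes> tau \<sigma> \<pi>)"
proof -
  let ?M = "tgt \<rho>" and ?N = "tgt \<sigma>" and ?P = "tgt \<pi>"
  let ?TM = "fobj T ?M" and ?TN = "fobj T ?N" and ?TP = "fobj T ?P"
  have nat: "\<R> ?M ?P \<star> (idt ?M \<boxtimes> \<pi>) = (F \<pi> \<boxtimes> idt ?TM) \<star> \<R> ?M ?TP"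
    using Rt_natural [of "idt ?M" \<pi>] by simp
  have "tau (mten \<rho> \<sigma>) \<pi> = (\<pi> \<boxtimes> \<rho> \<boxtimes> \<sigma>) \<star> (idt ?TP \<boxtimes> \<delta> ?M ?N) \<star> \<R> (?M \<odot> ?N) ?P"
    by (simp add: tau_def mten_def interchange_extend)
  also have "\<dots> = ((\<pi> \<boxtimes> \<rho>) \<boxtimes> \<sigma>) \<star> ((\<mu> ?P \<boxtimes> idt ?TM) \<boxtimes> idt ?TN) \<star> (\<R> ?M ?TP \<boxtimes> idt ?TN) \<star> (idt ?M \<boxtimes> \<R> ?N ?P)"
    by (simp add: Rt_ten_left)
  also have "\<dots> = ((((\<pi> \<star> F \<pi>) \<boxtimes> \<rho>) \<star> \<R> ?M ?TP) \<boxtimes> \<sigma>) \<star> (idt ?M \<boxtimes> \<R> ?N ?P)"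
    by (simp add: merge is_module_assoc del: ten_assoc)
  also have "((\<pi> \<star> F \<pi>) \<boxtimes> \<rho>) \<star> \<R> ?M ?TP = (\<pi> \<boxtimes> \<rho>) \<star> \<R> ?M ?P \<star> (idt ?M \<boxtimes> \<pi>)"
    by (simp add: nat interchange_extend)
  also have "(\<dots>) \<boxtimes> \<sigma> = (tau \<rho> \<pi> \<boxtimes> idt ?N) \<star> ((idt ?M \<boxtimes> \<pi>) \<boxtimes> \<sigma>)"
    by (simp add: tau_def interchange del: ten_assoc)
  also have "(\<dots>) \<star> (idt ?M \<boxtimes> \<R> ?N ?P) = (tau \<rho> \<pi> \<boxtimes> idt ?N) \<star> (idt ?M \<boxtimes> \<pi> \<boxtimes> \<sigma>) \<star> (idt ?M \<boxtimes> \<R> ?N ?P)"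
    by simp
  also have "\<dots> = (tau \<rho> \<pi> \<boxtimes> idt ?N) \<star> (idt ?M \<boxtimes> tau \<sigma> \<pi>)"
    by (simp add: tau_def interchange)
  finally show ?thesis .
qed

end

context quasitriangular_hopf_monad
begin

lemma module_braiding_eq:
  "Arr (fst N \<odot> fst N') (module_braiding C R N N') (fst N' \<odot> fst N) = tau (act N) (act N')"
  by (simp add: module_braiding_def tau_def Rt_def cmp_def ten_def split: prod.splits)

lemma module_category_braided: "braided_category TC (module_braiding C R)"
proof (intro braided_category.intro module_category_strict_monoidal braided_category_axioms.intro)
  fix X Y assume XY: "X \<in> Obj TC" "Y \<in> Obj TC"
  then have [simp]: "X \<in> modules C T" "Y \<in> modules C T"
    by simp_all
  note [simp] = tensor_module_in_modules
  obtain g where g: "is_module_hom (mten (act Y) (act X)) (mten (act X) (act Y)) g"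
    and inv: "g \<star> tau (act X) (act Y) = idt (fst X \<odot> fst Y)" "tau (act X) (act Y) \<star> g = idt (fst Y \<odot> fst X)"
    using tau_inverse [of "act X" "act Y"] by auto
  have g_eq: "g = Arr (fst Y \<odot> fst X) (und g) (fst X \<odot> fst Y)"
    using g by (cases g) (simp add: is_module_hom_def)
  have "und g \<in> module_hom C T (tensor_module Y X) (tensor_module X Y)"
    using g g_eq module_hom_iff [of "tensor_module Y X" "tensor_module X Y"]
    unfolding act_tensor_module by simp
  moreover have "module_braiding C R X Y \<in> module_hom C T (tensor_module X Y) (tensor_module Y X)"
    using is_module_hom_tau [of "act X" "act Y"] module_hom_iff [of "tensor_module X Y" "tensor_module Y X"]
    unfolding act_tensor_module by (simp add: module_braiding_eq)
  moreover have "und g \<cdot> module_braiding C R X Y = Id C (fst X \<odot> fst Y)"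
    "module_braiding C R X Y \<cdot> und g = Id C (fst Y \<odot> fst X)"
    using arg_cong [where f = und, OF inv(1)] arg_cong [where f = und, OF inv(2)]
    by (simp_all add: und_cmp und_idt flip: module_braiding_eq)
  ultimately show "module_braiding C R X Y \<in> iso TC (X \<odot>\<^bsub>TC\<^esub> Y) (Y \<odot>\<^bsub>TC\<^esub> X)"
    by (auto simp: iso_def)
next
  fix X Y X' Y' f g
  assume XY: "X \<in> Obj TC" "Y \<in> Obj TC" "X' \<in> Obj TC" "Y' \<in> Obj TC"
    and fg: "f \<in> Hom TC X X'" "g \<in> Hom TC Y Y'"
  let ?f = "Arr (fst X) f (fst X')" and ?g = "Arr (fst Y) g (fst Y')"
  have "(?g \<boxtimes> ?f) \<star> tau (act X) (act Y) = tau (act X') (act Y') \<star> (?f \<boxtimes> ?g)"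
    using XY fg by (intro tau_natural) (simp_all add: module_hom_iff)
  then show "(g \<otimes>\<^bsub>TC\<^esub> f) \<cdot>\<^bsub>TC\<^esub> module_braiding C R X Y = module_braiding C R X' Y' \<cdot>\<^bsub>TC\<^esub> (f \<otimes>\<^bsub>TC\<^esub> g)"
    by (simp add: cmp_def ten_def flip: module_braiding_eq)
next
  fix X Y Z assume XYZ: "X \<in> Obj TC" "Y \<in> Obj TC" "Z \<in> Obj TC"
  have "tau (act X) (act (tensor_module Y Z))
      = (idt (fst Y) \<boxtimes> tau (act X) (act Z)) \<star> (tau (act X) (act Y) \<boxtimes> idt (fst Z))"
    unfolding act_tensor_module using XYZ by (subst tau_mten_right) simp_all
  then show "module_braiding C R X (Y \<odot>\<^bsub>TC\<^esub> Z) = (Id TC Y \<otimes>\<^bsub>TC\<^esub> module_braiding C R X Z)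
      \<cdot>\<^bsub>TC\<^esub> (module_braiding C R X Y \<otimes>\<^bsub>TC\<^esub> Id TC Z)"
    unfolding module_braiding_eq [symmetric] by (simp add: cmp_def ten_def idt_def)
  have "tau (act (tensor_module X Y)) (act Z)
      = (tau (act X) (act Z) \<boxtimes> idt (fst Y)) \<star> (idt (fst X) \<boxtimes> tau (act Y) (act Z))"
    unfolding act_tensor_module using XYZ by (subst tau_mten_left) simp_all
  then show "module_braiding C R (X \<odot>\<^bsub>TC\<^esub> Y) Z = (module_braiding C R X Z \<otimes>\<^bsub>TC\<^esub> Id TC Y)
      \<cdot>\<^bsub>TC\<^esub> (Id TC X \<otimes>\<^bsub>TC\<^esub> module_braiding C R Y Z)"
    unfolding module_braiding_eq [symmetric] by (simp add: cmp_def ten_def idt_def)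
qed

end

section \<open>Twists\<close>

context quasitriangular_bimonad
begin

text \<open>A natural transformation from the identity functor to \<open>T\<close>.\<close>

definition is_family :: "('o \<Rightarrow> ('o, 'm) arrow) \<Rightarrow> bool" where
  "is_family t \<longleftrightarrow> (\<forall>X \<in> Obj C. arr (t X) \<and> src (t X) = X \<and> tgt (t X) = fobj T X)
    \<and> (\<forall>f. arr f \<longrightarrow> F f \<star> t (src f) = t (tgt f) \<star> f)"

definition is_twist :: "('o \<Rightarrow> ('o, 'm) arrow) \<Rightarrow> bool" where
  "is_twist t \<longleftrightarrow> is_family t
    \<and> (\<forall>X \<in> Obj C. \<mu> X \<star> t (fobj T X) = \<mu> X \<star> F (t X))
    \<and> (\<exists>t'. is_family t' \<and> (\<forall>X \<in> Obj C. \<mu> X \<star> t' (fobj T X) \<star> t X = \<eta> X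
        \<and> \<mu> X \<star> t (fobj T X) \<star> t' X = \<eta> X))
    \<and> (\<forall>X \<in> Obj C. \<forall>Y \<in> Obj C. \<delta> X Y \<star> t (X \<odot> Y)
        = ((\<mu> X \<star> t (fobj T X) \<star> \<mu> X) \<boxtimes> (\<mu> Y \<star> t (fobj T Y) \<star> \<mu> Y))
          \<star> \<R> (fobj T Y) (fobj T X) \<star> \<R> X Y)"

text \<open>The notion of twist on the braided category of modules, with a module represented by its
  action.\<close>

definition is_mtwist :: "(('o, 'm) arrow \<Rightarrow> ('o, 'm) arrow) \<Rightarrow> bool" where
  "is_mtwist \<Theta> \<longleftrightarrow> (\<forall>\<rho>. is_module \<rho> \<longrightarrow> is_module_hom \<rho> \<rho> (\<Theta> \<rho>)
      \<and> (\<exists>g. is_module_hom \<rho> \<rho> g \<and> g \<star> \<Theta> \<rho> = idt (tgt \<rho>) \<and> \<Theta> \<rho> \<star> g = idt (tgt \<rho>)))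
    \<and> (\<forall>\<rho> \<sigma> f. is_module \<rho> \<longrightarrow> is_module \<sigma> \<longrightarrow> is_module_hom \<rho> \<sigma> f \<longrightarrow> f \<star> \<Theta> \<rho> = \<Theta> \<sigma> \<star> f)
    \<and> (\<forall>\<rho> \<sigma>. is_module \<rho> \<longrightarrow> is_module \<sigma>
        \<longrightarrow> \<Theta> (mten \<rho> \<sigma>) = (\<Theta> \<rho> \<boxtimes> \<Theta> \<sigma>) \<star> tau \<sigma> \<rho> \<star> tau \<rho> \<sigma>)"

lemma is_familyD:
  assumes "is_family t"
  shows "X \<in> Obj C \<Longrightarrow> arr (t X)"
    and "X \<in> Obj C \<Longrightarrow> src (t X) = X"
    and "X \<in> Obj C \<Longrightarrow> tgt (t X) = fobj T X"
    and "\<lbrakk>arr f; src f = X; tgt f = Y\<rbrakk> \<Longrightarrow> F f \<star> t X = t Y \<star> f"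
  using assms unfolding is_family_def by auto

section \<open>Actions as linear maps from free modules, and the action of a natural family\<close>

lemma is_module_hom_free: "\<lbrakk>arr f; src f = X; tgt f = Y\<rbrakk> \<Longrightarrow> is_module_hom (\<mu> X) (\<mu> Y) (F f)"
  using mul_natural [of f] by (auto simp: is_module_hom_def)

lemma is_module_hom_act: "is_module \<rho> \<Longrightarrow> is_module_hom (\<mu> (tgt \<rho>)) \<rho> \<rho>"
  by (simp add: is_module_hom_def is_module_assoc)

text \<open>Naturality of \<open>t\<close> at the arrow \<open>\<rho>\<close> itself, after
  rewriting \<open>\<rho> \<star> \<mu>\<close> as \<open>\<rho> \<star> F \<rho>\<close>. It trades
  the composites \<open>\<mu> \<star> t\<close> of the star-product for iterated actions on the
  module.\<close>

lemma family_act: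
  assumes t: "is_family t" and [simp]: "is_module \<rho>"
  shows "\<rho> \<star> \<mu> (tgt \<rho>) \<star> t (fobj T (tgt \<rho>)) = \<rho> \<star> t (tgt \<rho>) \<star> \<rho>"
proof -
  note [simp] = is_familyD(1-3) [OF t]
  have "\<rho> \<star> \<mu> (tgt \<rho>) \<star> t (fobj T (tgt \<rho>)) = (\<rho> \<star> \<mu> (tgt \<rho>)) \<star> t (fobj T (tgt \<rho>))"
    by simp
  also have "\<dots> = \<rho> \<star> F \<rho> \<star> t (fobj T (tgt \<rho>))"
    by (simp flip: is_module_assoc)
  also have "F \<rho> \<star> t (fobj T (tgt \<rho>)) = t (tgt \<rho>) \<star> \<rho>"
    by (rule is_familyD(4) [OF t]) simp_all
  finally show ?thesis .
qed

text \<open>Each axiom has its own counterpart: centrality gives linearity, the star-inverse gives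
  invertibility, and the tensor axiom for \<open>t\<close> gives the one for the action.\<close>

lemma is_mtwist_act:
  assumes "is_twist t"
  shows "is_mtwist (\<lambda>\<rho>. \<rho> \<star> t (tgt \<rho>))"
proof -
  have t: "is_family t" and central: "\<And>X. X \<in> Obj C \<Longrightarrow> \<mu> X \<star> t (fobj T X) = \<mu> X \<star> F (t X)"
    and tens: "\<And>X Y. \<lbrakk>X \<in> Obj C; Y \<in> Obj C\<rbrakk> \<Longrightarrow> \<delta> X Y \<star> t (X \<odot> Y)
        = ((\<mu> X \<star> t (fobj T X) \<star> \<mu> X) \<boxtimes> (\<mu> Y \<star> t (fobj T Y) \<star> \<mu> Y))
          \<star> \<R> (fobj T Y) (fobj T X) \<star> \<R> X Y"
    using assms by (simp_all add: is_twist_def)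
  obtain t' where t': "is_family t'"
    and inv: "\<And>X. X \<in> Obj C \<Longrightarrow> \<mu> X \<star> t' (fobj T X) \<star> t X = \<eta> X"
      "\<And>X. X \<in> Obj C \<Longrightarrow> \<mu> X \<star> t (fobj T X) \<star> t' X = \<eta> X"
    using assms unfolding is_twist_def by blast
  note [simp] = is_familyD(1-3) [OF t] is_familyD(1-3) [OF t']
  have hom: "is_module_hom \<rho> \<rho> (\<rho> \<star> t (tgt \<rho>))" if [simp]: "is_module \<rho>" for \<rho>
  proof -
    have "(\<rho> \<star> t (tgt \<rho>)) \<star> \<rho> = \<rho> \<star> \<mu> (tgt \<rho>) \<star> F (t (tgt \<rho>))"
      by (simp add: central flip: family_act [OF t])
    also have "\<dots> = \<rho> \<star> F (\<rho> \<star> t (tgt \<rho>))"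
      using cmp_extend' [OF is_module_assoc, of \<rho> "F (t (tgt \<rho>))"] by (simp add: F_cmp)
    finally show ?thesis
      by (simp add: is_module_hom_def)
  qed
  have inverse: "\<exists>g. is_module_hom \<rho> \<rho> g \<and> g \<star> \<rho> \<star> t (tgt \<rho>) = idt (tgt \<rho>)
      \<and> (\<rho> \<star> t (tgt \<rho>)) \<star> g = idt (tgt \<rho>)" if [simp]: "is_module \<rho>" for \<rho>
  proof -
    let ?M = "tgt \<rho>"
    let ?g = "\<rho> \<star> t' ?M"
    have "?g \<star> \<rho> \<star> t ?M = (\<rho> \<star> t' ?M \<star> \<rho>) \<star> t ?M"
      by simp
    also have "\<dots> = \<rho> \<star> \<mu> ?M \<star> t' (fobj T ?M) \<star> t ?M"
      by (subst family_act [OF t', symmetric]) simp_all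
    finally have 1: "?g \<star> \<rho> \<star> t ?M = idt ?M"
      by (simp add: inv is_module_unit)
    have "(\<rho> \<star> t ?M) \<star> ?g = (\<rho> \<star> t ?M \<star> \<rho>) \<star> t' ?M"
      by simp
    also have "\<dots> = \<rho> \<star> \<mu> ?M \<star> t (fobj T ?M) \<star> t' ?M"
      by (subst family_act [OF t, symmetric]) simp_all
    finally have 2: "(\<rho> \<star> t ?M) \<star> ?g = idt ?M"
      by (simp add: inv is_module_unit)
    \<comment> \<open>\<open>t'\<close> is not known to be central, so linearity is obtained from
      that of the map being inverted.\<close>
    have "is_module_hom \<rho> \<rho> ?g"
      by (rule is_module_hom_inverse [OF _ _ hom]) (use 1 2 in simp_all)
    with 1 2 show ?thesis
      by blast
  qed
  have natural: "f \<star> \<rho> \<star> t (tgt \<rho>) = (\<sigma> \<star> t (tgt \<sigma>)) \<star> f"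
    if [simp]: "is_module \<rho>" "is_module \<sigma>" and f: "is_module_hom \<rho> \<sigma> f" for \<rho> \<sigma> f
  proof -
    have [simp]: "arr f" "src f = tgt \<rho>" "tgt f = tgt \<sigma>" and eq: "f \<star> \<rho> = \<sigma> \<star> F f"
      using f by (simp_all add: is_module_hom_def)
    have "f \<star> \<rho> \<star> t (tgt \<rho>) = \<sigma> \<star> F f \<star> t (tgt \<rho>)"
      by (intro cmp_extend') (simp_all add: eq)
    also have "F f \<star> t (tgt \<rho>) = t (tgt \<sigma>) \<star> f"
      by (rule is_familyD(4) [OF t]) simp_all
    finally show ?thesis
      by simp
  qed
  have tensor: "mten \<rho> \<sigma> \<star> t (tgt (mten \<rho> \<sigma>))
      = ((\<rho> \<star> t (tgt \<rho>)) \<boxtimes> (\<sigma> \<star> t (tgt \<sigma>))) \<star> tau \<sigma> \<rho> \<star> tau \<rho> \<sigma>"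
    if [simp]: "is_module \<rho>" "is_module \<sigma>" for \<rho> \<sigma>
  proof -
    let ?M = "tgt \<rho>" and ?N = "tgt \<sigma>"
    let ?TM = "fobj T ?M" and ?TN = "fobj T ?N"
    \<comment> \<open>Brings the pattern \<open>\<mu> \<star> t \<star> \<mu>\<close> of the tensor
      axiom into a form whose last factor \<open>F \<pi>\<close> can pass the R-matrix and become
      the action inside the inner braiding.\<close>
    have slide_act: "\<pi> \<star> \<mu> (tgt \<pi>) \<star> t (fobj T (tgt \<pi>)) \<star> \<mu> (tgt \<pi>) = (\<pi> \<star> t (tgt \<pi>)) \<star> \<pi> \<star> F \<pi>"
      if [simp]: "is_module \<pi>" for \<pi>
    proof -
      have "\<pi> \<star> \<mu> (tgt \<pi>) \<star> t (fobj T (tgt \<pi>)) \<star> \<mu> (tgt \<pi>)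
          = (\<pi> \<star> \<mu> (tgt \<pi>) \<star> t (fobj T (tgt \<pi>))) \<star> \<mu> (tgt \<pi>)"
        by simp
      then show ?thesis
        by (simp add: family_act [OF t] is_module_assoc)
    qed
    have nat: "\<R> ?N ?M \<star> (\<sigma> \<boxtimes> \<rho>) = (F \<rho> \<boxtimes> F \<sigma>) \<star> \<R> ?TN ?TM"
      by (rule Rt_natural) simp_all
    have "mten \<rho> \<sigma> \<star> t (tgt (mten \<rho> \<sigma>)) = ((\<rho> \<star> \<mu> ?M \<star> t ?TM \<star> \<mu> ?M) \<boxtimes> (\<sigma> \<star> \<mu> ?N \<star> t ?TN \<star> \<mu> ?N))
        \<star> \<R> ?TN ?TM \<star> \<R> ?M ?N"
      by (simp add: mten_def tens interchange_extend)
    also have "\<dots> = ((\<rho> \<star> t ?M) \<boxtimes> (\<sigma> \<star> t ?N)) \<star> (\<rho> \<boxtimes> \<sigma>) \<star> ((F \<rho> \<boxtimes> F \<sigma>) \<star> \<R> ?TN ?TM) \<star> \<R> ?M ?N"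
      by (simp add: slide_act interchange_extend)
    also have "\<dots> = ((\<rho> \<star> t ?M) \<boxtimes> (\<sigma> \<star> t ?N)) \<star> tau \<sigma> \<rho> \<star> tau \<rho> \<sigma>"
      unfolding nat [symmetric] by (simp add: tau_def)
    finally show ?thesis .
  qed
  show ?thesis
    using hom inverse natural tensor unfolding is_mtwist_def by blast
qed

text \<open>Naturality of \<open>t\<close> at \<open>\<eta> X\<close> together with
  \<open>\<mu> \<star> F \<eta> = idt\<close>: the recovery formula, responsible for injectivity of
  the correspondence.\<close>

lemma twist_eq_free:
  assumes t: "is_family t" and [simp]: "X \<in> Obj C"
  shows "(\<mu> X \<star> t (fobj T X)) \<star> \<eta> X = t X"
proof -
  note [simp] = is_familyD(1-3) [OF t]
  have "F (\<eta> X) \<star> t X = t (fobj T X) \<star> \<eta> X"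
    by (rule is_familyD(4) [OF t]) simp_all
  then have "(\<mu> X \<star> t (fobj T X)) \<star> \<eta> X = (\<mu> X \<star> F (\<eta> X)) \<star> t X"
    by simp
  then show ?thesis
    by (simp add: mul_F_unit)
qed

section \<open>From twists on modules back to twists for the monad\<close>

context
  fixes \<Theta>
  assumes \<Theta>: "is_mtwist \<Theta>"
begin

private lemma Theta_arr [simp]:
  assumes "is_module \<rho>"
  shows "arr (\<Theta> \<rho>)" "src (\<Theta> \<rho>) = tgt \<rho>" "tgt (\<Theta> \<rho>) = tgt \<rho>"
  using \<Theta> assms unfolding is_mtwist_def is_module_hom_def by blast+

private lemma Theta_hom: "is_module \<rho> \<Longrightarrow> \<Theta> \<rho> \<star> \<rho> = \<rho> \<star> F (\<Theta> \<rho>)"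
  using \<Theta> unfolding is_mtwist_def is_module_hom_def by blast

private lemma Theta_natural:
  "\<lbrakk>is_module_hom \<rho> \<sigma> f; is_module \<rho>; is_module \<sigma>\<rbrakk> \<Longrightarrow> f \<star> \<Theta> \<rho> = \<Theta> \<sigma> \<star> f"
  using \<Theta> unfolding is_mtwist_def by blast

text \<open>Naturality of \<open>\<Theta>\<close> at the linear map \<open>\<rho>\<close> from the
  free module, followed by the unit law. Responsible for surjectivity of the correspondence.\<close>

lemma mtwist_eq_act:
  assumes [simp]: "is_module \<rho>"
  shows "\<rho> \<star> \<Theta> (\<mu> (tgt \<rho>)) \<star> \<eta> (tgt \<rho>) = \<Theta> \<rho>"
proof -
  have "\<rho> \<star> \<Theta> (\<mu> (tgt \<rho>)) \<star> \<eta> (tgt \<rho>) = \<Theta> \<rho> \<star> \<rho> \<star> \<eta> (tgt \<rho>)"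
    by (intro cmp_extend' Theta_natural is_module_hom_act) simp_all
  then show ?thesis
    by (simp add: is_module_unit)
qed

lemma is_twist_free: "is_twist (\<lambda>X. \<Theta> (\<mu> X) \<star> \<eta> X)"
proof -
  \<comment> \<open>The pointwise inverses are collected into one function \<open>\<Xi>\<close>,
    whose values on free modules will supply the star-inverse.\<close>
  have "\<forall>\<rho>. \<exists>g. is_module \<rho> \<longrightarrow> is_module_hom \<rho> \<rho> g \<and> g \<star> \<Theta> \<rho> = idt (tgt \<rho>) \<and> \<Theta> \<rho> \<star> g = idt (tgt \<rho>)"
    using \<Theta> unfolding is_mtwist_def by blast
  then obtain \<Xi> where \<Xi>: "\<And>\<rho>. is_module \<rho> \<Longrightarrow> is_module_hom \<rho> \<rho> (\<Xi> \<rho>)"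
    and inv: "\<And>\<rho>. is_module \<rho> \<Longrightarrow> \<Xi> \<rho> \<star> \<Theta> \<rho> = idt (tgt \<rho>)" "\<And>\<rho>. is_module \<rho> \<Longrightarrow> \<Theta> \<rho> \<star> \<Xi> \<rho> = idt (tgt \<rho>)"
    unfolding choice_iff by blast
  have [simp]: "arr (\<Xi> \<rho>)" "src (\<Xi> \<rho>) = tgt \<rho>" "tgt (\<Xi> \<rho>) = tgt \<rho>" if "is_module \<rho>" for \<rho>
    using \<Xi> [OF that] by (simp_all add: is_module_hom_def)
  have Xi_natural: "f \<star> \<Xi> \<rho> = \<Xi> \<sigma> \<star> f"
    if f: "is_module_hom \<rho> \<sigma> f" and [simp]: "is_module \<rho>" "is_module \<sigma>" for \<rho> \<sigma> f
  proof -
    have [simp]: "arr f" "src f = tgt \<rho>" "tgt f = tgt \<sigma>"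
      using f by (simp_all add: is_module_hom_def)
    have "f \<star> \<Xi> \<rho> = (\<Xi> \<sigma> \<star> \<Theta> \<sigma>) \<star> f \<star> \<Xi> \<rho>"
      by (simp add: inv)
    also have "\<dots> = \<Xi> \<sigma> \<star> (f \<star> \<Theta> \<rho>) \<star> \<Xi> \<rho>"
      by (simp add: Theta_natural [OF f])
    also have "\<dots> = \<Xi> \<sigma> \<star> f"
      by (simp add: inv)
    finally show ?thesis .
  qed
  \<comment> \<open>This and the next fact are stated for an arbitrary \<open>\<Phi>\<close>, as
    both \<open>\<Theta>\<close> and its inverse \<open>\<Xi>\<close> are to be substituted.\<close>
  have family: "is_family (\<lambda>X. \<Phi> (\<mu> X) \<star> \<eta> X)"
    if [simp]: "\<And>\<rho>. is_module \<rho> \<Longrightarrow> arr (\<Phi> \<rho>)" "\<And>\<rho>. is_module \<rho> \<Longrightarrow> src (\<Phi> \<rho>) = tgt \<rho>"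
      "\<And>\<rho>. is_module \<rho> \<Longrightarrow> tgt (\<Phi> \<rho>) = tgt \<rho>"
      and nat: "\<And>\<rho> \<sigma> f. \<lbrakk>is_module_hom \<rho> \<sigma> f; is_module \<rho>; is_module \<sigma>\<rbrakk> \<Longrightarrow> f \<star> \<Phi> \<rho> = \<Phi> \<sigma> \<star> f"
    for \<Phi>
  proof -
    have "F f \<star> \<Phi> (\<mu> (src f)) \<star> \<eta> (src f) = (\<Phi> (\<mu> (tgt f)) \<star> \<eta> (tgt f)) \<star> f" if [simp]: "arr f" for f
    proof -
      have "F f \<star> \<Phi> (\<mu> (src f)) \<star> \<eta> (src f) = \<Phi> (\<mu> (tgt f)) \<star> F f \<star> \<eta> (src f)"
        by (intro cmp_extend' nat is_module_hom_free) simp_all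
      then show ?thesis
        by (simp add: unit_natural)
    qed
    then show ?thesis
      by (simp add: is_family_def)
  qed
  \<comment> \<open>The instance of \<open>mtwist_eq_act\<close> at a free module, but for
    \<open>\<Phi>\<close>: the family built from \<open>\<Phi>\<close> acts on
    \<open>\<mu> X\<close> as \<open>\<Phi>\<close> does.\<close>
  have free: "\<mu> X \<star> \<Phi> (\<mu> (fobj T X)) \<star> \<eta> (fobj T X) = \<Phi> (\<mu> X)"
    if [simp]: "\<And>\<rho>. is_module \<rho> \<Longrightarrow> arr (\<Phi> \<rho>)" "\<And>\<rho>. is_module \<rho> \<Longrightarrow> src (\<Phi> \<rho>) = tgt \<rho>"
      "\<And>\<rho>. is_module \<rho> \<Longrightarrow> tgt (\<Phi> \<rho>) = tgt \<rho>"
      and nat: "\<And>\<rho> \<sigma> f. \<lbrakk>is_module_hom \<rho> \<sigma> f; is_module \<rho>; is_module \<sigma>\<rbrakk> \<Longrightarrow> f \<star> \<Phi> \<rho> = \<Phi> \<sigma> \<star> f"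
      and [simp]: "X \<in> Obj C"
    for \<Phi> X
  proof -
    have "\<mu> X \<star> \<Phi> (\<mu> (fobj T X)) \<star> \<eta> (fobj T X) = \<Phi> (\<mu> X) \<star> \<mu> X \<star> \<eta> (fobj T X)"
      using is_module_hom_act [of "\<mu> X"] by (intro cmp_extend' nat) simp_all
    then show ?thesis
      by (simp add: mul_unit)
  qed
  note free_Theta = free [of \<Theta>, OF Theta_arr Theta_natural] and free_Xi = free [of \<Xi>, OF _ _ _ Xi_natural]
  have central: "\<mu> X \<star> \<Theta> (\<mu> (fobj T X)) \<star> \<eta> (fobj T X) = \<mu> X \<star> F (\<Theta> (\<mu> X) \<star> \<eta> X)"
    if [simp]: "X \<in> Obj C" for X
  proof -
    have "\<mu> X \<star> F (\<Theta> (\<mu> X) \<star> \<eta> X) = (\<mu> X \<star> F (\<Theta> (\<mu> X))) \<star> F (\<eta> X)"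
      by (simp add: F_cmp)
    also have "\<dots> = \<Theta> (\<mu> X) \<star> \<mu> X \<star> F (\<eta> X)"
      by (simp flip: Theta_hom)
    also have "\<dots> = \<Theta> (\<mu> X)"
      by (simp add: mul_F_unit)
    finally show ?thesis
      by (simp add: free_Theta)
  qed
  \<comment> \<open>One-sided on purpose: taking the pair in either order gives the two star-inverse
    equations.\<close>
  have inverse: "\<mu> X \<star> (\<Phi> (\<mu> (fobj T X)) \<star> \<eta> (fobj T X)) \<star> \<Psi> (\<mu> X) \<star> \<eta> X = \<eta> X"
    if "\<mu> X \<star> \<Phi> (\<mu> (fobj T X)) \<star> \<eta> (fobj T X) = \<Phi> (\<mu> X)" "\<Phi> (\<mu> X) \<star> \<Psi> (\<mu> X) = idt (fobj T X)"
      and [simp]: "X \<in> Obj C" "\<And>\<rho>. is_module \<rho> \<Longrightarrow> arr (\<Phi> \<rho>)" "\<And>\<rho>. is_module \<rho> \<Longrightarrow> src (\<Phi> \<rho>) = tgt \<rho>"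
      "\<And>\<rho>. is_module \<rho> \<Longrightarrow> tgt (\<Phi> \<rho>) = tgt \<rho>" "\<And>\<rho>. is_module \<rho> \<Longrightarrow> arr (\<Psi> \<rho>)"
      "\<And>\<rho>. is_module \<rho> \<Longrightarrow> src (\<Psi> \<rho>) = tgt \<rho>" "\<And>\<rho>. is_module \<rho> \<Longrightarrow> tgt (\<Psi> \<rho>) = tgt \<rho>"
    for X \<Phi> \<Psi>
  proof -
    have "\<mu> X \<star> (\<Phi> (\<mu> (fobj T X)) \<star> \<eta> (fobj T X)) \<star> \<Psi> (\<mu> X) \<star> \<eta> X
        = (\<mu> X \<star> \<Phi> (\<mu> (fobj T X)) \<star> \<eta> (fobj T X)) \<star> \<Psi> (\<mu> X) \<star> \<eta> X"
      by simp
    also have "\<dots> = (\<Phi> (\<mu> X) \<star> \<Psi> (\<mu> X)) \<star> \<eta> X"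
      unfolding that(1) by simp
    finally show ?thesis
      unfolding that(2) by simp
  qed
  have tensor: "\<delta> X Y \<star> \<Theta> (\<mu> (X \<odot> Y)) \<star> \<eta> (X \<odot> Y)
      = ((\<mu> X \<star> (\<Theta> (\<mu> (fobj T X)) \<star> \<eta> (fobj T X)) \<star> \<mu> X)
          \<boxtimes> (\<mu> Y \<star> (\<Theta> (\<mu> (fobj T Y)) \<star> \<eta> (fobj T Y)) \<star> \<mu> Y))
        \<star> \<R> (fobj T Y) (fobj T X) \<star> \<R> X Y"
    if [simp]: "X \<in> Obj C" "Y \<in> Obj C" for X Y
  proof -
    have act: "\<mu> Z \<star> (\<Theta> (\<mu> (fobj T Z)) \<star> \<eta> (fobj T Z)) \<star> \<mu> Z = \<Theta> (\<mu> Z) \<star> \<mu> Z" if [simp]: "Z \<in> Obj C" for Z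
      using arg_cong [OF free_Theta [of Z], of "\<lambda>f. f \<star> \<mu> Z"] by simp
    have nat: "\<R> (fobj T X) (fobj T Y) \<star> (\<eta> X \<boxtimes> \<eta> Y) = (F (\<eta> Y) \<boxtimes> F (\<eta> X)) \<star> \<R> X Y"
      by (rule Rt_natural) simp_all
    \<comment> \<open>Linearity of \<open>\<delta>\<close> moves \<open>\<Theta>\<close> from the
      free module on \<open>X \<odot> Y\<close> to a tensor product of free modules, where the
      tensor axiom of \<open>\<Theta>\<close> applies.\<close>
    have "\<delta> X Y \<star> \<Theta> (\<mu> (X \<odot> Y)) \<star> \<eta> (X \<odot> Y) = \<Theta> (mten (\<mu> X) (\<mu> Y)) \<star> \<delta> X Y \<star> \<eta> (X \<odot> Y)"
      by (intro cmp_extend' Theta_natural is_module_hom_comul) simp_all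
    also have "\<Theta> (mten (\<mu> X) (\<mu> Y)) = (\<Theta> (\<mu> X) \<boxtimes> \<Theta> (\<mu> Y)) \<star> tau (\<mu> Y) (\<mu> X) \<star> tau (\<mu> X) (\<mu> Y)"
      using \<Theta> unfolding is_mtwist_def by simp
    also have "(\<dots>) \<star> \<delta> X Y \<star> \<eta> (X \<odot> Y) = (\<Theta> (\<mu> X) \<boxtimes> \<Theta> (\<mu> Y)) \<star> tau (\<mu> Y) (\<mu> X) \<star> tau (\<mu> X) (\<mu> Y) \<star> (\<eta> X \<boxtimes> \<eta> Y)"
      by (simp add: comul_unit)
    \<comment> \<open>The R-matrix is the braiding of free modules restricted to generators. The
      other braiding is not met by units and keeps its \<open>\<mu>\<close> factors.\<close>
    also have "tau (\<mu> X) (\<mu> Y) \<star> (\<eta> X \<boxtimes> \<eta> Y) = \<R> X Y"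
      by (simp add: tau_def nat interchange_extend mul_F_unit)
    also have "(\<Theta> (\<mu> X) \<boxtimes> \<Theta> (\<mu> Y)) \<star> tau (\<mu> Y) (\<mu> X) \<star> \<R> X Y
        = ((\<Theta> (\<mu> X) \<star> \<mu> X) \<boxtimes> (\<Theta> (\<mu> Y) \<star> \<mu> Y)) \<star> \<R> (fobj T Y) (fobj T X) \<star> \<R> X Y"
      by (simp add: tau_def interchange_extend)
    finally show ?thesis
      by (simp only: act that)
  qed
  show ?thesis
    unfolding is_twist_def
    using family [of \<Theta>, OF Theta_arr Theta_natural] central tensor
      family [of \<Xi>, OF _ _ _ Xi_natural] free_Theta free_Xi inv
    by (intro conjI exI [of _ "\<lambda>X. \<Xi> (\<mu> X) \<star> \<eta> X"] ballI inverse) simp_all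
qed

end

end

section \<open>Translation between arrow families and the given locales\<close>

context quasitriangular_bimonad
begin

abbreviation typed :: "('o \<Rightarrow> 'm) \<Rightarrow> 'o \<Rightarrow> ('o, 'm) arrow" where
  "typed \<theta> \<equiv> (\<lambda>X. Arr X (\<theta> X) (fobj T X))"

lemma is_family_typed:
  "is_family (typed \<theta>) \<longleftrightarrow> (\<forall>X \<in> Obj C. \<theta> X \<in> Hom C X (fobj T X))
    \<and> (\<forall>X \<in> Obj C. \<forall>Y \<in> Obj C. \<forall>f \<in> Hom C X Y. farr T f \<cdot> \<theta> X = \<theta> Y \<cdot> f)"
proof -
  have "(\<forall>f. arr f \<longrightarrow> F f \<star> typed \<theta> (src f) = typed \<theta> (tgt f) \<star> f)
      \<longleftrightarrow> (\<forall>X \<in> Obj C. \<forall>Y \<in> Obj C. \<forall>f \<in> Hom C X Y. farr T f \<cdot> \<theta> X = \<theta> Y \<cdot> f)"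
    (is "?L \<longleftrightarrow> ?R")
  proof
    show ?R if ?L
    proof (intro ballI)
      fix X Y f assume "X \<in> Obj C" "Y \<in> Obj C" "f \<in> Hom C X Y"
      then show "farr T f \<cdot> \<theta> X = \<theta> Y \<cdot> f"
        using \<open>?L\<close> [rule_format, of "Arr X f Y"] by (simp add: cmp_def F_def)
    qed
    show ?L if ?R
      using that by (auto simp: cmp_def F_def)
  qed
  then show ?thesis
    by (simp add: is_family_def)
qed

text \<open>Values outside \<open>Obj C\<close> are irrelevant; this allows an extensional family to
  replace one that agrees with it on objects only.\<close>

lemma is_twist_cong:
  assumes "\<And>X. X \<in> Obj C \<Longrightarrow> t X = u X"
  shows "is_twist t \<longleftrightarrow> is_twist u"
  using assms by (simp add: is_twist_def is_family_def)

lemma bimonad_twist_iff: "bimonad_twist C T R \<theta> \<longleftrightarrow> is_twist (typed \<theta>)"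
proof -
  let ?inv = "\<lambda>t. \<forall>X \<in> Obj C. \<mu> X \<star> t (fobj T X) \<star> typed \<theta> X = \<eta> X \<and> \<mu> X \<star> typed \<theta> (fobj T X) \<star> t X = \<eta> X"
  \<comment> \<open>A star-inverse given as an arbitrary arrow-valued family agrees on objects with
    the \<open>typed\<close> version of its underlying morphisms, so the existential may range over
    either kind.\<close>
  have und: "is_family (typed (\<lambda>X. und (t X))) \<and> ?inv (typed (\<lambda>X. und (t X)))" if t: "is_family t" "?inv t" for t
  proof -
    have "typed (\<lambda>X. und (t X)) X = t X" if "X \<in> Obj C" for X
      using is_familyD [OF t(1)] that by (intro arrow.expand) simp
    then show ?thesis
      using t by (simp add: is_family_def)
  qed
  have "(\<exists>t. is_family t \<and> ?inv t) \<longleftrightarrow> (\<exists>\<theta>'. is_family (typed \<theta>') \<and> ?inv (typed \<theta>'))"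
  proof (intro iffI; elim exE conjE)
    fix t assume "is_family t" "?inv t"
    then show "\<exists>\<theta>'. is_family (typed \<theta>') \<and> ?inv (typed \<theta>')"
      by (intro exI [of _ "\<lambda>X. und (t X)"] und)
  next
    fix \<theta>' assume "is_family (typed \<theta>')" "?inv (typed \<theta>')"
    then show "\<exists>t. is_family t \<and> ?inv t"
      by (intro exI [of _ "typed \<theta>'"] conjI)
  qed
  then have "is_twist (typed \<theta>) \<longleftrightarrow> is_family (typed \<theta>)
    \<and> (\<forall>X \<in> Obj C. mu T X \<cdot> \<theta> (fobj T X) = mu T X \<cdot> farr T (\<theta> X))
    \<and> (\<exists>\<theta>'. is_family (typed \<theta>') \<and> (\<forall>X \<in> Obj C. mu T X \<cdot> \<theta>' (fobj T X) \<cdot> \<theta> X = eta T X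
            \<and> mu T X \<cdot> \<theta> (fobj T X) \<cdot> \<theta>' X = eta T X))
    \<and> (\<forall>X \<in> Obj C. \<forall>Y \<in> Obj C. T2 T X Y \<cdot> \<theta> (X \<odot> Y)
          = ((mu T X \<cdot> \<theta> (fobj T X) \<cdot> mu T X) \<otimes> (mu T Y \<cdot> \<theta> (fobj T Y) \<cdot> mu T Y))
            \<cdot> R (fobj T Y) (fobj T X) \<cdot> R X Y)"
    unfolding is_twist_def by (simp add: cmp_def ten_def F_def mul_def unit_def comul_def Rt_def)
  then show ?thesis
    unfolding bimonad_twist_def bimonad_twist_axioms_def is_family_typed
    using quasitriangular_bimonad_axioms by blast
qed

end

context quasitriangular_hopf_monad
begin

abbreviation mtyped :: "('o \<times> 'm \<Rightarrow> 'm) \<Rightarrow> ('o, 'm) arrow \<Rightarrow> ('o, 'm) arrow" where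
  "mtyped \<Theta> \<equiv> (\<lambda>\<rho>. Arr (tgt \<rho>) (\<Theta> (tgt \<rho>, und \<rho>)) (tgt \<rho>))"

lemma module_cases:
  assumes "is_module \<rho>"
  obtains N where "N \<in> modules C T" "\<rho> = act N"
proof (rule that)
  show eq: "\<rho> = act (tgt \<rho>, und \<rho>)"
    using assms by (intro arrow.expand) simp
  show "(tgt \<rho>, und \<rho>) \<in> modules C T"
    unfolding modules_iff eq [symmetric] by (rule assms)
qed

lemma module_hom_cases:
  assumes "is_module_hom (act N) (act N') f" "N \<in> modules C T" "N' \<in> modules C T"
  obtains g where "g \<in> module_hom C T N N'" "f = Arr (fst N) g (fst N')"
proof (rule that)
  show eq: "f = Arr (fst N) (und f) (fst N')"
    using assms by (intro arrow.expand) (simp add: is_module_hom_def)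
  show "und f \<in> module_hom C T N N'"
    using assms eq by (simp add: module_hom_iff)
qed

lemma is_mtwist_cong:
  assumes "\<And>\<rho>. is_module \<rho> \<Longrightarrow> \<Theta> \<rho> = \<Theta>' \<rho>"
  shows "is_mtwist \<Theta> \<longleftrightarrow> is_mtwist \<Theta>'"
  using assms by (simp add: is_mtwist_def)

text \<open>Transport along the bijection \<open>act\<close> between pairs and actions;
  \<open>module_cases\<close> and \<open>module_hom_cases\<close> provide its surjectivity on
  objects and morphisms.\<close>

lemma braided_twist_iff: "braided_twist TC (module_braiding C R) \<Theta> \<longleftrightarrow> is_mtwist (mtyped \<Theta>)"
proof
  assume "braided_twist TC (module_braiding C R) \<Theta>"
  then interpret bt: braided_twist TC "module_braiding C R" \<Theta> .
  have iso: "is_module_hom \<rho> \<rho> (mtyped \<Theta> \<rho>)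
      \<and> (\<exists>g. is_module_hom \<rho> \<rho> g \<and> g \<star> mtyped \<Theta> \<rho> = idt (tgt \<rho>) \<and> mtyped \<Theta> \<rho> \<star> g = idt (tgt \<rho>))"
    if \<rho>: "is_module \<rho>" for \<rho>
  proof -
    obtain N where N: "N \<in> modules C T" and \<rho>: "\<rho> = act N"
      using \<rho> by (rule module_cases)
    obtain g where "\<Theta> N \<in> module_hom C T N N" "g \<in> module_hom C T N N"
      "g \<cdot> \<Theta> N = Id C (fst N)" "\<Theta> N \<cdot> g = Id C (fst N)"
      using bt.twist_iso [of N] N by (auto simp: iso_def)
    then show ?thesis
      using N by (auto simp: \<rho> module_hom_iff cmp_def idt_def
        intro!: exI [of _ "Arr (fst N) g (fst N)"])
  qed
  have natural: "f \<star> mtyped \<Theta> \<rho> = mtyped \<Theta> \<sigma> \<star> f"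
    if \<rho>: "is_module \<rho>" and \<sigma>: "is_module \<sigma>" and f: "is_module_hom \<rho> \<sigma> f" for \<rho> \<sigma> f
  proof -
    obtain N where N: "N \<in> modules C T" "\<rho> = act N"
      using \<rho> by (rule module_cases)
    obtain N' where N': "N' \<in> modules C T" "\<sigma> = act N'"
      using \<sigma> by (rule module_cases)
    note N = N(1) N'(1) and eq = N(2) N'(2)
    obtain g where "g \<in> module_hom C T N N'" and g: "f = Arr (fst N) g (fst N')"
      using f N unfolding eq by (rule module_hom_cases)
    then show ?thesis
      using bt.twist_natural [of N N' g] N by (simp add: eq g cmp_def)
  qed
  have tensor: "mtyped \<Theta> (mten \<rho> \<sigma>) = (mtyped \<Theta> \<rho> \<boxtimes> mtyped \<Theta> \<sigma>) \<star> tau \<sigma> \<rho> \<star> tau \<rho> \<sigma>"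
    if \<rho>: "is_module \<rho>" and \<sigma>: "is_module \<sigma>" for \<rho> \<sigma>
  proof -
    obtain N where N: "N \<in> modules C T" "\<rho> = act N"
      using \<rho> by (rule module_cases)
    obtain N' where N': "N' \<in> modules C T" "\<sigma> = act N'"
      using \<sigma> by (rule module_cases)
    note N = N(1) N'(1) and eq = N(2) N'(2)
    show ?thesis
      unfolding eq act_tensor_module [symmetric] module_braiding_eq [symmetric]
      using bt.twist_tensor [of N N'] N by (simp add: cmp_def ten_def)
  qed
  show "is_mtwist (mtyped \<Theta>)"
    unfolding is_mtwist_def using iso natural tensor by blast
next
  assume "is_mtwist (mtyped \<Theta>)"
  then have iso: "\<And>\<rho>. is_module \<rho> \<Longrightarrow> is_module_hom \<rho> \<rho> (mtyped \<Theta> \<rho>)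
      \<and> (\<exists>g. is_module_hom \<rho> \<rho> g \<and> g \<star> mtyped \<Theta> \<rho> = idt (tgt \<rho>) \<and> mtyped \<Theta> \<rho> \<star> g = idt (tgt \<rho>))"
    and natural: "\<And>\<rho> \<sigma> f. \<lbrakk>is_module \<rho>; is_module \<sigma>; is_module_hom \<rho> \<sigma> f\<rbrakk>
      \<Longrightarrow> f \<star> mtyped \<Theta> \<rho> = mtyped \<Theta> \<sigma> \<star> f"
    and tensor: "\<And>\<rho> \<sigma>. \<lbrakk>is_module \<rho>; is_module \<sigma>\<rbrakk>
      \<Longrightarrow> mtyped \<Theta> (mten \<rho> \<sigma>) = (mtyped \<Theta> \<rho> \<boxtimes> mtyped \<Theta> \<sigma>) \<star> tau \<sigma> \<rho> \<star> tau \<rho> \<sigma>"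
    unfolding is_mtwist_def by blast+
  show "braided_twist TC (module_braiding C R) \<Theta>"
  proof (intro braided_twist.intro module_category_braided braided_twist_axioms.intro)
    fix N assume "N \<in> Obj TC"
    then have N: "N \<in> modules C T" by simp
    obtain g where hom: "is_module_hom (act N) (act N) (mtyped \<Theta> (act N))" "is_module_hom (act N) (act N) g"
      and inv: "g \<star> mtyped \<Theta> (act N) = idt (fst N)" "mtyped \<Theta> (act N) \<star> g = idt (fst N)"
      using iso [of "act N"] N by auto
    obtain h where "h \<in> module_hom C T N N" and h: "g = Arr (fst N) h (fst N)"
      using hom(2) N N by (rule module_hom_cases)
    moreover have "h \<cdot> \<Theta> N = Id C (fst N)" "\<Theta> N \<cdot> h = Id C (fst N)"
      using inv unfolding h by (simp_all add: cmp_def idt_def)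
    moreover have "\<Theta> N \<in> module_hom C T N N"
      using hom(1) N by (simp add: module_hom_iff)
    ultimately show "\<Theta> N \<in> iso TC N N"
      by (auto simp: iso_def)
  next
    fix X Y f assume "X \<in> Obj TC" "Y \<in> Obj TC" "f \<in> Hom TC X Y"
    then show "f \<cdot>\<^bsub>TC\<^esub> \<Theta> X = \<Theta> Y \<cdot>\<^bsub>TC\<^esub> f"
      using natural [of "act X" "act Y" "Arr (fst X) f (fst Y)"] by (simp add: module_hom_iff cmp_def)
  next
    fix X Y assume "X \<in> Obj TC" "Y \<in> Obj TC"
    then show "\<Theta> (X \<odot>\<^bsub>TC\<^esub> Y) = (\<Theta> X \<otimes>\<^bsub>TC\<^esub> \<Theta> Y) \<cdot>\<^bsub>TC\<^esub> module_braiding C R Y X \<cdot>\<^bsub>TC\<^esub> module_braiding C R X Y"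
      using tensor [of "act X" "act Y"]
      unfolding act_tensor_module [symmetric] module_braiding_eq [symmetric]
      by (simp add: cmp_def ten_def)
  qed
qed

section \<open>The bijection between the two kinds of twists\<close>

lemma mtyped_module_twist:
  assumes "is_module \<rho>"
  shows "mtyped (module_twist C T \<theta>) \<rho> = \<rho> \<star> typed \<theta> (tgt \<rho>)"
proof -
  obtain N where "N \<in> modules C T" "\<rho> = act N"
    using assms by (rule module_cases)
  then show ?thesis
    by (cases N) (simp add: module_twist_def cmp_def)
qed

lemma braided_twist_module_twist:
  assumes "bimonad_twist C T R \<theta>"
  shows "braided_twist TC (module_braiding C R) (module_twist C T \<theta>)"
  using is_mtwist_act [of "typed \<theta>"] assms is_mtwist_cong [OF mtyped_module_twist [of _ \<theta>]]
  by (simp add: braided_twist_iff bimonad_twist_iff)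

lemma typed_eq_module_twist:
  assumes "bimonad_twist C T R \<theta>" "X \<in> Obj C"
  shows "typed \<theta> X = mtyped (module_twist C T \<theta>) (\<mu> X) \<star> \<eta> X"
proof -
  have "is_family (typed \<theta>)"
    using assms(1) by (simp add: bimonad_twist_iff is_twist_def)
  from twist_eq_free [OF this assms(2)] show ?thesis
    using mtyped_module_twist [of "\<mu> X" \<theta>] assms(2) by simp
qed

lemma bij_betw_module_twist:
  "bij_betw (module_twist C T) (bimonad_twists C T R) (braided_twists TC (module_braiding C R))"
proof (rule bij_betw_imageI)
  show "inj_on (module_twist C T) (bimonad_twists C T R)"
  proof (rule inj_onI)
    fix \<theta> \<theta>' assume \<theta>: "\<theta> \<in> bimonad_twists C T R" and \<theta>': "\<theta>' \<in> bimonad_twists C T R"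
      and eq: "module_twist C T \<theta> = module_twist C T \<theta>'"
    show "\<theta> = \<theta>'"
    proof (rule extensionalityI)
      show "\<theta> \<in> extensional (Obj C)" "\<theta>' \<in> extensional (Obj C)"
        using \<theta> \<theta>' by (simp_all add: bimonad_twists_def)
      fix X assume "X \<in> Obj C"
      then have "typed \<theta> X = typed \<theta>' X"
        using \<theta> \<theta>' eq typed_eq_module_twist [of \<theta> X] typed_eq_module_twist [of \<theta>' X]
        by (simp add: bimonad_twists_def)
      then show "\<theta> X = \<theta>' X"
        by simp
    qed
  qed
  show "module_twist C T ` bimonad_twists C T R = braided_twists TC (module_braiding C R)"
  proof (intro equalityI image_subsetI subsetI)
    fix \<theta> assume "\<theta> \<in> bimonad_twists C T R"
    then show "module_twist C T \<theta> \<in> braided_twists TC (module_braiding C R)"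
      using braided_twist_module_twist by (simp add: bimonad_twists_def braided_twists_def module_twist_def)
  next
    fix \<Theta> assume "\<Theta> \<in> braided_twists TC (module_braiding C R)"
    then have ext: "\<Theta> \<in> extensional (modules C T)" and tw: "is_mtwist (mtyped \<Theta>)"
      by (simp_all add: braided_twists_def braided_twist_iff)
    \<comment> \<open>The preimage is the action of \<open>\<Theta>\<close> on generators of free
      modules, restricted to \<open>Obj C\<close> to be extensional.\<close>
    define \<theta> where "\<theta> = (\<lambda>X \<in> Obj C. und (mtyped \<Theta> (\<mu> X) \<star> \<eta> X))"
    have typed: "typed \<theta> X = mtyped \<Theta> (\<mu> X) \<star> \<eta> X" if "X \<in> Obj C" for X
      using that by (intro arrow.expand) (simp add: \<theta>_def)
    have "bimonad_twist C T R \<theta>"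
      using is_twist_free [OF tw] is_twist_cong [OF typed] by (simp add: bimonad_twist_iff)
    then have "\<theta> \<in> bimonad_twists C T R"
      by (simp add: bimonad_twists_def \<theta>_def)
    moreover have "module_twist C T \<theta> = \<Theta>"
    proof (rule extensionalityI [OF _ ext])
      show "module_twist C T \<theta> \<in> extensional (modules C T)"
        by (simp add: module_twist_def)
      fix N assume N: "N \<in> modules C T"
      then have "mtyped (module_twist C T \<theta>) (act N) = mtyped \<Theta> (act N)"
        using mtyped_module_twist [of "act N" \<theta>] mtwist_eq_act [OF tw, of "act N"] typed [of "fst N"]
        by simp
      then show "module_twist C T \<theta> N = \<Theta> N"
        by simp
    qed
    ultimately show "\<Theta> \<in> module_twist C T ` bimonad_twists C T R"
      by blast
  qed
qed

section \<open>Self-duality\<close>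

lemma self_dual_bimonad_twist_iff:
  "self_dual_bimonad_twist C T sl \<theta>
    \<longleftrightarrow> (\<forall>X \<in> Obj C. dual (typed \<theta> X) = \<s> X \<star> typed \<theta> (ldual C (fobj T X)))"
  by (simp add: self_dual_bimonad_twist_def dual_def antipode_def cmp_def)

text \<open>Modules have the evaluations and coevaluations of their carriers, so the dual of a
  linear map is computed in the base category; only the dual object carries a new action.\<close>

lemma self_dual_braided_twist_iff:
  "self_dual_braided_twist TC \<Theta> \<longleftrightarrow> (\<forall>\<rho>. is_module \<rho> \<longrightarrow> dual (mtyped \<Theta> \<rho>) = mtyped \<Theta> (dact \<rho>))"
proof -
  have "(\<forall>\<rho>. is_module \<rho> \<longrightarrow> dual (mtyped \<Theta> \<rho>) = mtyped \<Theta> (dact \<rho>))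
      \<longleftrightarrow> (\<forall>N \<in> modules C T. dual (mtyped \<Theta> (act N)) = mtyped \<Theta> (act (ldual_module N)))"
    unfolding act_ldual_module using module_cases is_module_act by metis
  then show ?thesis
    by (simp add: self_dual_braided_twist_def dual_def ldual_arr_def)
qed

text \<open>From \<open>\<theta>\<close> to \<open>\<Theta>\<close>, dualizing the action
  contributes a factor \<open>dual \<rho>\<close>, which naturality carries past
  \<open>\<theta>\<close> to form \<open>dact \<rho>\<close>. Conversely, self-duality on free
  modules is restricted along \<open>\<eta>\<close>.\<close>

lemma self_dual_iff:
  assumes "bimonad_twist C T R \<theta>"
  shows "self_dual_bimonad_twist C T sl \<theta> \<longleftrightarrow> self_dual_braided_twist TC (module_twist C T \<theta>)"
proof -
  define t where "t = typed \<theta>"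
  have t: "is_family t"
    using assms by (simp add: t_def bimonad_twist_iff is_twist_def)
  note [simp] = is_familyD(1-3) [OF t]
  have nat: "F f \<star> t X = t Y \<star> f" if "arr f" "src f = X" "tgt f = Y" for f X Y
    using is_familyD(4) [OF t that] .
  have "(\<forall>X \<in> Obj C. dual (t X) = \<s> X \<star> t (ldual C (fobj T X)))
      \<longleftrightarrow> (\<forall>\<rho>. is_module \<rho> \<longrightarrow> dual (\<rho> \<star> t (tgt \<rho>)) = dact \<rho> \<star> t (ldual C (tgt \<rho>)))" (is "?L \<longleftrightarrow> ?R")
  proof (intro iffI allI impI ballI)
    fix \<rho> assume ?L and [simp]: "is_module \<rho>"
    let ?M = "tgt \<rho>"
    have "dual (\<rho> \<star> t ?M) = \<s> ?M \<star> t (ldual C (fobj T ?M)) \<star> dual \<rho>"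
      using \<open>?L\<close> by (simp add: dual_cmp)
    also have "t (ldual C (fobj T ?M)) \<star> dual \<rho> = F (dual \<rho>) \<star> t (ldual C ?M)"
      by (rule nat [symmetric]) simp_all
    finally show "dual (\<rho> \<star> t ?M) = dact \<rho> \<star> t (ldual C ?M)"
      by (simp add: dact_def)
  next
    fix X assume ?R and [simp]: "X \<in> Obj C"
    have "dual (t X) = dual (\<eta> X) \<star> dual (\<mu> X \<star> t (fobj T X))"
      using arg_cong [OF twist_eq_free [OF t, of X], of dual] by (simp add: dual_cmp)
    also have "dual (\<mu> X \<star> t (fobj T X)) = dact (\<mu> X) \<star> t (ldual C (fobj T X))"
      using \<open>?R\<close> [rule_format, of "\<mu> X"] by simp
    also have "dual (\<eta> X) \<star> dact (\<mu> X) \<star> t (ldual C (fobj T X))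
        = (dual (\<eta> X) \<star> \<s> (fobj T X)) \<star> F (dual (\<mu> X)) \<star> t (ldual C (fobj T X))"
      by (simp add: dact_def)
    \<comment> \<open>Naturality of the antipode at \<open>\<eta> X\<close> yields
      \<open>dual (F (\<eta> X))\<close>, which cancels with \<open>dual (\<mu> X)\<close> because
      \<open>\<mu> X \<star> F (\<eta> X)\<close> is the identity.\<close>
    also have "dual (\<eta> X) \<star> \<s> (fobj T X) = \<s> X \<star> F (dual (F (\<eta> X)))"
      using antipode_natural [of "\<eta> X"] by simp
    also have "(\<dots>) \<star> F (dual (\<mu> X)) \<star> t (ldual C (fobj T X))
        = \<s> X \<star> F (dual (\<mu> X \<star> F (\<eta> X))) \<star> t (ldual C (fobj T X))"
      by (simp add: dual_cmp F_cmp)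
    finally show "dual (t X) = \<s> X \<star> t (ldual C (fobj T X))"
      by (simp add: mul_F_unit)
  qed
  moreover have "mtyped (module_twist C T \<theta>) (dact \<rho>) = dact \<rho> \<star> t (ldual C (tgt \<rho>))"
    if "is_module \<rho>" for \<rho>
    using mtyped_module_twist [of "dact \<rho>" \<theta>] that by (simp add: t_def)
  ultimately show ?thesis
    unfolding self_dual_bimonad_twist_iff self_dual_braided_twist_iff
    using mtyped_module_twist [of _ \<theta>] by (simp add: t_def)
qed

end

theorem theorem8p13:
  fixes C :: "('o, 'm) autonomous"
    and T :: "('o, 'm) bimonad"
    and sl sr :: "'o \<Rightarrow> 'm"
    and R :: "'o \<Rightarrow> 'o \<Rightarrow> 'm"
  assumes "quasitriangular_hopf_monad C T sl sr R"
  defines "TC \<equiv> module_category C T sl sr"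
    and "\<tau> \<equiv> module_braiding C R"
  shows
    "(\<forall>\<theta>. bimonad_twist C T R \<theta> \<longrightarrow> braided_twist TC \<tau> (module_twist C T \<theta>))
     \<and> bij_betw (module_twist C T) (bimonad_twists C T R) (braided_twists TC \<tau>)
     \<and> (\<forall>\<theta>. bimonad_twist C T R \<theta> \<longrightarrow>
          (self_dual_bimonad_twist C T sl \<theta>
             \<longleftrightarrow> self_dual_braided_twist TC (module_twist C T \<theta>))
          \<and> (self_dual_bimonad_twist C T sl \<theta> \<longrightarrow> ribbon_hopf_monad C T sl sr R \<theta>)
          \<and> (self_dual_braided_twist TC (module_twist C T \<theta>)
               \<longrightarrow> ribbon_category TC \<tau> (module_twist C T \<theta>)))"
proof -
  interpret quasitriangular_hopf_monad C T sl sr R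
    by (rule assms(1))
  show ?thesis
    unfolding TC_def \<tau>_def
    using braided_twist_module_twist bij_betw_module_twist self_dual_iff
    by (auto intro!: ribbon_hopf_monad.intro ribbon_hopf_monad_axioms.intro ribbon_category.intro
        ribbon_category_axioms.intro assms(1) module_category_autonomous)
qed

end
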